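(* The sparse residual tree (SRT) algorithm needs $\mathcal{O}(N\log_2N)$ time and $\mathcal{O}(N\log_2N)$ space in the worst case to train an SRT for $N$ arbitrarily distributed points, and needs $\mathcal{O}(\log_2N)$ time in the worst case to make a prediction for a new point $x$. The costs of the sparse residual forest (SRF) algorithm, for an SRF with $n_t$ SRTs, are $n_t$ times those of the SRT.
   Context: Data: $N$ pairwise distinct points $X$ in a convex domain $\Omega\subset\mathbb{R}^d$ and values $f_X$ of a target function $f$; an expected relative absolute error $\epsilon_{\mathrm E}>0$, where the relative absolute error of an approximation $s$ is $\max_i|s(x_i)-f(x_i)|/\max_i|f(x_i)|$; and working parameters $\omega_1>0$ (upper bound of condition numbers), $\omega_2>0$ (termination error of explorations), $\omega_3\in(0,1)$ (factor of shape parameters), $\omega_4>0$ (termination factor of tree nodes). SRT algorithm. Starting at the root with $X'=X$, $\Omega'=\Omega$, residual $r'=f$, process each node $(X',\Omega')$, $X'=X\cap\Omega'$ of size $N'$, as follows. (1) Sparsification: choose randomly an index set $I$ of $N'_I\leqslant N'$ distinct indices, and work with the subset $X'(I)$ of $X'$. Here $N'_I$ is a certain fixed multiple (say $100$) of the average number $\bar n_c$ of centers over all currently existing nodes; at the root it is a fixed value related to $d$. (2) Exploration: set $\delta'=\sqrt{-\ln(\omega_3)/\max_{x'\in X'(I)}\|x'-\bar x\|_2^2}$, with $\bar x$ the mean of $X'(I)$. Starting with the centers inherited from the parent (at the root: the point of $X'(I)$ closest to $\bar x$), add centers one at a time. Given centers $\chi'_1,\dots,\chi'_j$, compute by recursive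 QR decomposition ($Q_jR_j=\Phi$, $\Phi$ the matrix of $e^{-\delta'^2\|x'-\chi'_i\|_2^2}$, $x'\in X'(I)$, $i\leqslant j$) the least squares approximation of $r'$ on $X'(I)$ by $\sum_{i\leqslant j}\alpha_j^{(i)}e^{-\delta'^2\|x-\chi'_i\|_2^2}$, and its residual $r'_j$. Form $j+d+1$ quasi-uniform points $U'_{j+d+1}\supset\{\chi'_1,\dots,\chi'_j\}$ of $X'(I)$, where each new quasi-uniform point maximizes over $X'(I)$ the minimal distance to the previous ones. The new center is the point of $U'_{j+d+1}\setminus\{\chi'_1,\dots,\chi'_j\}$ in whose Voronoi region (with respect to $U'_{j+d+1}$) the mean of $|r'_j|^2$ over $X'(I)$ is largest. Stop when $\max_l|R_{ll}|/\min_l|R_{ll}|>\omega_1$, or $\epsilon_j-\epsilon_{j+1}<\omega_2$ with $\epsilon_j=\big(\frac1{N'_I}\sum_{x'\in X'(I)}r'_j(x')^2\big)^{1/2}$, or $j+1=N'_I$. Update the residual on the full set $X'$: $r''=r'-\sum_i\alpha'_ie^{-\delta'^2\|\cdot-\chi'_i\|_2^2}$ with the final centers and coefficients. (3) Equal binary splitting: generate $d+1$ quasi-uniform points of $X'(I)$, now starting from the point of $X'(I)$ farthest from $\bar x$; let $x'_a$ be the one whose Voronoi region has the largest mean of $|r''|^2$ over $X'(I)$, and $x'_b$ the point of $X'(I)$ farthest from $x'_a$. Split $X'$ by the median $c'$ of the projections of its points onto $x'_b-x'_a$ into two subsets of sizes $\lceil N'/2\rceil$ and $N'-\lceil N'/2\rceil$,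 and split $\Omega'$ by the corresponding hyperplane. (4) Termination: a node is not processed further if the expected relative absolute error $\epsilon_{\mathrm E}$ is reached there, or if the size of one of its two split subsets is less than $\omega_4\bar n_c$ (the node is then recorded as lacking data). The SRT prediction at $x\in\Omega$ is the sum, over the nodes on the path from the root to the leaf whose subdomain contains $x$, of the Gaussian approximations found at those nodes. SRF algorithm. Build $n_t$ SRTs for the same data; in the SRTs other than the first, the median in step (3) is replaced by the $p_r$-th percentile, with $p_r$ an integer randomly selected from $37$ to $62$ inclusive. For $x\in\Omega$ let $s^{(i)}(x)$ be the $i$th SRT prediction, $\sigma_i^2(x)=\big(s^{(i)}(x)-\frac1{n_t}\sum_js^{(j)}(x)\big)^2$, and $I_F=\{i:\sigma_i^2(x)<\frac1{n_t}\sum_j\sigma_j^2(x)\}$; the SRF prediction is the average of $s^{(i)}(x)$ over $i\in I_F$. *)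

theory Defs
  imports "HOL-Analysis.Analysis" "HOL-Library.Landau_Symbols" "HOL-Library.Monad_Syntax"
begin

text \<open>
  The algorithms are programs for a real RAM: arithmetic, comparisons, \<open>sqrt\<close>, \<open>exp\<close> and \<open>ln\<close> on
  reals cost one time unit each. A computation is \<open>Some (v, t, s)\<close> if it terminates with value \<open>v\<close>
  after \<open>t\<close> time units, having allocated \<open>s\<close> memory cells; it is \<open>None\<close> if it diverges or gets
  stuck. Cells are never released, so \<open>s\<close> is an upper bound for the memory in use at any moment.
  Loops are least fixed points (\<open>partial_function\<close>), so termination is not built in.
  Only \<open>step\<close> introduces costs; it is used for elementary operations on reals, on d-vectors
  (cost proportional to d) and on lists (cost proportional to the cells visited or written).
\<close>

type_synonym 'a comp = "('a \<times> nat \<times> nat) option"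

definition step :: "nat \<Rightarrow> nat \<Rightarrow> 'a \<Rightarrow> 'a comp" where
  "step t s v = Some (v, t, s)"

definition ret :: "'a \<Rightarrow> 'a comp" where
  "ret v = step 0 0 v"

definition comp_bind :: "'a comp \<Rightarrow> ('a \<Rightarrow> 'b comp) \<Rightarrow> 'b comp" where
  "comp_bind m f =
     Option.bind m (\<lambda>(x, t, s). Option.bind (f x) (\<lambda>(y, t', s'). Some (y, t + t', s + s')))"

no_adhoc_overloading Monad_Syntax.bind \<rightleftharpoons> Option.bind
adhoc_overloading Monad_Syntax.bind \<rightleftharpoons> comp_bind

lemma comp_bind_mono [partial_function_mono]:
  assumes "mono_option B" and "\<And>y. mono_option (\<lambda>f. C y f)"
  shows "mono_option (\<lambda>f. comp_bind (B f) (\<lambda>y. C y f))"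
  unfolding comp_bind_def case_prod_unfold
  by (intro bind_mono assms option.const_mono)


section \<open>Lists\<close>

primrec mapM :: "('a \<Rightarrow> 'b comp) \<Rightarrow> 'a list \<Rightarrow> 'b list comp" where
  "mapM f [] = step 1 0 []"
| "mapM f (x # xs) = do { y \<leftarrow> f x; ys \<leftarrow> mapM f xs; step 1 1 (y # ys) }"

primrec foldM :: "('b \<Rightarrow> 'a \<Rightarrow> 'b comp) \<Rightarrow> 'b \<Rightarrow> 'a list \<Rightarrow> 'b comp" where
  "foldM f b [] = step 1 0 b"
| "foldM f b (x # xs) = do { b' \<leftarrow> f b x; b'' \<leftarrow> foldM f b' xs; step 1 0 b'' }"

primrec filterM :: "('a \<Rightarrow> bool comp) \<Rightarrow> 'a list \<Rightarrow> 'a list comp" where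
  "filterM p [] = step 1 0 []"
| "filterM p (x # xs) =
     do { b \<leftarrow> p x; ys \<leftarrow> filterM p xs; if b then step 1 1 (x # ys) else step 1 0 ys }"

definition lenM :: "'a list \<Rightarrow> nat comp" where
  "lenM xs = step (length xs + 1) 0 (length xs)"

definition zipM :: "'a list \<Rightarrow> 'b list \<Rightarrow> ('a \<times> 'b) list comp" where
  "zipM xs ys = step (length xs + 1) (2 * length xs) (zip xs ys)"

definition appendM :: "'a list \<Rightarrow> 'a list \<Rightarrow> 'a list comp" where
  "appendM xs ys = step (length xs + 1) (length xs) (xs @ ys)"

definition snocM :: "'a list \<Rightarrow> 'a \<Rightarrow> 'a list comp" where
  "snocM xs x = step (length xs + 1) (length xs + 1) (xs @ [x])"

definition takeM :: "nat \<Rightarrow> 'a list \<Rightarrow> 'a list comp" where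
  "takeM n xs = step (n + 1) n (take n xs)"

definition dropM :: "nat \<Rightarrow> 'a list \<Rightarrow> 'a list comp" where
  "dropM n xs = step (n + 1) 0 (drop n xs)"

definition nthM :: "'a list \<Rightarrow> nat \<Rightarrow> 'a comp" where
  "nthM xs i = (if i < length xs then step (i + 1) 0 (xs ! i) else None)"

definition sumM :: "('a \<Rightarrow> real comp) \<Rightarrow> 'a list \<Rightarrow> real comp" where
  "sumM f = foldM (\<lambda>a x. do { v \<leftarrow> f x; step 1 0 (a + v) }) 0"

text \<open>Maximum of nonnegative quantities.\<close>

definition maxM :: "('a \<Rightarrow> real comp) \<Rightarrow> 'a list \<Rightarrow> real comp" where
  "maxM f = foldM (\<lambda>a x. do { v \<leftarrow> f x; step 1 0 (max a v) }) 0"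

fun argmaxM :: "('a \<Rightarrow> real comp) \<Rightarrow> 'a list \<Rightarrow> 'a comp" where
  "argmaxM f [] = None"
| "argmaxM f (x # xs) = do {
     v \<leftarrow> f x;
     (y, _) \<leftarrow> foldM (\<lambda>(y, w) z. do { u \<leftarrow> f z; step 1 0 (if u > w then (z, u) else (y, w)) })
                 (x, v) xs;
     ret y }"

definition argminM :: "('a \<Rightarrow> real comp) \<Rightarrow> 'a list \<Rightarrow> 'a comp" where
  "argminM f = argmaxM (\<lambda>x. do { v \<leftarrow> f x; step 1 0 (- v) })"


section \<open>Selection of the k-th smallest element (median of medians)\<close>

primrec insertM :: "real \<Rightarrow> real list \<Rightarrow> real list comp" where
  "insertM x [] = step 1 1 [x]"
| "insertM x (y # ys) =
     (if x \<le> y then step 1 1 (x # y # ys) else do { zs \<leftarrow> insertM x ys; step 1 1 (y # zs) })"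

primrec sortM :: "real list \<Rightarrow> real list comp" where
  "sortM [] = step 1 0 []"
| "sortM (x # xs) = do { ys \<leftarrow> sortM xs; insertM x ys }"

fun chop5 :: "'a list \<Rightarrow> 'a list list" where
  "chop5 [] = []"
| "chop5 (x # xs) = take 5 (x # xs) # chop5 (drop 4 xs)"

definition median5 :: "real list \<Rightarrow> real comp" where
  "median5 xs = do { n \<leftarrow> lenM xs; ys \<leftarrow> sortM xs; nthM ys ((n - 1) div 2) }"

partial_function (option) select :: "nat \<Rightarrow> real list \<Rightarrow> real comp" where
  "select k xs = do {
     n \<leftarrow> lenM xs;
     if n \<le> 20 then do { ys \<leftarrow> sortM xs; nthM ys k }
     else do {
       gs \<leftarrow> step (n + 1) (2 * n) (chop5 xs);
       ms \<leftarrow> mapM median5 gs;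
       l \<leftarrow> lenM ms;
       m \<leftarrow> select ((l - 1) div 2) ms;
       lt \<leftarrow> filterM (\<lambda>x. step 1 0 (x < m)) xs;
       eq \<leftarrow> filterM (\<lambda>x. step 1 0 (x = m)) xs;
       gt \<leftarrow> filterM (\<lambda>x. step 1 0 (x > m)) xs;
       nl \<leftarrow> lenM lt;
       ne \<leftarrow> lenM eq;
       if k < nl then select k lt
       else if k < nl + ne then step 2 0 m
       else do { k' \<leftarrow> step 3 0 (k - nl - ne); select k' gt }
     }
   }"


section \<open>Vectors\<close>

definition vaddM :: "real^'d \<Rightarrow> real^'d \<Rightarrow> (real^'d) comp" where
  "vaddM x y = step CARD('d) CARD('d) (x + y)"

definition vsubM :: "real^'d \<Rightarrow> real^'d \<Rightarrow> (real^'d) comp" where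
  "vsubM x y = step CARD('d) CARD('d) (x - y)"

definition vscaleM :: "real \<Rightarrow> real^'d \<Rightarrow> (real^'d) comp" where
  "vscaleM a x = step CARD('d) CARD('d) (a *\<^sub>R x)"

definition innerM :: "real^'d \<Rightarrow> real^'d \<Rightarrow> real comp" where
  "innerM x y = step (2 * CARD('d)) 0 (x \<bullet> y)"

definition sqdistM :: "real^'d \<Rightarrow> real^'d \<Rightarrow> real comp" where
  "sqdistM x y = step (3 * CARD('d)) 0 ((norm (x - y))\<^sup>2)"

definition memberM :: "real^'d \<Rightarrow> (real^'d) list \<Rightarrow> bool comp" where
  "memberM x xs = step (CARD('d) * length xs + 1) 0 (x \<in> set xs)"

definition meanM :: "(real^'d) list \<Rightarrow> (real^'d) comp" where
  "meanM xs = do {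
     n \<leftarrow> lenM xs;
     v \<leftarrow> foldM vaddM 0 xs;
     a \<leftarrow> step 1 0 (1 / real n);
     vscaleM a v }"

definition gaussM :: "real \<Rightarrow> real^'d \<Rightarrow> real^'d \<Rightarrow> real comp" where
  "gaussM \<delta> c x = do { q \<leftarrow> sqdistM x c; step 4 0 (exp (- (\<delta>\<^sup>2 * q))) }"

definition dotM :: "real list \<Rightarrow> real list \<Rightarrow> real comp" where
  "dotM xs ys = do { zs \<leftarrow> zipM xs ys; sumM (\<lambda>(x, y). step 1 0 (x * y)) zs }"

definition axpyM :: "real \<Rightarrow> real list \<Rightarrow> real list \<Rightarrow> real list comp" where
  "axpyM a xs ys = do { zs \<leftarrow> zipM xs ys; mapM (\<lambda>(x, y). step 2 0 (a * x + y)) zs }"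

definition normM :: "real list \<Rightarrow> real comp" where
  "normM xs = do { q \<leftarrow> dotM xs xs; step 1 0 (sqrt q) }"

definition rmsM :: "real list \<Rightarrow> real comp" where
  "rmsM xs = do {
     n \<leftarrow> lenM xs;
     q \<leftarrow> sumM (\<lambda>x. step 1 0 (x\<^sup>2)) xs;
     step 2 0 (sqrt (q / real n)) }"


section \<open>Parameters, samples and trees\<close>

text \<open>
  \<open>n0\<close> is the sample size at the root, \<open>\<kappa>\<close> the fixed multiple of the average number of centers
  that determines the sample size at the other nodes.
\<close>

record srt_params =
  \<omega>1 :: real
  \<omega>2 :: real
  \<omega>3 :: real
  \<omega>4 :: real
  n0 :: nat
  \<kappa> :: real

text \<open>A data point of a node: location, current residual, and whether it is a center of the parent.\<close>

type_synonym 'd sample = "(real^'d) \<times> real \<times> bool"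

text \<open>A Gaussian approximation: shape parameter and the list of coefficient-center pairs.\<close>

type_synonym 'd approx = "real \<times> (real \<times> (real^'d)) list"

text \<open>
  \<open>Node g w c l r\<close>: the subdomain is cut by the hyperplane \<open>x \<bullet> w = c\<close>, \<open>l\<close> belonging to the side
  \<open>x \<bullet> w \<le> c\<close>. The flag of a leaf records lack of data.
\<close>

datatype 'd tree =
  Leaf "'d::finite approx" bool
| Node "'d approx" "real^'d" real "'d tree" "'d tree"

definition evalM :: "'d::finite approx \<Rightarrow> real^'d \<Rightarrow> real comp" where
  "evalM g x = sumM (\<lambda>(\<alpha>, c). do { k \<leftarrow> gaussM (fst g) c x; step 1 0 (\<alpha> * k) }) (snd g)"


section \<open>Sparsification\<close>

text \<open>
  Draws \<open>m\<close> entries without replacement; \<open>rnd\<close> is the stream of random numbers. Every selection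
  arises from some stream.
\<close>

primrec drawM :: "(nat \<Rightarrow> nat) \<Rightarrow> nat \<Rightarrow> nat \<Rightarrow> 'a list \<Rightarrow> 'a list comp" where
  "drawM rnd pos 0 xs = step 1 0 []"
| "drawM rnd pos (Suc m) xs = do {
     n \<leftarrow> lenM xs;
     i \<leftarrow> step 2 0 (rnd pos mod n);
     x \<leftarrow> nthM xs i;
     xs' \<leftarrow> step (n + 1) n (take i xs @ drop (Suc i) xs);
     ys \<leftarrow> drawM rnd (Suc pos) m xs';
     step 1 1 (x # ys) }"

text \<open>
  The subset consists of the inherited centers and random further points. It has \<open>sz\<close> elements,
  except that it cannot exceed the node and always has room for the inherited centers.
  Returned are the inherited centers, the subset, and the new position in the random stream.
\<close>

definition sparsifyM ::
  "(nat \<Rightarrow> nat) \<Rightarrow> nat \<Rightarrow> nat \<Rightarrow> 'd::finite sample list \<Rightarrow>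
     ((real^'d) list \<times> 'd sample list \<times> nat) comp" where
  "sparsifyM rnd pos sz X = do {
     inh \<leftarrow> filterM (\<lambda>(x, r, b). step 1 0 b) X;
     rest \<leftarrow> filterM (\<lambda>(x, r, b). step 1 0 (\<not> b)) X;
     N \<leftarrow> lenM X;
     j \<leftarrow> lenM inh;
     m \<leftarrow> step 3 0 (min N (max j sz) - j);
     ys \<leftarrow> drawM rnd pos m rest;
     S \<leftarrow> appendM inh ys;
     cs \<leftarrow> mapM (\<lambda>(x, r, b). step 1 0 x) inh;
     step 1 3 (cs, S, pos + m) }"


section \<open>Quasi-uniform points and Voronoi regions\<close>

text \<open>
  \<open>argmaxM\<close> and \<open>argminM\<close> return the first optimum; in particular a point equidistant from several
  sites belongs to the Voronoi region of the first of them.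
\<close>

definition min_sqdistM :: "(real^'d) list \<Rightarrow> real^'d \<Rightarrow> real comp" where
  "min_sqdistM U x = do { u \<leftarrow> argminM (sqdistM x) U; sqdistM x u }"

primrec quasiM :: "nat \<Rightarrow> (real^'d) list \<Rightarrow> (real^'d) list \<Rightarrow> (real^'d) list comp" where
  "quasiM 0 S U = ret U"
| "quasiM (Suc m) S U = do { u \<leftarrow> argmaxM (min_sqdistM U) S; U' \<leftarrow> snocM U u; quasiM m S U' }"

text \<open>Mean of the squared residual over the Voronoi region of \<open>u\<close> with respect to \<open>U\<close>.\<close>

definition region_meanM ::
  "(real^'d) list \<Rightarrow> ((real^'d) \<times> real) list \<Rightarrow> real^'d \<Rightarrow> real comp" where
  "region_meanM U sr u = do {
     (a, n) \<leftarrow> foldM (\<lambda>(a, n) (x, r). do {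
         v \<leftarrow> argminM (sqdistM x) U;
         b \<leftarrow> step CARD('d) 0 (v = u);
         step 3 0 (if b then (a + r\<^sup>2, n + 1) else (a, n)) }) (0, 0 :: real) sr;
     step 1 0 (a / n) }"


section \<open>Exploration\<close>

text \<open>
  The columns \<open>qcols\<close> of Q (entries indexed by the sample), the columns \<open>rcols\<close> of R (the l-th one
  consisting of its first l entries), \<open>qtr\<close> = the product of the transpose of Q with the node's
  initial residual, and \<open>resid\<close> = the residual of the least squares approximation on the sample.
\<close>

record ('d::finite) fit =
  centers :: "(real^'d) list"
  qcols :: "real list list"
  rcols :: "real list list"
  qtr :: "real list"
  resid :: "real list"

text \<open>
  Gram-Schmidt step for a new center. If the new column depends linearly on the previous ones,
  the new diagonal entry of R is 0 and the new column of Q is 0 (as \<open>x / 0 = 0\<close>).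
\<close>

definition add_centerM ::
  "real \<Rightarrow> (real^'d) list \<Rightarrow> ('d::finite) fit \<Rightarrow> real^'d \<Rightarrow> 'd fit comp" where
  "add_centerM \<delta> S F c = do {
     \<phi> \<leftarrow> mapM (gaussM \<delta> c) S;
     (v, hs) \<leftarrow> foldM (\<lambda>(v, hs) q. do {
         h \<leftarrow> dotM q v; v' \<leftarrow> axpyM (- h) q v; hs' \<leftarrow> snocM hs h; ret (v', hs') }) (\<phi>, []) (qcols F);
     \<rho> \<leftarrow> normM v;
     q \<leftarrow> mapM (\<lambda>a. step 1 0 (a / \<rho>)) v;
     b \<leftarrow> dotM q (resid F);
     r \<leftarrow> axpyM (- b) q (resid F);
     col \<leftarrow> snocM hs \<rho>;
     cs \<leftarrow> snocM (centers F) c;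
     qs \<leftarrow> snocM (qcols F) q;
     rs \<leftarrow> snocM (rcols F) col;
     bs \<leftarrow> snocM (qtr F) b;
     step 1 5 \<lparr>centers = cs, qcols = qs, rcols = rs, qtr = bs, resid = r\<rparr> }"

text \<open>
  \<open>max |R\<^sub>l\<^sub>l| / min |R\<^sub>l\<^sub>l| > \<omega>\<^sub>1\<close>, multiplied out so that a vanishing diagonal entry counts as
  an infinite quotient.
\<close>

definition ill_conditionedM :: "srt_params \<Rightarrow> ('d::finite) fit \<Rightarrow> bool comp" where
  "ill_conditionedM P F = do {
     ds \<leftarrow> mapM (\<lambda>col. step (length col + 1) 0 \<bar>last col\<bar>) (rcols F);
     mx \<leftarrow> maxM (step 1 0) ds;
     mn \<leftarrow> foldM (\<lambda>a x. step 1 0 (min a x)) mx ds;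
     step 2 0 (mx > \<omega>1 P * mn) }"

text \<open>
  If fewer than d + 1 points of the sample are left, all of them become quasi-uniform points.
\<close>

definition new_centerM :: "(real^'d) list \<Rightarrow> ('d::finite) fit \<Rightarrow> (real^'d) comp" where
  "new_centerM S F = do {
     n \<leftarrow> lenM S;
     j \<leftarrow> lenM (centers F);
     m \<leftarrow> step 3 0 (min (CARD('d) + 1) (n - j));
     U \<leftarrow> quasiM m S (centers F);
     us \<leftarrow> dropM j U;
     sr \<leftarrow> zipM S (resid F);
     argmaxM (region_meanM U sr) us }"

partial_function (option) explore_loopM ::
  "srt_params \<Rightarrow> real \<Rightarrow> (real^'d) list \<Rightarrow> ('d::finite) fit \<Rightarrow> 'd fit comp" where
  "explore_loopM P \<delta> S F = do {
     ill \<leftarrow> ill_conditionedM P F;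
     n \<leftarrow> lenM S;
     j \<leftarrow> lenM (centers F);
     full \<leftarrow> step 1 0 (j \<ge> n);
     if ill \<or> full then ret F
     else do {
       c \<leftarrow> new_centerM S F;
       F' \<leftarrow> add_centerM \<delta> S F c;
       e \<leftarrow> rmsM (resid F);
       e' \<leftarrow> rmsM (resid F');
       conv \<leftarrow> step 2 0 (e - e' < \<omega>2 P);
       if conv then ret F' else explore_loopM P \<delta> S F'
     }
   }"

text \<open>
  Solution of the triangular system for the coefficients; the columns of R come in reverse order.
  Together with \<open>x / 0 = 0\<close> this yields a least squares solution also in the rank deficient case.
\<close>

primrec backsubM :: "real list list \<Rightarrow> real list \<Rightarrow> real list \<Rightarrow> real list comp" where
  "backsubM [] b acc = step 1 0 acc"
| "backsubM (col # cols) b acc = do {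
     a \<leftarrow> step (length col + length b + 1) 0 (last b / last col);
     col' \<leftarrow> step (length col + 1) (length col) (butlast col);
     b' \<leftarrow> step (length b + 1) (length b) (butlast b);
     b'' \<leftarrow> axpyM (- a) col' b';
     acc' \<leftarrow> step 1 1 (a # acc);
     backsubM cols b'' acc' }"

text \<open>
  \<open>inh\<close> are the inherited centers, \<open>sr\<close> the sampled points with their residuals. Without inherited
  centers (as at the root) the sampled point closest to the mean is the first center.
\<close>

definition exploreM ::
  "srt_params \<Rightarrow> (real^'d) list \<Rightarrow> 'd::finite sample list \<Rightarrow> 'd approx comp" where
  "exploreM P inh sr = do {
     S \<leftarrow> mapM (\<lambda>(x, r, b). step 1 0 x) sr;
     rs \<leftarrow> mapM (\<lambda>(x, r, b). step 1 0 r) sr;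
     xm \<leftarrow> meanM S;
     q \<leftarrow> maxM (sqdistM xm) S;
     \<delta> \<leftarrow> step 4 0 (sqrt (- ln (\<omega>3 P) / q));
     start \<leftarrow> (if inh = [] then do { c \<leftarrow> argminM (sqdistM xm) S; step 2 1 [c] } else step 1 0 inh);
     F0 \<leftarrow> step 1 5 \<lparr>centers = [], qcols = [], rcols = [], qtr = [], resid = rs\<rparr>;
     F1 \<leftarrow> foldM (add_centerM \<delta> S) F0 start;
     F \<leftarrow> explore_loopM P \<delta> S F1;
     cols \<leftarrow> step (length (rcols F) + 1) (length (rcols F)) (rev (rcols F));
     \<alpha>s \<leftarrow> backsubM cols (qtr F) [];
     ac \<leftarrow> zipM \<alpha>s (centers F);
     step 1 2 (\<delta>, ac) }"

text \<open>Update of the residuals; the flags now mark the centers of the current node.\<close>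

definition updateM ::
  "'d approx \<Rightarrow> 'd::finite sample list \<Rightarrow> 'd sample list comp" where
  "updateM g X = do {
     cs \<leftarrow> mapM (\<lambda>(\<alpha>, c). step 1 0 c) (snd g);
     mapM (\<lambda>(x, r, b). do {
       v \<leftarrow> evalM g x;
       b' \<leftarrow> memberM x cs;
       step 1 3 (x, r - v, b') }) X }"


section \<open>Binary splitting\<close>

text \<open>
  Normal \<open>x\<^sub>b - x\<^sub>a\<close> of the splitting hyperplane, from the sampled points with their updated
  residuals.
\<close>

definition directionM :: "'d::finite sample list \<Rightarrow> (real^'d) comp" where
  "directionM sr3 = do {
     S \<leftarrow> mapM (\<lambda>(x, r, b). step 1 0 x) sr3;
     sr \<leftarrow> mapM (\<lambda>(x, r, b). step 1 2 (x, r)) sr3;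
     n \<leftarrow> lenM S;
     m \<leftarrow> step 2 0 (min CARD('d) (n - 1));
     xm \<leftarrow> meanM S;
     u \<leftarrow> argmaxM (sqdistM xm) S;
     U0 \<leftarrow> step 1 1 [u];
     U \<leftarrow> quasiM m S U0;
     xa \<leftarrow> argmaxM (region_meanM U sr) U;
     xb \<leftarrow> argmaxM (sqdistM xa) S;
     vsubM xb xa }"

text \<open>
  Split at the \<open>p\<close>-th percentile of the projections onto \<open>w\<close> (the median for \<open>p = 50\<close>). The first
  part has \<open>\<lceil>p N' / 100\<rceil>\<close> elements; points projected exactly onto the percentile are distributed
  so that the sizes are met.
\<close>

definition splitM ::
  "nat \<Rightarrow> real^'d \<Rightarrow> 'd::finite sample list \<Rightarrow> (real \<times> 'd sample list \<times> 'd sample list) comp" where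
  "splitM p w X = do {
     N \<leftarrow> lenM X;
     k \<leftarrow> step 3 0 ((p * N + 99) div 100);
     vX \<leftarrow> mapM (\<lambda>(x, r, b). do { v \<leftarrow> innerM x w; step 1 2 (v, (x, r, b)) }) X;
     vs \<leftarrow> mapM (\<lambda>(v, y). step 1 0 v) vX;
     k' \<leftarrow> step 1 0 (k - 1);
     c \<leftarrow> select k' vs;
     lt \<leftarrow> filterM (\<lambda>(v, y). step 1 0 (v < c)) vX;
     eq \<leftarrow> filterM (\<lambda>(v, y). step 1 0 (v = c)) vX;
     gt \<leftarrow> filterM (\<lambda>(v, y). step 1 0 (v > c)) vX;
     nl \<leftarrow> lenM lt;
     i \<leftarrow> step 1 0 (k - nl);
     eq1 \<leftarrow> takeM i eq;
     eq2 \<leftarrow> dropM i eq;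
     A \<leftarrow> appendM lt eq1;
     B \<leftarrow> appendM eq2 gt;
     A' \<leftarrow> mapM (\<lambda>(v, y). step 1 0 y) A;
     B' \<leftarrow> mapM (\<lambda>(v, y). step 1 0 y) B;
     step 1 3 (c, A', B') }"


section \<open>Sparse residual tree\<close>

text \<open>
  The global state \<open>(pos, nodes, total)\<close> holds the position in the random stream, the number of
  nodes processed so far and their total number of centers; the average number of centers over the
  existing nodes is \<open>total / nodes\<close>. Nodes are processed depth first. \<open>M\<close> is the maximal modulus
  of the data values, and \<open>perc n\<close> is the percentile used at the n-th node.
\<close>

partial_function (option) buildM ::
  "srt_params \<Rightarrow> real \<Rightarrow> real \<Rightarrow> (nat \<Rightarrow> nat) \<Rightarrow> (nat \<Rightarrow> nat) \<Rightarrow> 'd::finite sample list \<Rightarrow>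
     nat \<times> nat \<times> nat \<Rightarrow> ('d tree \<times> nat \<times> nat \<times> nat) comp" where
  "buildM P \<epsilon> M rnd perc X st = do {
     (pos, nodes, total) \<leftarrow> step 1 1 st;
     sz \<leftarrow> step 4 0 (if nodes = 0 then n0 P else nat \<lceil>\<kappa> P * (real total / real nodes)\<rceil>);
     (inh, sr, pos') \<leftarrow> sparsifyM rnd pos sz X;
     g \<leftarrow> exploreM P inh sr;
     X' \<leftarrow> updateM g X;
     sr' \<leftarrow> updateM g sr;
     nc \<leftarrow> lenM (snd g);
     (nodes', total') \<leftarrow> step 2 2 (nodes + 1, total + nc);
     w \<leftarrow> directionM sr';
     p \<leftarrow> step 1 0 (perc nodes);
     (c, A, B) \<leftarrow> splitM p w X';
     err \<leftarrow> maxM (\<lambda>(x, r, b). step 1 0 \<bar>r\<bar>) X';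
     accurate \<leftarrow> step 2 0 (err / M \<le> \<epsilon>);
     nA \<leftarrow> lenM A;
     nB \<leftarrow> lenM B;
     lacking \<leftarrow> step 5 0 (real (min nA nB) < \<omega>4 P * (real total' / real nodes'));
     if accurate \<or> lacking
     then step 1 6 (Leaf g (\<not> accurate), pos', nodes', total')
     else do {
       (l, st1) \<leftarrow> buildM P \<epsilon> M rnd perc A (pos', nodes', total');
       (r, st2) \<leftarrow> buildM P \<epsilon> M rnd perc B st1;
       step 1 9 (Node g w c l r, st2)
     }
   }"

definition srt_trainM ::
  "srt_params \<Rightarrow> real \<Rightarrow> (nat \<Rightarrow> nat) \<Rightarrow> (nat \<Rightarrow> nat) \<Rightarrow> ((real^'d::finite) \<times> real) list \<Rightarrow> 'd tree comp" where
  "srt_trainM P \<epsilon> rnd perc D = do {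
     M \<leftarrow> maxM (\<lambda>(x, y). step 1 0 \<bar>y\<bar>) D;
     X \<leftarrow> mapM (\<lambda>(x, y). step 1 3 (x, y, False)) D;
     (T, _) \<leftarrow> buildM P \<epsilon> M rnd perc X (0, 0, 0);
     ret T }"

abbreviation median_splits :: "nat \<Rightarrow> nat" where
  "median_splits \<equiv> \<lambda>_. 50"

primrec srt_predictM :: "'d::finite tree \<Rightarrow> real^'d \<Rightarrow> real comp" where
  "srt_predictM (Leaf g b) x = do { v \<leftarrow> evalM g x; step 1 0 v }"
| "srt_predictM (Node g w c l r) x = do {
     v \<leftarrow> evalM g x;
     t \<leftarrow> innerM x w;
     u \<leftarrow> (if t \<le> c then srt_predictM l x else srt_predictM r x);
     step 3 0 (v + u) }"


section \<open>Sparse residual forest\<close>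

definition srf_trainM ::
  "srt_params \<Rightarrow> real \<Rightarrow> (nat \<Rightarrow> nat \<Rightarrow> nat) \<Rightarrow> (nat \<Rightarrow> nat \<Rightarrow> nat) \<Rightarrow> nat \<Rightarrow> ((real^'d::finite) \<times> real) list \<Rightarrow>
     'd tree list comp" where
  "srf_trainM P \<epsilon> rnds percs nt D =
     mapM (\<lambda>i. srt_trainM P \<epsilon> (rnds i) (if i = 0 then median_splits else percs i) D) [0..<nt]"

text \<open>
  If all predictions have the same deviation (for instance for a single tree), no index is selected
  and the average over the empty set is \<open>0 / 0 = 0\<close>.
\<close>

definition srf_predictM :: "'d::finite tree list \<Rightarrow> real^'d \<Rightarrow> real comp" where
  "srf_predictM Ts x = do {
     ss \<leftarrow> mapM (\<lambda>T. srt_predictM T x) Ts;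
     n \<leftarrow> lenM ss;
     a \<leftarrow> sumM (step 1 0) ss;
     m \<leftarrow> step 1 0 (a / real n);
     vs \<leftarrow> mapM (\<lambda>s. step 2 2 (s, (s - m)\<^sup>2)) ss;
     b \<leftarrow> sumM (\<lambda>(s, v). step 1 0 v) vs;
     mv \<leftarrow> step 1 0 (b / real n);
     sel \<leftarrow> filterM (\<lambda>(s, v). step 1 0 (v < mv)) vs;
     k \<leftarrow> lenM sel;
     tot \<leftarrow> sumM (\<lambda>(s, v). step 1 0 s) sel;
     step 1 0 (tot / real k) }"

end

(*
  In units of the inverse shape parameter all centers of a node lie in a ball of fixed radius. So
  among K of them, K depending only on the dimension, omega_1 and omega_3, two are so close that their
  columns almost coincide, which forces a tiny diagonal entry of R: exploration stops with at most K
  centers, and the samples have bounded size as well. Everything else at a node is linear in its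
  number of points, the percentile included, by median of medians. Neither part of a split node has
  more than 4/5 of its points, so the depth is logarithmic and each level costs O(N).
*)
theory Submission
  imports Defs
begin

text \<open>The bound K must not grow with the sample, whose size is itself a multiple of the
  average number of centers. It does not: the norm of the first column and the distance of two
  columns carry the same factor, the square root of the sample size, so only single entries have to
  be compared. The circle is then broken by the order of choice: first K, next a bound for all
  samples, last the cost constants. The sample size at a node depends on all nodes processed before,
  through the global average. The invariant \<open>state_ok\<close> keeps this average between 1 and
  K. Inherited centers are inserted without a condition test, so their number has to be bounded
  separately: the data points are distinct, and the marked points of a part are centers of its
  parent. Termination comes out together with the bounds. Exploration consumes the difference
  between K and the number of centers. A node with an empty part is a leaf, because
  \<open>\<omega>4\<close> times the average is positive, so every split node has two smaller
  parts.\<close>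

section \<open>Resource bounds\<close>

text \<open>One number bounds time and space together, and the equation with \<open>Some\<close>
  contains termination, so a bound for a \<open>partial_function\<close> also proves that it
  converges. The sizes on which later costs depend travel through the postcondition
  \<open>Q\<close>.\<close>

definition run :: "'a comp \<Rightarrow> nat \<Rightarrow> ('a \<Rightarrow> bool) \<Rightarrow> bool" where
  "run m b Q \<longleftrightarrow> (\<exists>v t s. m = Some (v, t, s) \<and> t \<le> b \<and> s \<le> b \<and> Q v)"

lemma run_mono: "run m b Q \<Longrightarrow> b \<le> b' \<Longrightarrow> run m b' Q"
  unfolding run_def by fastforce

lemma run_weaken: "run m b Q \<Longrightarrow> (\<And>v. Q v \<Longrightarrow> R v) \<Longrightarrow> run m b R"
  unfolding run_def by blast

lemma run_step: "Q v \<Longrightarrow> run (step t s v) (t + s) Q"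
  unfolding run_def step_def by simp

lemma run_ret: "Q v \<Longrightarrow> run (ret v) 0 Q"
  unfolding run_def ret_def step_def by simp

text \<open>Chaining this rule along a \<open>do\<close> block yields the right-nested sum of the
  costs of its statements. The long literal bounds in later statements have exactly this
  shape.\<close>

lemma run_bind:
  assumes "run m b P" and "\<And>v. P v \<Longrightarrow> run (f v) b' Q"
  shows "run (comp_bind m f) (b + b') Q"
proof -
  obtain v t s where m: "m = Some (v, t, s)" "t \<le> b" "s \<le> b" "P v"
    using assms(1) unfolding run_def by blast
  moreover obtain w t' s' where "f v = Some (w, t', s')" "t' \<le> b'" "s' \<le> b'" "Q w"
    using assms(2)[OF m(4)] unfolding run_def by blast
  ultimately show ?thesis
    unfolding run_def comp_bind_def by simp
qed

lemma run_bind_step: "run (f v) b Q \<Longrightarrow> run (comp_bind (step t s v) f) (t + s + b) Q"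
  by (rule run_bind[OF run_step[where Q = "\<lambda>w. w = v"]]) simp_all

text \<open>Adding the branches, instead of taking the maximum, keeps all bounds polynomial.\<close>

lemma run_if: "(c \<Longrightarrow> run m b Q) \<Longrightarrow> (\<not> c \<Longrightarrow> run m' b' Q) \<Longrightarrow>
    run (if c then m else m') (b + b') Q"
  by (auto intro: run_mono)

section \<open>Costs of the list operations\<close>

lemma linear_mono: "i \<le> n \<Longrightarrow> i * c + d \<le> n * c + (d :: nat)"
  by simp

text \<open>For entries known only through properties, such as updated samples or trained trees. The
  2 is one unit of time and one cell for each entry of the result.\<close>

lemma run_mapM_rel:
  assumes "\<And>x. x \<in> set xs \<Longrightarrow> run (f x) b (Q x)"
  shows "run (mapM f xs) (length xs * (b + 2) + 1) (list_all2 Q xs)"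
  using assms
proof (induction xs)
  case Nil
  show ?case by (simp, rule run_mono[OF run_step]) simp_all
next
  case (Cons x xs)
  have 1: "run (f x) b (Q x)" "run (mapM f xs) (length xs * (b + 2) + 1) (list_all2 Q xs)"
    using Cons by auto
  show ?case unfolding mapM.simps
    by (rule run_mono, rule run_bind[OF 1(1)], rule run_bind[OF 1(2)], rule run_step) simp_all
qed

lemma run_mapM:
  assumes "\<And>x. x \<in> set xs \<Longrightarrow> run (f x) b (\<lambda>v. v = g x)" and "length xs \<le> n"
  shows "run (mapM f xs) (n * (b + 2) + 1) (\<lambda>ys. ys = map g xs)"
  by (rule run_mono[OF run_weaken[OF run_mapM_rel] linear_mono[OF assms(2)]], rule assms(1),
      assumption) (auto simp: list_all2_conv_all_nth intro: nth_equalityI)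

text \<open>The invariant sees the position, so it can speak of the prefix already consumed: the
  columns of Q already orthogonalized against, or the centers already inserted.\<close>

lemma run_foldM_nth:
  assumes "\<And>i a. i < length xs \<Longrightarrow> I i a \<Longrightarrow> run (f a (xs ! i)) b (I (Suc i))" and "I 0 a"
  shows "run (foldM f a xs) (length xs * (b + 1) + 1) (I (length xs))"
  using assms
proof (induction xs arbitrary: I a)
  case Nil
  then show ?case using run_step[of "I 0" a 1 0] by simp
next
  case (Cons x xs)
  have 1: "run (f a x) b (I 1)" using Cons.prems(1)[of 0 a] Cons.prems(2) by simp
  have 2: "run (foldM f a' xs) (length xs * (b + 1) + 1) (I (length (x # xs)))" if "I 1 a'" for a'
    using Cons.IH[of "\<lambda>i. I (Suc i)" a'] Cons.prems(1)[of "Suc _"] that by simp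
  show ?case unfolding foldM.simps
    by (rule run_mono, rule run_bind[OF 1], rule run_bind[OF 2], assumption, rule run_step,
        assumption) simp
qed

lemma run_foldM:
  assumes "\<And>x a. x \<in> set xs \<Longrightarrow> I a \<Longrightarrow> run (f a x) b I" and "I a" and "length xs \<le> n"
  shows "run (foldM f a xs) (n * (b + 1) + 1) I"
  by (rule run_mono[OF run_foldM_nth[where I = "\<lambda>_. I"] linear_mono[OF assms(3)]])
     (use assms(1,2) in auto)

lemma run_foldM_fun:
  assumes "\<And>x a. x \<in> set xs \<Longrightarrow> run (f a x) b (\<lambda>v. v = g a x)" and "length xs \<le> n"
  shows "run (foldM f a xs) (n * (b + 1) + 1) (\<lambda>v. v = foldl g a xs)"
  using assms
proof (induction xs arbitrary: a n)
  case Nil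
  show ?case by (simp, rule run_mono[OF run_step]) simp_all
next
  case (Cons x xs)
  have 1: "run (f a x) b (\<lambda>v. v = g a x)" by (simp add: Cons.prems)
  have 2: "run (foldM f (g a x) xs) (length xs * (b + 1) + 1) (\<lambda>v. v = foldl g a (x # xs))"
    using Cons.IH[of "length xs" "g a x"] Cons.prems by simp
  show ?case unfolding foldM.simps
    by (rule run_mono, rule run_bind[OF 1], simp only:, rule run_bind[OF 2], simp only:,
        rule run_step, rule refl, rule order_trans[OF _ linear_mono[OF Cons.prems(2)]]) simp
qed

lemma run_filterM:
  assumes "\<And>x. x \<in> set xs \<Longrightarrow> run (p x) b (\<lambda>v. v = q x)" and "length xs \<le> n"
  shows "run (filterM p xs) (n * (b + 3) + 1) (\<lambda>ys. ys = filter q xs)"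
proof (rule run_mono)
  show "run (filterM p xs) (length xs * (b + 3) + 1) (\<lambda>ys. ys = filter q xs)"
    using assms(1)
  proof (induction xs)
    case Nil
    show ?case by (simp, rule run_mono[OF run_step]) simp_all
  next
    case (Cons x xs)
    have 1: "run (p x) b (\<lambda>v. v = q x)"
      and 2: "run (filterM p xs) (length xs * (b + 3) + 1) (\<lambda>ys. ys = filter q xs)"
      by (rule Cons.prems, simp) (rule Cons.IH, rule Cons.prems, simp)
    show ?case unfolding filterM.simps
      by (rule run_mono, rule run_bind[OF 1], rule run_bind[OF 2], rule run_if[OF run_step run_step])
         simp_all
  qed
qed (rule linear_mono[OF assms(2)])

lemma run_lenM: "length xs \<le> n \<Longrightarrow> run (lenM xs) (n + 1) (\<lambda>v. v = length xs)"
  unfolding lenM_def by (rule run_mono[OF run_step]) simp_all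

lemma run_zipM: "length xs \<le> n \<Longrightarrow> run (zipM xs ys) (3 * n + 1) (\<lambda>v. v = zip xs ys)"
  unfolding zipM_def by (rule run_mono[OF run_step]) simp_all

lemma run_appendM: "length xs \<le> n \<Longrightarrow> run (appendM xs ys) (2 * n + 1) (\<lambda>v. v = xs @ ys)"
  unfolding appendM_def by (rule run_mono[OF run_step]) simp_all

lemma run_snocM: "length xs \<le> n \<Longrightarrow> run (snocM xs x) (2 * n + 2) (\<lambda>v. v = xs @ [x])"
  unfolding snocM_def by (rule run_mono[OF run_step]) simp_all

lemma run_takeM: "k \<le> n \<Longrightarrow> run (takeM k xs) (2 * n + 1) (\<lambda>v. v = take k xs)"
  unfolding takeM_def by (rule run_mono[OF run_step]) simp_all

lemma run_dropM: "k \<le> n \<Longrightarrow> run (dropM k xs) (n + 1) (\<lambda>v. v = drop k xs)"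
  unfolding dropM_def by (rule run_mono[OF run_step]) simp_all

lemma run_nthM: "i < length xs \<Longrightarrow> length xs \<le> n \<Longrightarrow> run (nthM xs i) n (\<lambda>v. v = xs ! i)"
  unfolding nthM_def by simp (rule run_mono[OF run_step], simp_all)

lemma run_sumM:
  assumes "\<And>x. x \<in> set xs \<Longrightarrow> run (f x) b (\<lambda>v. v = g x)" and "length xs \<le> n"
  shows "run (sumM f xs) (n * (b + 2) + 1) (\<lambda>v. v = sum_list (map g xs))"
proof -
  have "run (do { v \<leftarrow> f x; step 1 0 (a + v) }) (b + 1) (\<lambda>v. v = a + g x)" if "x \<in> set xs" for x a
    by (rule run_mono, rule run_bind[OF assms(1)[OF that]], rule run_step) simp_all
  then have "run (sumM f xs) (n * (b + 1 + 1) + 1) (\<lambda>v. v = foldl (\<lambda>a x. a + g x) 0 xs)"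
    unfolding sumM_def by (intro run_foldM_fun assms(2)) auto
  moreover have "foldl (\<lambda>a x. a + g x) a xs = a + sum_list (map g xs)" for a
    by (induction xs arbitrary: a) (auto simp: algebra_simps)
  ultimately show ?thesis by simp
qed

lemma run_sumM_any:
  assumes "\<And>x. x \<in> set xs \<Longrightarrow> run (f x) b (\<lambda>_. True)" and "length xs \<le> n"
  shows "run (sumM f xs) (n * (b + 2) + 1) (\<lambda>_. True)"
proof -
  \<comment> \<open>Computations are deterministic, so the value of \<open>f x\<close> itself can
    serve as the function required by \<open>run_sumM\<close>.\<close>
  have "run (f x) b (\<lambda>v. v = fst (the (f x)))" if "x \<in> set xs" for x
    using assms(1)[OF that] by (auto simp: run_def)
  from run_weaken[OF run_sumM[OF this assms(2)]] show ?thesis by simp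
qed

lemma run_maxM:
  assumes "\<And>x. x \<in> set xs \<Longrightarrow> run (f x) b (\<lambda>v. v = g x)" and "length xs \<le> n"
  shows "run (maxM f xs) (n * (b + 2) + 1) (\<lambda>v. 0 \<le> v \<and> (\<forall>x\<in>set xs. g x \<le> v))"
proof -
  have "run (do { v \<leftarrow> f x; step 1 0 (max a v) }) (b + 1) (\<lambda>v. v = max a (g x))"
    if "x \<in> set xs" for x a
    by (rule run_mono, rule run_bind[OF assms(1)[OF that]], rule run_step) simp_all
  then have "run (maxM f xs) (n * (b + 1 + 1) + 1) (\<lambda>v. v = foldl (\<lambda>a x. max a (g x)) 0 xs)"
    unfolding maxM_def by (intro run_foldM_fun assms(2)) auto
  moreover have "a \<le> foldl (\<lambda>a x. max a (g x)) a xs \<and>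
      (\<forall>x\<in>set xs. g x \<le> foldl (\<lambda>a x. max a (g x)) a xs)" for a
    by (induction xs arbitrary: a) (auto, (meson max.bounded_iff)+)
  ultimately show ?thesis by (auto elim: run_weaken)
qed

text \<open>The bounds hold for any choice from the list. Membership is what keeps centers and
  quasi-uniform points inside the sample.\<close>

lemma run_argmaxM:
  assumes "xs \<noteq> []" and "\<And>x. x \<in> set xs \<Longrightarrow> run (f x) b (\<lambda>_. True)" and "length xs \<le> n"
  shows "run (argmaxM f xs) ((n + 1) * (b + 2)) (\<lambda>y. y \<in> set xs)"
proof -
  obtain x ys where xs: "xs = x # ys" using assms(1) by (cases xs) auto
  have 1: "run (f x) b (\<lambda>_. True)" using assms(2) xs by simp
  have 2: "run (foldM (\<lambda>(y, w) z. do { u \<leftarrow> f z; step 1 0 (if u > w then (z, u) else (y, w)) })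
      (x, v) ys) (n * (b + 1 + 1) + 1) (\<lambda>p. fst p \<in> set xs)" for v
  proof (rule run_foldM)
    fix z and p :: "'a \<times> real" assume "z \<in> set ys" and p: "fst p \<in> set xs"
    then have "run (f z) b (\<lambda>_. True)" "z \<in> set xs" using assms(2) xs by simp_all
    with p show "run ((\<lambda>(y, w) z. do { u \<leftarrow> f z; step 1 0 (if u > w then (z, u) else (y, w)) }) p z)
        (b + 1) (\<lambda>p. fst p \<in> set xs)"
      by (cases p) (simp, rule run_mono, erule run_bind, rule run_step, auto)
  qed (use assms(3) xs in auto)
  show ?thesis unfolding xs argmaxM.simps
    by (rule run_mono, rule run_bind[OF 1], rule run_bind[OF 2], clarsimp, rule run_ret)
       (simp_all add: xs)
qed

lemma run_argminM:
  assumes "xs \<noteq> []" and "\<And>x. x \<in> set xs \<Longrightarrow> run (f x) b (\<lambda>_. True)" and "length xs \<le> n"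
  shows "run (argminM f xs) ((n + 1) * (b + 1 + 2)) (\<lambda>y. y \<in> set xs)"
  unfolding argminM_def
proof (rule run_argmaxM[OF assms(1) _ assms(3)])
  fix x assume "x \<in> set xs"
  show "run (do { v \<leftarrow> f x; step 1 0 (- v) }) (b + 1) (\<lambda>_. True)"
    by (rule run_mono, rule run_bind[OF assms(2)], fact, rule run_step) simp_all
qed

section \<open>Selection\<close>

lemma run_insertM: "run (insertM x ys) (length ys * 2 + 2) (\<lambda>zs. zs = insort x ys)"
proof (induction ys)
  case Nil
  show ?case by (simp, rule run_mono[OF run_step]) simp_all
next
  case (Cons y ys)
  show ?case unfolding insertM.simps
    by (cases "x \<le> y")
      (simp, rule run_mono[OF run_step], simp, simp,
       simp only: if_False, rule run_mono, rule run_bind[OF Cons.IH], rule run_step, simp_all)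
qed

lemma run_sortM: "length xs \<le> n \<Longrightarrow> run (sortM xs) (n * (n * 2 + 2) + 1) (\<lambda>ys. ys = sort xs)"
proof (induction xs arbitrary: n)
  case Nil
  show ?case by (simp, rule run_mono[OF run_step]) simp_all
next
  case (Cons x xs)
  have "run (sortM (x # xs)) (length xs * (length xs * 2 + 2) + 1 + (length xs * 2 + 2))
      (\<lambda>ys. ys = sort (x # xs))"
    unfolding sortM.simps
    by (rule run_bind[OF Cons.IH], rule order_refl) (use run_insertM[of x "sort xs"] in simp)
  moreover have "length xs * (length xs * 2 + 2) + 1 + (length xs * 2 + 2)
      \<le> length (x # xs) * (length (x # xs) * 2 + 2) + 1" by simp
  moreover have "\<dots> \<le> n * (n * 2 + 2) + 1" using Cons.prems by (intro add_mono mult_le_mono) auto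
  ultimately show ?case using run_mono order_trans by blast
qed

section \<open>Counting the elements on one side of an order statistic\<close>

lemma filter_sort_length: "length (filter P (sort xs)) = length (filter P xs)"
  by (metis filter_sort length_sort)

lemma count_le_sort_nth:
  assumes "i < length xs" and "sort xs ! i \<le> (m :: real)"
  shows "i + 1 \<le> length (filter (\<lambda>x. x \<le> m) xs)"
proof -
  have "x \<le> m" if "x \<in> set (take (i + 1) (sort xs))" for x
    using that assms by (auto simp: in_set_conv_nth less_Suc_eq_le)
      (metis length_sort order_trans sorted_nth_mono sorted_sort)
  then have "length (filter (\<lambda>x. x \<le> m) (take (i + 1) (sort xs))) = i + 1"
    using assms by (subst filter_True) auto
  moreover have "length (filter (\<lambda>x. x \<le> m) (take (i + 1) (sort xs))) \<le>
      length (filter (\<lambda>x. x \<le> m) (sort xs))"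
    by (metis append_take_drop_id filter_append le_add1 length_append)
  ultimately show ?thesis by (simp only: filter_sort_length)
qed

lemma count_ge_sort_nth:
  assumes "i < length xs" and "sort xs ! i \<ge> (m :: real)"
  shows "length xs - i \<le> length (filter (\<lambda>x. x \<ge> m) xs)"
proof -
  have "x \<ge> m" if "x \<in> set (drop i (sort xs))" for x
  proof -
    obtain j where "x = drop i (sort xs) ! j" "j < length (drop i (sort xs))"
      using \<open>x \<in> _\<close> by (metis in_set_conv_nth)
    then have "x = sort xs ! (i + j)" "i + j < length xs" using assms(1) by auto
    then show ?thesis
      using assms(2) sorted_nth_mono[OF sorted_sort, of i "i + j" xs] by simp
  qed
  then have "length (filter (\<lambda>x. x \<ge> m) (drop i (sort xs))) = length xs - i"
    using assms by (subst filter_True) auto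
  moreover have "length (filter (\<lambda>x. x \<ge> m) (drop i (sort xs))) \<le>
      length (filter (\<lambda>x. x \<ge> m) (sort xs))"
    by (metis append_take_drop_id filter_append le_add2 length_append)
  ultimately show ?thesis by (simp only: filter_sort_length)
qed

lemma length_chop5: "length xs \<le> 5 * length (chop5 xs) \<and> 5 * length (chop5 xs) \<le> length xs + 4"
proof (induction xs rule: chop5.induct)
  case (2 x xs)
  then show ?case by (cases "length xs \<le> 4") auto
qed simp

lemma chop5_group: "g \<in> set (chop5 xs) \<Longrightarrow> 0 < length g \<and> length g \<le> 5"
  by (induction xs rule: chop5.induct) auto

lemma run_median5:
  assumes "0 < length xs" and "length xs \<le> 5"
  shows "run (median5 xs) 100 (\<lambda>v. v = sort xs ! ((length xs - 1) div 2))"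
proof -
  have i: "(length xs - 1) div 2 < length xs" using assms by linarith
  show ?thesis
    unfolding median5_def
    by (rule run_mono, rule run_bind[OF run_lenM[OF assms(2)]], simp only:,
      rule run_bind[OF run_sortM[OF assms(2)]], simp only:, rule run_nthM[where n = 5])
     (use i assms in auto)
qed

text \<open>Each group of five whose median is at most \<open>m\<close> contributes three elements; only the last
  group can be smaller.\<close>

lemma chop5_count_le:
  "3 * length (filter (\<lambda>g. sort g ! ((length g - 1) div 2) \<le> (m :: real)) (chop5 xs))
     \<le> length (filter (\<lambda>x. x \<le> m) xs) + 2"
proof (induction xs rule: chop5.induct)
  case (2 x xs)
  define g where "g = take 5 (x # xs)"
  define P where "P g \<longleftrightarrow> sort g ! ((length g - 1) div 2) \<le> m" for g
  have chop: "chop5 (x # xs) = g # chop5 (drop 4 xs)" by (simp add: g_def)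
  have 1: "length (filter (\<lambda>x. x \<le> m) (x # xs)) =
      length (filter (\<lambda>x. x \<le> m) g) + length (filter (\<lambda>x. x \<le> m) (drop 4 xs))"
    unfolding g_def by (metis append_take_drop_id drop_Suc_Cons eval_nat_numeral(3) filter_append length_append)
  have 2: "(length g - 1) div 2 + 1 \<le> length (filter (\<lambda>x. x \<le> m) g)"
    if "P g"
    using that unfolding P_def by (rule count_le_sort_nth[rotated]) (auto simp: g_def)
  show ?case
  proof (cases "length xs \<ge> 4")
    case True
    then have "length g = 5" by (simp add: g_def)
    then show ?thesis using 1 2 "2.IH" unfolding chop P_def[symmetric] by auto
  next
    \<comment> \<open>This is the last group. It contributes at least one element, and the slack 2
      replaces the missing ones.\<close>
    case False
    then show ?thesis using 1 2 unfolding chop P_def[symmetric] by auto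
  qed
qed simp

text \<open>The mirror image. The chosen median is the lower one, so a group has at least as many
  guaranteed elements from its median upwards as up to it, and the slack 2 suffices again.\<close>

lemma chop5_count_ge:
  "3 * length (filter (\<lambda>g. sort g ! ((length g - 1) div 2) \<ge> (m :: real)) (chop5 xs))
     \<le> length (filter (\<lambda>x. x \<ge> m) xs) + 2"
proof (induction xs rule: chop5.induct)
  case (2 x xs)
  define g where "g = take 5 (x # xs)"
  define P where "P g \<longleftrightarrow> sort g ! ((length g - 1) div 2) \<ge> m" for g
  have chop: "chop5 (x # xs) = g # chop5 (drop 4 xs)" by (simp add: g_def)
  have 1: "length (filter (\<lambda>x. x \<ge> m) (x # xs)) =
      length (filter (\<lambda>x. x \<ge> m) g) + length (filter (\<lambda>x. x \<ge> m) (drop 4 xs))"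
    unfolding g_def by (metis append_take_drop_id drop_Suc_Cons eval_nat_numeral(3) filter_append length_append)
  have 2: "length g - (length g - 1) div 2 \<le> length (filter (\<lambda>x. x \<ge> m) g)"
    if "P g"
    using that unfolding P_def by (rule count_ge_sort_nth[rotated]) (auto simp: g_def)
  show ?case
  proof (cases "length xs \<ge> 4")
    case True
    then have "length g = 5" by (simp add: g_def)
    then show ?thesis using 1 2 "2.IH" unfolding chop P_def[symmetric] by auto
  next
    case False
    then show ?thesis using 1 2 unfolding chop P_def[symmetric] by (auto simp: g_def)
  qed
qed simp

text \<open>This makes \<open>v\<close> the entry at position \<open>k\<close>, counted from 0, of
  the sorted list. Counts are used because they pass easily between a list and the parts into which
  a pivot divides it.\<close>

definition has_rank :: "nat \<Rightarrow> real list \<Rightarrow> real \<Rightarrow> bool" where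
  "has_rank k xs v \<longleftrightarrow>
     length (filter (\<lambda>x. x < v) xs) \<le> k \<and> k < length (filter (\<lambda>x. x \<le> v) xs)"

lemma has_rank_sort_nth:
  assumes "k < length xs" shows "has_rank k xs (sort xs ! k)"
  using count_le_sort_nth[OF assms order_refl] count_ge_sort_nth[OF assms order_refl]
    sum_length_filter_compl[of "\<lambda>x. x < sort xs ! k" xs] assms
  by (auto simp: has_rank_def not_less)

text \<open>The value \<open>v\<close> lies below \<open>m\<close>, since otherwise the whole part,
  which has more than \<open>k\<close> elements, would lie below \<open>v\<close>. Up to such a
  \<open>v\<close> the part and the list have the same elements.\<close>

lemma has_rank_less:
  assumes "has_rank k (filter (\<lambda>x. x < m) xs) v" and "k < length (filter (\<lambda>x. x < m) xs)"
  shows "has_rank k xs v"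
proof -
  have "v < m"
  proof (rule ccontr)
    assume "\<not> v < m"
    then have "filter (\<lambda>x. x < v) (filter (\<lambda>x. x < m) xs) = filter (\<lambda>x. x < m) xs"
      by (auto simp: filter_filter intro!: filter_cong)
    then show False using assms by (simp add: has_rank_def)
  qed
  then have "filter (\<lambda>x. x < v) (filter (\<lambda>x. x < m) xs) = filter (\<lambda>x. x < v) xs"
    "filter (\<lambda>x. x \<le> v) (filter (\<lambda>x. x < m) xs) = filter (\<lambda>x. x \<le> v) xs"
    by (auto simp: filter_filter intro!: filter_cong)
  then show ?thesis using assms by (simp add: has_rank_def)
qed

text \<open>Here \<open>v\<close> lies above \<open>m\<close>, so all elements up to
  \<open>m\<close> count as smaller, and the rank shifts by their number.\<close>

lemma has_rank_greater:
  assumes "has_rank (k - length (filter (\<lambda>x. x \<le> m) xs)) (filter (\<lambda>x. x > m) xs) v"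
    and "length (filter (\<lambda>x. x \<le> m) xs) \<le> k"
  shows "has_rank k xs v"
proof -
  have "m < v"
  proof (rule ccontr)
    assume "\<not> m < v"
    then have "filter (\<lambda>x. x \<le> v) (filter (\<lambda>x. x > m) xs) = []"
      by (auto simp: filter_empty_conv)
    then show False using assms by (simp add: has_rank_def)
  qed
  have "length (filter P xs) = length (filter (\<lambda>x. x \<le> m) xs) +
      length (filter P (filter (\<lambda>x. x > m) xs))" if "\<And>x. x \<le> m \<Longrightarrow> P x" for P
    using that by (induction xs) auto
  from this[of "\<lambda>x. x < v"] this[of "\<lambda>x. x \<le> v"] show ?thesis
    using assms \<open>m < v\<close> by (auto simp: has_rank_def)
qed

lemma length_filter_le_split:
  "length (filter (\<lambda>x. x < (m :: real)) xs) + length (filter (\<lambda>x. x = m) xs) =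
     length (filter (\<lambda>x. x \<le> m) xs)"
  by (induction xs) auto

text \<open>The recursive calls receive at most \<open>(n + 4) / 5\<close> and \<open>(7 n + 20) / 10\<close> elements. As
  \<open>1/5 + 7/10 < 1\<close>, the cost is linear; subtracting 9000 absorbs the rounding.\<close>

lemma run_select:
  "k < length xs \<Longrightarrow> run (select k xs) (10000 * length xs - 9000) (has_rank k xs)"
proof (induction "length xs" arbitrary: k xs rule: less_induct)
  case less
  note IH = less(1) and k = less(2)
  let ?n = "length xs"
  show ?case
  proof (cases "?n \<le> 20")
    \<comment> \<open>At most 20 elements cost 21 + 841 + 20 = 882 units, while the bound allows
      1000 already for a single element.\<close>
    case True
    show ?thesis
      by (subst select.simps, rule run_mono, rule run_bind[OF run_lenM[OF True]],
          simp only: True if_True, rule run_bind[OF run_sortM[OF True]],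
          rule run_weaken[OF run_nthM[where n = 20]])
        (use True k has_rank_sort_nth[OF k] in \<open>auto simp: less_eq_Suc_le\<close>)
  next
    case False
    define ms where "ms = map (\<lambda>g. sort g ! ((length g - 1) div 2)) (chop5 xs)"
    define l where "l = length ms"
    have l: "l = length (chop5 xs)" by (simp add: l_def ms_def)
    have l5: "?n \<le> 5 * l" "5 * l \<le> ?n + 4" using length_chop5[of xs] by (auto simp: l)
    have ll: "(l - 1) div 2 < length ms" using l5 False by (simp flip: l_def)
    \<comment> \<open>About half of the \<open>l\<close> medians lie on either side of
      \<open>m\<close>, and each brings three elements, so at least about \<open>3 * ?n / 10\<close>
      elements are excluded from either part. The 20 is ten times the slack 2 of the group
      counts.\<close>
    have small: "10 * length (filter (\<lambda>x. x < m) xs) \<le> 7 * ?n + 20"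
      "10 * length (filter (\<lambda>x. x > m) xs) \<le> 7 * ?n + 20"
      if m: "has_rank ((l - 1) div 2) ms m" for m
    proof -
      have a: "(l - 1) div 2 < length (filter (\<lambda>x. x \<le> m) ms)"
        "length (filter (\<lambda>x. x < m) ms) \<le> (l - 1) div 2" using m by (auto simp: has_rank_def)
      have b: "length (filter (\<lambda>x. x < m) ms) + length (filter (\<lambda>x. x \<ge> m) ms) = l"
        using sum_length_filter_compl[of "\<lambda>x. x < m" ms] by (simp add: not_less l_def)
      have c: "3 * length (filter (\<lambda>x. x \<le> m) ms) \<le> length (filter (\<lambda>x. x \<le> m) xs) + 2"
        "3 * length (filter (\<lambda>x. x \<ge> m) ms) \<le> length (filter (\<lambda>x. x \<ge> m) xs) + 2"
        using chop5_count_le[of m xs] chop5_count_ge[of m xs]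
        by (simp_all add: ms_def filter_map o_def)
      have d: "length (filter (\<lambda>x. x < m) xs) + length (filter (\<lambda>x. x \<ge> m) xs) = ?n"
        "length (filter (\<lambda>x. x \<le> m) xs) + length (filter (\<lambda>x. x > m) xs) = ?n"
        using sum_length_filter_compl[of "\<lambda>x. x < m" xs] sum_length_filter_compl[of "\<lambda>x. x \<le> m" xs]
        by (simp_all add: not_less not_le)
      have e: "2 * ((l - 1) div 2) + 1 \<le> l" "l \<le> 2 * ((l - 1) div 2) + 2" using l5 False by auto
      show "10 * length (filter (\<lambda>x. x < m) xs) \<le> 7 * ?n + 20"
        using a(2) b c(2) d(1) e(1) l5(1) by linarith
      show "10 * length (filter (\<lambda>x. x > m) xs) \<le> 7 * ?n + 20"
        using a(1) c(1) d(2) e(2) l5(1) by linarith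
    qed
    have ms: "run (mapM median5 (chop5 xs)) (l * (100 + 2) + 1) (\<lambda>v. v = ms)"
      unfolding ms_def
      by (rule run_mapM, rule run_median5) (simp_all only: chop5_group l order_refl)
    have m: "run (select ((l - 1) div 2) ms) (10000 * l - 9000) (has_rank ((l - 1) div 2) ms)"
      unfolding l_def by (rule IH) (use l5 False ll in \<open>simp_all flip: l_def\<close>)
    have filt: "run (filterM (\<lambda>x. step 1 0 (p x)) xs) (?n * (1 + 0 + 3) + 1) (\<lambda>v. v = filter p xs)" for p
      by (rule run_filterM[OF run_step]) auto
    \<comment> \<open>A common bound for both parts; it is smaller than \<open>?n\<close> because
      the list has more than 20 elements.\<close>
    define B where "B = (7 * ?n + 20) div 10"
    have B10: "10 * B \<le> 7 * ?n + 20" "7 * ?n + 11 \<le> 10 * B" unfolding B_def by linarith+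
    have rec: "run (if k < length (filter (\<lambda>x. x < m) xs) then select k (filter (\<lambda>x. x < m) xs)
        else if k < length (filter (\<lambda>x. x < m) xs) + length (filter (\<lambda>x. x = m) xs) then step 2 0 m
        else do { k' \<leftarrow> step 3 0 (k - length (filter (\<lambda>x. x < m) xs) - length (filter (\<lambda>x. x = m) xs));
                  select k' (filter (\<lambda>x. x > m) xs) })
      (10000 * B - 9000 + 3) (has_rank k xs)"
      if m: "has_rank ((l - 1) div 2) ms m" for m
    proof -
      let ?lt = "filter (\<lambda>x. x < m) xs" and ?eq = "filter (\<lambda>x. x = m) xs"
        and ?gt = "filter (\<lambda>x. x > m) xs"
      have le: "length ?lt + length ?eq = length (filter (\<lambda>x. x \<le> m) xs)"
        by (rule length_filter_le_split)
      have n: "length (filter (\<lambda>x. x \<le> m) xs) + length ?gt = ?n"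
        using sum_length_filter_compl[of "\<lambda>x. x \<le> m" xs] by (simp add: not_le)
      have B: "length ?lt \<le> B" "length ?gt \<le> B" "B < ?n" "B > 0"
        using small[OF m] False B10 by linarith+
      consider "k < length ?lt" | "length ?lt \<le> k" "k < length ?lt + length ?eq"
        | "length ?lt + length ?eq \<le> k" by linarith
      then show ?thesis
      proof cases
        case 1
        have "run (select k ?lt) (10000 * length ?lt - 9000) (has_rank k ?lt)"
          by (rule IH) (use 1 B in linarith)+
        then have "run (select k ?lt) (10000 * B - 9000 + 3) (has_rank k ?lt)"
          by (rule run_mono) (use B in simp)
        from run_weaken[OF this has_rank_less[OF _ 1]] show ?thesis using 1 by simp
      next
        case 2
        then have "has_rank k xs m" using le by (simp add: has_rank_def)
        then have "run (step 2 0 m) (10000 * B - 9000 + 3) (has_rank k xs)"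
          by (rule run_mono[OF run_step]) simp
        with 2 show ?thesis by simp
      next
        case 3
        define k' where "k' = k - length (filter (\<lambda>x. x \<le> m) xs)"
        have k': "k - length ?lt - length ?eq = k'" using le by (simp add: k'_def)
        have "run (select k' ?gt) (10000 * length ?gt - 9000) (has_rank k' ?gt)"
          by (rule IH) (use 3 B n k le in \<open>unfold k'_def, linarith+\<close>)
        then have "run (select k' ?gt) (10000 * length ?gt - 9000) (has_rank k xs)"
          by (rule run_weaken) (use 3 le in \<open>unfold k'_def, auto intro: has_rank_greater\<close>)
        then have "run (do { k' \<leftarrow> step 3 0 k'; select k' ?gt }) (3 + 0 + (10000 * length ?gt - 9000))
            (has_rank k xs)"
          by (rule run_bind_step)
        then have "run (do { k' \<leftarrow> step 3 0 k'; select k' ?gt }) (10000 * B - 9000 + 3) (has_rank k xs)"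
          by (rule run_mono) (use B in linarith)
        then show ?thesis using 3 by (simp add: k' del: diff_diff_left)
      qed
    qed
    \<comment> \<open>The subtractions are exact, since \<open>l\<close>, \<open>B\<close> and
      \<open>?n\<close> are positive. After inserting the bounds for \<open>l\<close> and
      \<open>B\<close>, about \<open>961 * ?n\<close> has to exceed about 19100. This holds from 20
      elements on, so the cutoff of \<open>select\<close> is just large enough.\<close>
    have arith: "18 * ?n + 12 + 103 * l + (10000 * l - 9000) + (10000 * B - 9000) \<le> 10000 * ?n - 9000"
    proof -
      have "21 \<le> ?n" "1 \<le> l" "1 \<le> B" using False l5 B10 by linarith+
      then have "10000 * l - 9000 + 9000 = 10000 * l" "10000 * B - 9000 + 9000 = 10000 * B"
        "10000 * ?n - 9000 + 9000 = 10000 * ?n" by auto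
      then show ?thesis using l5 B10 \<open>21 \<le> ?n\<close> by linarith
    qed
    have l1: "length (filter p xs) \<le> ?n" for p by simp
    show ?thesis
      by (subst select.simps, rule run_mono, rule run_bind[OF run_lenM[OF order_refl]],
          simp only: False if_False, rule run_bind_step, rule run_bind[OF ms], simp only:,
          rule run_bind[OF run_lenM[of ms l]], simp add: l_def, simp only: l_def[symmetric],
          rule run_bind[OF m], rule run_bind[OF filt], simp only:, rule run_bind[OF filt], simp only:,
          rule run_bind[OF filt], simp only:, rule run_bind[OF run_lenM[OF l1]], simp only:,
          rule run_bind[OF run_lenM[OF l1]], simp only:, rule rec, assumption)
        (use arith in simp)
  qed
qed

section \<open>Gram-Schmidt orthogonalization\<close>

definition dot :: "real list \<Rightarrow> real list \<Rightarrow> real" where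
  "dot xs ys = sum_list (map (\<lambda>(x, y). x * y) (zip xs ys))"

definition l2dist :: "real list \<Rightarrow> real list \<Rightarrow> real" where
  "l2dist xs ys = sqrt (\<Sum>i<length xs. (xs ! i - ys ! i)\<^sup>2)"

text \<open>The vector \<open>v\<close> minus its component along \<open>q\<close>, in the form in
  which \<open>axpyM\<close> returns it.\<close>

definition orth :: "real list \<Rightarrow> real list \<Rightarrow> real list" where
  "orth q v = map (\<lambda>(x, y). - dot q v * x + y) (zip q v)"

text \<open>Modified Gram-Schmidt: each coefficient is computed from the vector already reduced by
  the preceding columns, as in \<open>add_centerM\<close>. Being a composition of the linear maps
  \<open>orth q\<close>, it inherits their contraction property.\<close>

definition mgs :: "real list list \<Rightarrow> real list \<Rightarrow> real list" where
  "mgs qs v = foldl (\<lambda>v q. orth q v) v qs"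

lemma dot_sum: "length xs = n \<Longrightarrow> length ys = n \<Longrightarrow> dot xs ys = (\<Sum>i<n. xs ! i * ys ! i)"
  unfolding dot_def by (subst sum_list_sum_nth) (simp add: atLeast0LessThan)

lemma length_orth [simp]: "length (orth q v) = min (length q) (length v)"
  by (simp add: orth_def)

lemma orth_nth: "i < length q \<Longrightarrow> i < length v \<Longrightarrow> orth q v ! i = v ! i - dot q v * q ! i"
  by (simp add: orth_def)

lemma length_mgs: "\<forall>q\<in>set qs. length q = length v \<Longrightarrow> length (mgs qs v) = length v"
proof (induction qs arbitrary: v)
  case (Cons q qs)
  then show ?case using Cons.IH[of "orth q v"] by (simp add: mgs_def)
qed (simp add: mgs_def)

text \<open>With \<open>h\<close> the inner product, the squared norm changes by
  \<open>- 2 * h^2\<close> plus \<open>h^2\<close> times the squared norm of \<open>q\<close>. The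
  hypothesis is an inequality because a dependent column of the Gauss matrix leads to
  \<open>q = 0\<close>.\<close>

lemma sum_orth_le:
  fixes q w :: "nat \<Rightarrow> real"
  assumes "(\<Sum>i<n. q i * q i) \<le> 1"
  shows "(\<Sum>i<n. (w i - (\<Sum>j<n. q j * w j) * q i)\<^sup>2) \<le> (\<Sum>i<n. (w i)\<^sup>2)"
proof -
  define h where "h = (\<Sum>j<n. q j * w j)"
  have "(\<Sum>i<n. (w i - h * q i)\<^sup>2) = (\<Sum>i<n. (w i)\<^sup>2 - 2 * h * (q i * w i) + h\<^sup>2 * (q i * q i))"
    by (intro sum.cong refl) (simp add: power2_eq_square algebra_simps)
  also have "\<dots> = (\<Sum>i<n. (w i)\<^sup>2) - 2 * h * h + h\<^sup>2 * (\<Sum>i<n. q i * q i)"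
    by (simp add: sum.distrib sum_subtractf sum_distrib_left h_def)
  also have "\<dots> \<le> (\<Sum>i<n. (w i)\<^sup>2) - 2 * h * h + h\<^sup>2 * 1"
    by (intro add_left_mono mult_left_mono assms) simp
  also have "\<dots> \<le> (\<Sum>i<n. (w i)\<^sup>2)" by (simp add: power2_eq_square)
  finally show ?thesis by (simp add: h_def)
qed

lemma l2dist_orth_le:
  assumes "length q = n" "length a = n" "length b = n" "dot q q \<le> 1"
  shows "l2dist (orth q a) (orth q b) \<le> l2dist a b"
proof -
  have eq: "orth q a ! i - orth q b ! i =
      (a ! i - b ! i) - (\<Sum>j<n. q ! j * (a ! j - b ! j)) * q ! i" if "i < n" for i
    using that assms by (simp add: orth_nth dot_sum[of _ n] algebra_simps sum_subtractf)
  have "(\<Sum>i<n. (orth q a ! i - orth q b ! i)\<^sup>2) \<le> (\<Sum>i<n. (a ! i - b ! i)\<^sup>2)"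
    using sum_orth_le[where n = n and q = "(!) q" and w = "\<lambda>i. a ! i - b ! i"] assms
    by (simp add: eq dot_sum[of _ n])
  then show ?thesis using assms by (simp add: l2dist_def)
qed

lemma l2dist_mgs_le:
  assumes "\<forall>q\<in>set qs. length q = length a \<and> dot q q \<le> 1" and "length b = length a"
  shows "l2dist (mgs qs a) (mgs qs b) \<le> l2dist a b"
  using assms
proof (induction qs arbitrary: a b)
  case (Cons q qs)
  have "l2dist (mgs qs (orth q a)) (mgs qs (orth q b)) \<le> l2dist (orth q a) (orth q b)"
    by (rule Cons.IH) (use Cons.prems in auto)
  also have "\<dots> \<le> l2dist a b" by (rule l2dist_orth_le) (use Cons.prems in auto)
  finally show ?case by (simp add: mgs_def)
qed (simp add: mgs_def)

lemma sqrt_dot: "sqrt (dot v v) = l2dist v (replicate (length v) 0)"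
  by (simp add: l2dist_def dot_sum[OF refl] power2_eq_square)

lemma orth_zero: "length q = n \<Longrightarrow> orth q (replicate n 0) = replicate n 0"
  by (rule nth_equalityI) (simp_all add: orth_nth dot_sum[of _ n])

text \<open>Covers \<open>v = 0\<close> as well: then \<open>q\<close> is 0 by
  \<open>x / 0 = 0\<close>, and \<open>orth q v\<close> is the zero vector \<open>v\<close> itself.
  Rank deficiency therefore needs no separate treatment.\<close>

lemma normalize:
  assumes "q = map (\<lambda>a. a / sqrt (dot v v)) v"
  shows "dot q q \<le> 1" and "orth q v = replicate (length v) 0"
proof -
  let ?n = "length v" and ?\<rho> = "sqrt (dot v v)"
  have vv: "dot v v = (\<Sum>i<?n. (v ! i)\<^sup>2)" by (simp add: dot_sum[OF refl] power2_eq_square)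
  then have \<rho>2: "?\<rho>\<^sup>2 = dot v v" by (simp add: sum_nonneg)
  have q: "length q = ?n" "\<And>i. i < ?n \<Longrightarrow> q ! i = v ! i / ?\<rho>" by (simp_all add: assms)
  have "dot q q = (\<Sum>i<?n. (v ! i)\<^sup>2 / ?\<rho>\<^sup>2)"
    by (simp only: dot_sum[OF q(1) q(1)]) (simp add: q power2_eq_square)
  \<comment> \<open>This quotient is 1, or 0 if \<open>v\<close> vanishes.\<close>
  then have qq: "dot q q = dot v v / dot v v" unfolding \<rho>2 by (simp only: vv sum_divide_distrib)
  then show "dot q q \<le> 1" by simp
  have "dot q v = (\<Sum>i<?n. (v ! i)\<^sup>2 / ?\<rho>)"
    by (simp only: dot_sum[OF q(1) refl]) (simp add: q power2_eq_square)
  also have "\<dots> = dot v v / r" if "r = ?\<rho>" for r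
    unfolding that[symmetric] by (simp add: vv sum_divide_distrib)
  finally have qv: "dot q v = dot v v / ?\<rho>" by simp
  show "orth q v = replicate ?n 0"
  proof (rule nth_equalityI)
    fix i assume i: "i < length (orth q v)"
    then have "orth q v ! i = v ! i - dot v v / ?\<rho>\<^sup>2 * v ! i"
      using q by (simp add: orth_nth qv power2_eq_square)
    also have "\<dots> = 0"
    proof (cases "dot v v = 0")
      case True
      then have "(v ! i)\<^sup>2 = 0" using i q unfolding vv by (subst (asm) sum_nonneg_eq_0_iff) auto
      then show ?thesis by simp
    next
      case False
      then show ?thesis by (simp add: \<rho>2)
    qed
    finally show "orth q v ! i = replicate ?n 0 ! i" using i q by simp
  qed (simp add: q)
qed

section \<open>Gaussian columns with nearby centers\<close>

definition gcol :: "real \<Rightarrow> (real^'d) list \<Rightarrow> real^'d \<Rightarrow> real list" where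
  "gcol \<delta> S c = map (\<lambda>x. exp (- (\<delta>\<^sup>2 * (norm (x - c))\<^sup>2))) S"

lemma length_gcol [simp]: "length (gcol \<delta> S c) = length S"
  by (simp add: gcol_def)

lemma exp_minus_lipschitz:
  fixes a b :: real
  assumes "0 \<le> a" "0 \<le> b"
  shows "\<bar>exp (- a) - exp (- b)\<bar> \<le> \<bar>a - b\<bar>"
proof -
  have *: "exp (- a) - exp (- b) \<le> b - a \<and> exp (- b) \<le> exp (- a)" if "0 \<le> a" "a \<le> b" for a b :: real
  proof -
    have "exp (- a) - exp (- b) = exp (- a) * (1 - exp (- (b - a)))"
      by (simp add: algebra_simps flip: exp_add)
    also have "\<dots> \<le> 1 * (b - a)"
      using that exp_ge_add_one_self[of "- (b - a)"] by (intro mult_mono) (auto simp del: exp_ge_add_one_self)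
    finally show ?thesis using that by simp
  qed
  show ?thesis using *[of a b] *[of b a] assms by (cases "a \<le> b") auto
qed

text \<open>In units of \<open>1 / \<delta>\<close> all centers lie in a fixed ball, so among sufficiently many of them two
  are arbitrarily close, and their columns almost coincide.\<close>

lemma gcol_pigeonhole:
  fixes L \<omega> :: real
  assumes "L > 0" and "\<omega> > 0"
  obtains K where "K > 0" and
    "\<And>\<delta> m (S :: (real^'d::finite) list) cs. \<lbrakk>\<delta> \<ge> 0; \<forall>x\<in>set S. \<delta> * norm (x - m) \<le> sqrt L; set cs \<subseteq> set S;
       K \<le> length cs\<rbrakk> \<Longrightarrow>
       \<exists>i<length cs. \<exists>k<i. \<omega> * l2dist (gcol \<delta> S (cs ! i)) (gcol \<delta> S (cs ! k)) <
         sqrt (dot (gcol \<delta> S (cs ! 0)) (gcol \<delta> S (cs ! 0)))"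
proof -
  \<comment> \<open>Centers at scaled distance below \<open>2 * \<eta>\<close> have columns that
    differ by at most \<open>8 * sqrt L * \<eta>\<close> in each entry, because scaled distances
    within the sample are at most \<open>2 * sqrt L\<close>. For the same reason every entry is at
    least \<open>exp (- 4 * L)\<close>. Dividing by \<open>\<omega> + 1\<close> instead of
    \<open>\<omega>\<close> makes the comparison strict.\<close>
  define \<eta> where "\<eta> = exp (- 4 * L) / (8 * sqrt L * (\<omega> + 1))"
  have \<eta>: "\<eta> > 0" using assms by (simp add: \<eta>_def)
  have \<eta>8: "\<omega> * (8 * sqrt L * \<eta>) < exp (- 4 * L)"
  proof -
    have "8 * sqrt L * \<eta> = exp (- 4 * L) / (\<omega> + 1)" using assms by (simp add: \<eta>_def)
    moreover have "\<omega> * (exp (- 4 * L) / (\<omega> + 1)) < exp (- 4 * L)" using assms by (simp add: field_simps)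
    ultimately show ?thesis by simp
  qed
  \<comment> \<open>A finite net \<open>T\<close> of the ball depends on \<open>L\<close>,
    \<open>\<omega>\<close> and the dimension only. One center more than \<open>T\<close> has points
    forces two centers to share a net point. A repeated center is covered too, its distance being
    0.\<close>
  have "compact (cball (0 :: real^'d) (sqrt L))" by simp
  then obtain T where T: "finite T" "cball (0 :: real^'d) (sqrt L) \<subseteq> (\<Union>x\<in>T. ball x \<eta>)"
    using \<eta> unfolding compact_eq_totally_bounded by metis
  show ?thesis
  proof (rule that[of "Suc (card T)"])
    fix \<delta> m and S cs :: "(real^'d) list"
    assume \<delta>: "\<delta> \<ge> 0" and S: "\<forall>x\<in>set S. \<delta> * norm (x - m) \<le> sqrt L" and cs: "set cs \<subseteq> set S"
      and K: "Suc (card T) \<le> length cs"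
    let ?n = "length S"
    \<comment> \<open>Keeps the comparison of entries strict after multiplication by
      \<open>sqrt (real ?n)\<close>.\<close>
    have n: "?n > 0" using K cs by (cases S) auto
    have "\<forall>i<length cs. \<exists>t\<in>T. \<delta> *\<^sub>R (cs ! i - m) \<in> ball t \<eta>"
    proof (intro allI impI)
      fix i assume "i < length cs"
      then have "\<delta> *\<^sub>R (cs ! i - m) \<in> cball 0 (sqrt L)" using S cs \<delta> by (auto dest!: nth_mem)
      then show "\<exists>t\<in>T. \<delta> *\<^sub>R (cs ! i - m) \<in> ball t \<eta>" using T(2) by blast
    qed
    then obtain h where h: "\<And>i. i < length cs \<Longrightarrow> h i \<in> T \<and> \<delta> *\<^sub>R (cs ! i - m) \<in> ball (h i) \<eta>"
      by metis
    have "\<not> inj_on h {..<length cs}"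
    proof
      assume "inj_on h {..<length cs}"
      then have "card {..<length cs} \<le> card T" using h T(1) by (intro card_inj_on_le) auto
      then show False using K by simp
    qed
    then obtain i k where ik: "i < length cs" "k < i" "h i = h k"
      unfolding inj_on_def by (metis lessThan_iff linorder_neqE_nat)
    let ?a = "cs ! i" and ?b = "cs ! k"
    have ab: "?a \<in> set S" "?b \<in> set S" "cs ! 0 \<in> set S" using ik cs by (auto intro!: subsetD[OF cs] nth_mem)
    have "dist (\<delta> *\<^sub>R (?a - m)) (\<delta> *\<^sub>R (?b - m)) < 2 * \<eta>"
      using h[of i] h[of k] ik by (auto intro: dist_triangle_half_r)
    then have close: "\<delta> * norm (?a - ?b) < 2 * \<eta>"
      using \<delta> by (simp add: dist_norm flip: scaleR_diff_right)
    have far: "\<delta> * norm (x - c) \<le> 2 * sqrt L" if "x \<in> set S" "c \<in> set S" for x c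
    proof -
      have "\<delta> * norm (x - c) \<le> \<delta> * (norm (x - m) + norm (c - m))"
        using \<delta> norm_triangle_ineq4[of "x - m" "c - m"] by (intro mult_left_mono) auto
      moreover have "\<delta> * norm (x - m) \<le> sqrt L" "\<delta> * norm (c - m) \<le> sqrt L" using S that by auto
      ultimately show ?thesis by (simp add: distrib_left)
    qed
    have entry: "(exp (- (\<delta>\<^sup>2 * (norm (x - ?a))\<^sup>2)) - exp (- (\<delta>\<^sup>2 * (norm (x - ?b))\<^sup>2)))\<^sup>2
        \<le> (8 * sqrt L * \<eta>)\<^sup>2" if x: "x \<in> set S" for x
    proof -
      let ?A = "\<delta> * norm (x - ?a)" and ?B = "\<delta> * norm (x - ?b)"
      have "\<bar>exp (- (?A\<^sup>2)) - exp (- (?B\<^sup>2))\<bar> \<le> \<bar>?A\<^sup>2 - ?B\<^sup>2\<bar>"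
        by (rule exp_minus_lipschitz) simp_all
      also have "\<dots> = \<bar>?A - ?B\<bar> * \<bar>?A + ?B\<bar>"
        by (simp add: power2_eq_square algebra_simps flip: abs_mult)
      also have "\<dots> \<le> (2 * \<eta>) * (2 * sqrt L + 2 * sqrt L)"
      proof (rule mult_mono)
        have "\<bar>norm (x - ?a) - norm (x - ?b)\<bar> \<le> norm (?a - ?b)"
          using norm_triangle_ineq3[of "x - ?a" "x - ?b"] by (simp add: norm_minus_commute)
        then have "\<delta> * \<bar>norm (x - ?a) - norm (x - ?b)\<bar> \<le> \<delta> * norm (?a - ?b)"
          using \<delta> by (rule mult_left_mono)
        then show "\<bar>?A - ?B\<bar> \<le> 2 * \<eta>"
          using close \<delta> by (simp add: abs_mult flip: right_diff_distrib)
        show "\<bar>?A + ?B\<bar> \<le> 2 * sqrt L + 2 * sqrt L"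
          using far[OF x ab(1)] far[OF x ab(2)] \<delta> by simp
      qed (use \<eta> in auto)
      finally have "\<bar>exp (- (?A\<^sup>2)) - exp (- (?B\<^sup>2))\<bar> \<le> \<bar>8 * sqrt L * \<eta>\<bar>"
        using \<eta> assms by (simp add: mult_ac)
      then show ?thesis unfolding power_mult_distrib[of \<delta>] by (simp only: abs_le_square_iff)
    qed
    have "(\<Sum>l<?n. (gcol \<delta> S ?a ! l - gcol \<delta> S ?b ! l)\<^sup>2) \<le> (\<Sum>l<?n. (8 * sqrt L * \<eta>)\<^sup>2)"
      by (rule sum_mono) (use entry in \<open>simp add: gcol_def\<close>)
    also have "\<dots> = real ?n * (8 * sqrt L * \<eta>)\<^sup>2" by simp
    finally have "l2dist (gcol \<delta> S ?a) (gcol \<delta> S ?b) \<le> sqrt (real ?n * (8 * sqrt L * \<eta>)\<^sup>2)"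
      unfolding l2dist_def length_gcol by (rule real_sqrt_le_mono)
    also have "\<dots> = sqrt (real ?n) * (8 * sqrt L * \<eta>)"
      using \<eta> assms by (simp add: real_sqrt_mult)
    finally have "\<omega> * l2dist (gcol \<delta> S ?a) (gcol \<delta> S ?b) \<le> \<omega> * (sqrt (real ?n) * (8 * sqrt L * \<eta>))"
      using assms by (intro mult_left_mono) auto
    also have "\<dots> < sqrt (real ?n) * exp (- 4 * L)"
      using mult_strict_left_mono[OF \<eta>8, of "sqrt (real ?n)"] n by (simp add: mult_ac)
    also have "\<dots> = sqrt (real ?n * (exp (- 4 * L))\<^sup>2)" by (simp add: real_sqrt_mult)
    also have "\<dots> = sqrt (\<Sum>l<?n. (exp (- 4 * L))\<^sup>2)" by simp
    also have "\<dots> \<le> sqrt (dot (gcol \<delta> S (cs ! 0)) (gcol \<delta> S (cs ! 0)))"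
    proof -
      have "exp (- 4 * L) \<le> gcol \<delta> S (cs ! 0) ! l" if "l < ?n" for l
      proof -
        have "(\<delta> * norm (S ! l - cs ! 0))\<^sup>2 \<le> (2 * sqrt L)\<^sup>2"
          using far[of "S ! l" "cs ! 0"] that ab \<delta> by (intro power_mono) auto
        then show ?thesis using that assms by (simp add: gcol_def power_mult_distrib)
      qed
      then have "(\<Sum>l<?n. (exp (- 4 * L))\<^sup>2) \<le> (\<Sum>l<?n. (gcol \<delta> S (cs ! 0) ! l)\<^sup>2)"
        by (intro sum_mono power_mono) auto
      then show ?thesis by (simp add: dot_sum[of _ ?n] power2_eq_square)
    qed
    finally show "\<exists>i<length cs. \<exists>k<i. \<omega> * l2dist (gcol \<delta> S (cs ! i)) (gcol \<delta> S (cs ! k)) <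
         sqrt (dot (gcol \<delta> S (cs ! 0)) (gcol \<delta> S (cs ! 0)))"
      using ik by blast
  qed simp
qed

section \<open>Vector operations\<close>

lemma run_sqdistM: "run (sqdistM x (y :: real^'d)) (3 * CARD('d)) (\<lambda>v. v = (norm (x - y))\<^sup>2)"
  unfolding sqdistM_def by (rule run_mono[OF run_step]) simp_all

lemma run_innerM: "run (innerM x (y :: real^'d)) (2 * CARD('d)) (\<lambda>v. v = x \<bullet> y)"
  unfolding innerM_def by (rule run_mono[OF run_step]) simp_all

lemma run_gaussM: "run (gaussM \<delta> c (x :: real^'d)) (3 * CARD('d) + 4)
    (\<lambda>v. v = exp (- (\<delta>\<^sup>2 * (norm (x - c))\<^sup>2)))"
  unfolding gaussM_def by (rule run_mono, rule run_bind[OF run_sqdistM], rule run_step) simp_all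

lemma run_dotM:
  assumes "length xs \<le> n" shows "run (dotM xs ys) (6 * n + 2) (\<lambda>v. v = dot xs ys)"
  unfolding dotM_def dot_def
  by (rule run_mono, rule run_bind[OF run_zipM[OF assms]], simp only:,
      rule run_sumM[where b = 1 and n = n]) (use assms in \<open>auto intro: run_mono[OF run_step]\<close>)

lemma run_axpyM:
  assumes "length xs \<le> n"
  shows "run (axpyM a xs ys) (7 * n + 2) (\<lambda>v. v = map (\<lambda>(x, y). a * x + y) (zip xs ys))"
  unfolding axpyM_def
  by (rule run_mono, rule run_bind[OF run_zipM[OF assms]], simp only:,
      rule run_mapM[where b = 2 and n = n]) (use assms in \<open>auto intro: run_mono[OF run_step]\<close>)

lemma run_normM: "length xs \<le> n \<Longrightarrow> run (normM xs) (6 * n + 3) (\<lambda>v. v = sqrt (dot xs xs))"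
  unfolding normM_def by (rule run_mono, rule run_bind[OF run_dotM], assumption, rule run_step) simp_all

lemma run_rmsM:
  assumes "length xs \<le> n" shows "run (rmsM xs) (4 * n + 4) (\<lambda>_. True)"
  unfolding rmsM_def
  by (rule run_mono, rule run_bind[OF run_lenM[OF assms]],
      rule run_bind[OF run_sumM_any[where b = 1, OF run_mono[OF run_step] assms]], simp, simp,
      rule run_step) simp_all

lemma run_meanM:
  assumes "length xs \<le> n"
  shows "run (meanM (xs :: (real^'d) list)) ((2 * n + 2) * (CARD('d) + 1) + 2) (\<lambda>_. True)"
  unfolding meanM_def vscaleM_def
  by (rule run_mono, rule run_bind[OF run_lenM[OF assms]],
      rule run_bind[OF run_foldM[where I = "\<lambda>_. True" and b = "2 * CARD('d)", OF _ _ assms]],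
      simp add: vaddM_def, rule run_mono[OF run_step], simp, simp, simp, rule run_bind_step,
      rule run_step) (simp_all add: algebra_simps)

section \<open>Exploration\<close>

text \<open>Instead of orthonormality it records what the contraction argument uses and what
  survives rank deficiency: columns of Q have norm at most 1, and \<open>mgs\<close> annihilates the
  columns of all present centers. The last two clauses turn close centers into a large quotient of
  diagonal entries of R.\<close>

definition fit_inv :: "real \<Rightarrow> (real^'d) list \<Rightarrow> ('d::finite) fit \<Rightarrow> bool" where
  "fit_inv \<delta> S F \<longleftrightarrow>
     length (qcols F) = length (centers F) \<and> length (rcols F) = length (centers F) \<and>
     length (qtr F) = length (centers F) \<and> length (resid F) = length S \<and>
     set (centers F) \<subseteq> set S \<and>
     (\<forall>q\<in>set (qcols F). length q = length S \<and> dot q q \<le> 1) \<and>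
     (\<forall>i<length (centers F). length (rcols F ! i) = i + 1) \<and>
     (\<forall>c\<in>set (centers F). mgs (qcols F) (gcol \<delta> S c) = replicate (length S) 0) \<and>
     (\<forall>i<length (centers F). \<forall>k<i.
        \<bar>last (rcols F ! i)\<bar> \<le> l2dist (gcol \<delta> S (centers F ! i)) (gcol \<delta> S (centers F ! k))) \<and>
     (centers F \<noteq> [] \<longrightarrow>
        \<bar>last (rcols F ! 0)\<bar> = sqrt (dot (gcol \<delta> S (centers F ! 0)) (gcol \<delta> S (centers F ! 0))))"

text \<open>Each Gram-Schmidt step is a contraction, and the columns of the earlier centers have been
  mapped to 0. So a new diagonal entry of R is at most the distance to any earlier column.\<close>

lemma fit_inv_add:
  assumes inv: "fit_inv \<delta> S F" and c: "c \<in> set S" and v: "v = mgs (qcols F) (gcol \<delta> S c)"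
    and hs: "length hs = length (qcols F)" and q: "q = map (\<lambda>a. a / sqrt (dot v v)) v"
    and r: "length r = length S"
  shows "fit_inv \<delta> S \<lparr>centers = centers F @ [c], qcols = qcols F @ [q],
           rcols = rcols F @ [hs @ [sqrt (dot v v)]], qtr = qtr F @ [b], resid = r\<rparr>"
proof -
  let ?j = "length (centers F)" and ?n = "length S"
  have qs: "\<forall>q\<in>set (qcols F). length q = ?n \<and> dot q q \<le> 1"
    using inv by (simp add: fit_inv_def)
  have lv: "length v = ?n" unfolding v using qs by (subst length_mgs) auto
  have \<rho>: "sqrt (dot v v) \<le> l2dist (gcol \<delta> S c) (gcol \<delta> S c')" if "c' \<in> set (centers F)" for c'
  proof -
    have "sqrt (dot v v) = l2dist v (mgs (qcols F) (gcol \<delta> S c'))"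
      using inv that lv by (simp add: fit_inv_def sqrt_dot)
    also have "\<dots> \<le> l2dist (gcol \<delta> S c) (gcol \<delta> S c')"
      unfolding v by (rule l2dist_mgs_le) (use qs in auto)
    finally show ?thesis .
  qed
  have dot0: "sqrt (dot v v) \<ge> 0" by (simp add: sqrt_dot l2dist_def sum_nonneg)
  \<comment> \<open>The new map \<open>orth q\<close> annihilates the remainder \<open>v\<close> of
    the new column and fixes the zero vectors that the earlier columns have become.\<close>
  have zero: "mgs (qcols F @ [q]) (gcol \<delta> S c') = replicate ?n 0" if "c' \<in> insert c (set (centers F))" for c'
  proof (cases "c' = c")
    case True
    then show ?thesis using normalize(2)[OF q] lv v by (simp add: mgs_def)
  next
    case False
    then have "mgs (qcols F) (gcol \<delta> S c') = replicate ?n 0"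
      using inv that by (simp add: fit_inv_def)
    then show ?thesis using lv by (simp add: mgs_def orth_zero q)
  qed
  have last: "\<bar>last ((rcols F @ [hs @ [sqrt (dot v v)]]) ! i)\<bar> \<le>
      l2dist (gcol \<delta> S ((centers F @ [c]) ! i)) (gcol \<delta> S ((centers F @ [c]) ! k))"
    if "i < Suc ?j" "k < i" for i k
  proof (cases "i = ?j")
    case True
    then show ?thesis using \<rho>[of "centers F ! k"] that inv dot0 by (simp add: fit_inv_def nth_append)
  next
    case False
    then show ?thesis using that inv by (simp add: fit_inv_def nth_append)
  qed
  have first: "\<bar>last ((rcols F @ [hs @ [sqrt (dot v v)]]) ! 0)\<bar> =
      sqrt (dot (gcol \<delta> S ((centers F @ [c]) ! 0)) (gcol \<delta> S ((centers F @ [c]) ! 0)))"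
  proof (cases "centers F = []")
    case True
    then have "v = gcol \<delta> S c" "rcols F = []" using inv v by (simp_all add: fit_inv_def mgs_def)
    then show ?thesis using True dot0 by simp
  next
    case False
    then show ?thesis using inv by (simp add: fit_inv_def nth_append)
  qed
  have lens: "length ((rcols F @ [hs @ [sqrt (dot v v)]]) ! i) = i + 1" if "i < Suc ?j" for i
    using that inv hs by (auto simp: fit_inv_def nth_append less_Suc_eq)
  have "length q = ?n" "dot q q \<le> 1" using normalize(1)[OF q] lv by (simp_all add: q)
  then show ?thesis
    using inv c r zero last first lens by (simp add: fit_inv_def)
qed

text \<open>A crude product dominating \<open>n\<close> Gaussians of cost proportional to the
  dimension and \<open>j\<close> Gram-Schmidt steps of cost linear in \<open>n\<close> and
  \<open>j\<close>.\<close>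

lemma run_add_centerM:
  fixes S :: "(real^'d::finite) list"
  assumes inv: "fit_inv \<delta> S F" and c: "c \<in> set S" and n: "length S \<le> n" and j: "length (centers F) \<le> j"
  shows "run (add_centerM \<delta> S F c) (50 * (j + 1) * (n + 1) * (j + CARD('d) + 1))
           (\<lambda>F'. fit_inv \<delta> S F' \<and> centers F' = centers F @ [c])"
proof -
  let ?\<phi> = "gcol \<delta> S c"
  have qs: "\<forall>q\<in>set (qcols F). length q = length S" and lq: "length (qcols F) = length (centers F)"
    "length (rcols F) = length (centers F)" "length (qtr F) = length (centers F)"
    and lr: "length (resid F) = length S"
    using inv by (auto simp: fit_inv_def)
  have col: "run (mapM (gaussM \<delta> c) S) (n * (3 * CARD('d) + 4 + 2) + 1) (\<lambda>v. v = ?\<phi>)"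
    unfolding gcol_def by (rule run_mapM[OF run_gaussM n])
  have "run (foldM (\<lambda>(v, hs) q. do {
         h \<leftarrow> dotM q v; v' \<leftarrow> axpyM (- h) q v; hs' \<leftarrow> snocM hs h; ret (v', hs') }) (?\<phi>, []) (qcols F))
      (length (qcols F) * (6 * n + 2 + (7 * n + 2 + (2 * j + 2 + 0)) + 1) + 1)
      (\<lambda>(v, hs). v = mgs (take (length (qcols F)) (qcols F)) ?\<phi> \<and> length hs = length (qcols F))"
  proof (rule run_foldM_nth)
    fix i and a :: "real list \<times> real list"
    assume i: "i < length (qcols F)" and "case a of (v, hs) \<Rightarrow> v = mgs (take i (qcols F)) ?\<phi> \<and> length hs = i"
    then obtain v hs where a: "a = (v, hs)" "v = mgs (take i (qcols F)) ?\<phi>" "length hs = i" by (cases a) auto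
    have q: "length (qcols F ! i) \<le> n" using qs i n by simp
    have hs: "length hs \<le> j" using a i lq j by simp
    have upd: "map (\<lambda>(x, y). - dot (qcols F ! i) v * x + y) (zip (qcols F ! i) v) =
        mgs (take (Suc i) (qcols F)) ?\<phi>"
      using i unfolding orth_def[symmetric] by (simp add: a mgs_def take_Suc_conv_app_nth)
    show "run ((\<lambda>(v, hs) q. do {
         h \<leftarrow> dotM q v; v' \<leftarrow> axpyM (- h) q v; hs' \<leftarrow> snocM hs h; ret (v', hs') }) a (qcols F ! i))
      (6 * n + 2 + (7 * n + 2 + (2 * j + 2 + 0)))
      (\<lambda>(v, hs). v = mgs (take (Suc i) (qcols F)) ?\<phi> \<and> length hs = Suc i)"
      unfolding a(1) prod.case
      by (rule run_bind[OF run_dotM[OF q]], simp only:, rule run_bind[OF run_axpyM[OF q]], simp only: upd,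
          rule run_bind[OF run_snocM[OF hs]], simp only:, rule run_ret) (simp add: a)
  qed (simp add: mgs_def)
  from run_mono[OF this linear_mono]
  have fold: "run (foldM (\<lambda>(v, hs) q. do {
         h \<leftarrow> dotM q v; v' \<leftarrow> axpyM (- h) q v; hs' \<leftarrow> snocM hs h; ret (v', hs') }) (?\<phi>, []) (qcols F))
      (j * (6 * n + 2 + (7 * n + 2 + (2 * j + 2 + 0)) + 1) + 1)
      (\<lambda>(v, hs). v = mgs (qcols F) ?\<phi> \<and> length hs = length (qcols F))"
    using j lq by simp
  show ?thesis
    unfolding add_centerM_def
  proof (rule run_mono, rule run_bind[OF col], simp only:, rule run_bind[OF fold], clarify)
    fix hs :: "real list" assume hs: "length hs = length (qcols F)"
    define v where v: "v = mgs (qcols F) ?\<phi>"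
    let ?q = "map (\<lambda>a. a / sqrt (dot v v)) v"
    have lv: "length v = length S" unfolding v using qs by (subst length_mgs) auto
    have l: "length v \<le> n" "length ?q \<le> n" "length hs \<le> j" "length (qcols F) \<le> j"
      "length (rcols F) \<le> j" "length (qtr F) \<le> j" using lv n hs lq j by auto
    have div: "run (mapM (\<lambda>a. step 1 0 (a / sqrt (dot v v))) v) (n * (1 + 0 + 2) + 1) (\<lambda>w. w = ?q)"
      by (rule run_mapM[OF run_step l(1)]) simp
    let ?r = "\<lambda>b. map (\<lambda>(x, y). - b * x + y) (zip ?q (resid F))"
    show "run (do {
         \<rho> \<leftarrow> normM (mgs (qcols F) ?\<phi>);
         q \<leftarrow> mapM (\<lambda>a. step 1 0 (a / \<rho>)) (mgs (qcols F) ?\<phi>);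
         b \<leftarrow> dotM q (resid F);
         r \<leftarrow> axpyM (- b) q (resid F);
         col \<leftarrow> snocM hs \<rho>;
         cs \<leftarrow> snocM (centers F) c;
         qs \<leftarrow> snocM (qcols F) q;
         rs \<leftarrow> snocM (rcols F) col;
         bs \<leftarrow> snocM (qtr F) b;
         step 1 5 \<lparr>centers = cs, qcols = qs, rcols = rs, qtr = bs, resid = r\<rparr> })
      (6 * n + 3 + (n * (1 + 0 + 2) + 1 + (6 * n + 2 + (7 * n + 2 + (2 * j + 2 + (2 * j + 2 +
        (2 * j + 2 + (2 * j + 2 + (2 * j + 2 + (1 + 5))))))))))
      (\<lambda>F'. fit_inv \<delta> S F' \<and> centers F' = centers F @ [c])"
      unfolding v[symmetric]
      by (rule run_bind[OF run_normM[OF l(1)]], simp only:, rule run_bind[OF div], simp only:,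
          rule run_bind[OF run_dotM[OF l(2)]], simp only:, rule run_bind[OF run_axpyM[OF l(2)]], simp only:,
          rule run_bind[OF run_snocM[OF l(3)]], simp only:, rule run_bind[OF run_snocM[OF j]], simp only:,
          rule run_bind[OF run_snocM[OF l(4)]], simp only:, rule run_bind[OF run_snocM[OF l(5)]], simp only:,
          rule run_bind[OF run_snocM[OF l(6)]], simp only:, rule run_step, rule conjI,
          rule fit_inv_add[OF inv c v hs refl]) (use lv lr in simp_all)
  qed (simp add: algebra_simps)
qed

text \<open>This is the direction that forces exploration to stop: the computed maximum is at least
  the first diagonal entry, and the computed minimum is at most the \<open>i\<close>th.\<close>

lemma run_ill_conditionedM:
  assumes "length (rcols F) \<le> j" and "\<forall>col\<in>set (rcols F). length col \<le> j" and "\<omega>1 P > 0"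
  shows "run (ill_conditionedM P F) (j * (j + 10) + 10)
    (\<lambda>b. \<forall>i<length (rcols F). \<omega>1 P * \<bar>last (rcols F ! i)\<bar> < \<bar>last (rcols F ! 0)\<bar> \<longrightarrow> b)"
proof -
  define ds where "ds = map (\<lambda>col. \<bar>last col\<bar>) (rcols F)"
  have ds: "run (mapM (\<lambda>col. step (length col + 1) 0 \<bar>last col\<bar>) (rcols F)) (j * (j + 1 + 2) + 1) (\<lambda>v. v = ds)"
    unfolding ds_def by (rule run_mapM[OF run_mono[OF run_step] assms(1)]) (use assms(2) in auto)
  have l: "length ds \<le> j" using assms(1) by (simp add: ds_def)
  have mx: "run (maxM (step 1 0) ds) (j * (1 + 0 + 2) + 1) (\<lambda>v. 0 \<le> v \<and> (\<forall>x\<in>set ds. x \<le> v))"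
    by (rule run_maxM[OF run_step l]) simp
  have mn: "run (foldM (\<lambda>a x. step 1 0 (min a x)) m ds) (j * (1 + 0 + 1) + 1) (\<lambda>v. v = foldl min m ds)" for m
    by (rule run_foldM_fun[OF run_step l]) simp
  have min: "foldl min m ds \<le> m \<and> (\<forall>x\<in>set ds. foldl min m ds \<le> x)" for m :: real and ds
    by (induction ds arbitrary: m) (auto, (meson min.bounded_iff)+)
  show ?thesis unfolding ill_conditionedM_def
  proof (rule run_mono, rule run_bind[OF ds], simp only:, rule run_bind[OF mx], rule run_bind[OF mn],
      rule run_step, intro allI impI)
    fix M m i assume M: "0 \<le> M \<and> (\<forall>x\<in>set ds. x \<le> M)" and m: "m = foldl min M ds"
      and i: "i < length (rcols F)" and ill: "\<omega>1 P * \<bar>last (rcols F ! i)\<bar> < \<bar>last (rcols F ! 0)\<bar>"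
    have "\<omega>1 P * m \<le> \<omega>1 P * \<bar>last (rcols F ! i)\<bar>"
      using min[of M ds] i m assms(3) by (intro mult_left_mono) (auto simp: ds_def)
    also note ill
    also have "\<bar>last (rcols F ! 0)\<bar> \<le> M" using M i by (cases "rcols F") (auto simp: ds_def)
    finally show "\<omega>1 P * m < M" .
  qed (simp add: algebra_simps)
qed

section \<open>Quasi-uniform points, Voronoi regions and the choice of new centers\<close>

lemma run_min_sqdistM:
  fixes U :: "(real^'d) list"
  assumes "U \<noteq> []" and "length U \<le> u"
  shows "run (min_sqdistM U x) ((u + 2) * (3 * CARD('d) + 3)) (\<lambda>_. True)"
  unfolding min_sqdistM_def
  by (rule run_mono, rule run_bind[OF run_argminM[OF assms(1) run_weaken[OF run_sqdistM] assms(2)]], simp,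
      rule run_weaken[OF run_sqdistM]) (simp_all add: algebra_simps)

text \<open>The result has \<open>U\<close> as a prefix, which \<open>new_centerM\<close> drops in
  order to obtain the candidates.\<close>

lemma run_quasiM:
  fixes S :: "(real^'d) list"
  assumes "U \<noteq> []" and "length U + m \<le> u" and "S \<noteq> []" and "length S \<le> n"
  shows "run (quasiM m S U) (m * ((n + 1) * ((u + 2) * (3 * CARD('d) + 3) + 2) + (2 * u + 2)))
    (\<lambda>V. \<exists>us. V = U @ us \<and> length us = m \<and> set us \<subseteq> set S)"
  using assms(1,2)
proof (induction m arbitrary: U)
  case 0
  show ?case by (simp, rule run_mono[OF run_ret]) simp_all
next
  case (Suc m)
  have l: "length U \<le> u" using Suc.prems by simp
  show ?case unfolding quasiM.simps
  proof (rule run_mono, rule run_bind[OF run_argmaxM[OF assms(3) run_min_sqdistM assms(4)]],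
      rule Suc.prems, rule l, rule run_bind[OF run_snocM[OF l]], simp only:)
    fix x assume x: "x \<in> set S"
    have "run (quasiM m S (U @ [x])) (m * ((n + 1) * ((u + 2) * (3 * CARD('d) + 3) + 2) + (2 * u + 2)))
      (\<lambda>V. \<exists>us. V = (U @ [x]) @ us \<and> length us = m \<and> set us \<subseteq> set S)"
      by (rule Suc.IH) (use Suc.prems in auto)
    then show "run (quasiM m S (U @ [x])) (m * ((n + 1) * ((u + 2) * (3 * CARD('d) + 3) + 2) + (2 * u + 2)))
      (\<lambda>V. \<exists>us. V = U @ us \<and> length us = Suc m \<and> set us \<subseteq> set S)"
    proof (rule run_weaken, elim exE conjE)
      fix V us assume "V = (U @ [x]) @ us" "length us = m" "set us \<subseteq> set S"
      then show "\<exists>us. V = U @ us \<and> length us = Suc m \<and> set us \<subseteq> set S"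
        using x by (intro exI[of _ "x # us"]) simp
    qed
  qed simp
qed

lemma run_region_meanM:
  fixes U :: "(real^'d) list"
  assumes "U \<noteq> []" and "length U \<le> u" and "length sr \<le> n"
  shows "run (region_meanM U sr v) ((n + 2) * ((u + 2) * (3 * CARD('d) + 4))) (\<lambda>_. True)"
proof -
  have min: "run (argminM (sqdistM x) U) ((u + 1) * (3 * CARD('d) + 1 + 2)) (\<lambda>_. True)" for x
    by (rule run_weaken[OF run_argminM[OF assms(1) run_weaken[OF run_sqdistM] assms(2)]]) simp_all
  have fold: "run (foldM (\<lambda>(a, n) (x, r). do {
         v' \<leftarrow> argminM (sqdistM x) U;
         b \<leftarrow> step CARD('d) 0 (v' = v);
         step 3 0 (if b then (a + r\<^sup>2, n + 1) else (a, n)) }) (0, 0 :: real) sr)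
      (n * ((u + 1) * (3 * CARD('d) + 1 + 2) + (CARD('d) + 0 + (3 + 0)) + 1) + 1) (\<lambda>_. True)"
    by (rule run_foldM[OF _ _ assms(3)])
       (auto simp only: split_paired_all prod.case intro!: run_bind[OF min] run_bind_step run_step)
  show ?thesis unfolding region_meanM_def
    by (rule run_mono, rule run_bind[OF fold], clarify, rule run_step) (simp_all add: algebra_simps)
qed

text \<open>The exact cost is hidden in \<open>C\<close>; what counts is that \<open>C\<close> is
  fixed before the sample and the fit.\<close>

lemma run_new_centerM:
  fixes S :: "(real^'d::finite) list"
  shows "\<exists>C. \<forall>\<delta> S (F :: 'd fit). fit_inv \<delta> S F \<and> centers F \<noteq> [] \<and> length (centers F) \<le> j \<and>
      length (centers F) < length S \<and> length S \<le> n \<longrightarrow> run (new_centerM S F) C (\<lambda>c. c \<in> set S)"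
proof (rule exI, intro allI impI, elim conjE)
  fix \<delta> S and F :: "'d fit"
  assume inv: "fit_inv \<delta> S F" and ne: "centers F \<noteq> []" and j: "length (centers F) \<le> j"
    and jn: "length (centers F) < length S" and n: "length S \<le> n"
  \<comment> \<open>Positive, as some sample position is left. So \<open>argmaxM\<close> receives a
    candidate and does not get stuck.\<close>
  let ?m = "min (CARD('d) + 1) (length S - length (centers F))"
  define u where "u = j + (CARD('d) + 1)"
  have m: "length (centers F) + ?m \<le> u" using j by (simp add: u_def)
  let ?A = "(n + 1) * ((u + 2) * (3 * CARD('d) + 3) + 2) + (2 * u + 2)"
  have quasi: "run (quasiM ?m S (centers F)) ((CARD('d) + 1) * ?A)
    (\<lambda>V. \<exists>us. V = centers F @ us \<and> length us = ?m \<and> set us \<subseteq> set S)"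
    by (rule run_mono[OF run_quasiM[OF ne m _ n] mult_le_mono1]) (use jn in auto)
  have drop: "run (dropM (length (centers F)) U) (j + 1) (\<lambda>v. v = drop (length (centers F)) U)"
    for U :: "(real^'d) list" by (rule run_dropM[OF j])
  show "run (new_centerM S F) (n + 1 + (j + 1 + (3 + 0 + ((CARD('d) + 1) * ?A + (j + 1 + (3 * n + 1 +
      (u + 1) * ((n + 2) * ((u + 2) * (3 * CARD('d) + 4)) + 2))))))) (\<lambda>c. c \<in> set S)"
    unfolding new_centerM_def
  proof (rule run_bind[OF run_lenM[OF n]], simp only:, rule run_bind[OF run_lenM[OF j]], simp only:,
      rule run_bind_step, rule run_bind[OF quasi], elim exE conjE, simp only:, rule run_bind[OF drop], simp only:,
      rule run_bind[OF run_zipM[OF n]], simp only:)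
    fix us assume us: "length us = ?m" "set us \<subseteq> set S"
    have lsr: "length (zip S (resid F)) \<le> n" using n by simp
    have lU: "length (centers F @ us) \<le> u" using us m by simp
    show "run (argmaxM (region_meanM (centers F @ us) (zip S (resid F)))
        (drop (length (centers F)) (centers F @ us)))
      ((u + 1) * ((n + 2) * ((u + 2) * (3 * CARD('d) + 4)) + 2)) (\<lambda>c. c \<in> set S)"
      by (rule run_weaken[OF run_argmaxM[OF _ run_region_meanM[OF _ lU lsr]]]) (use us m jn ne in auto)
  qed
qed

text \<open>Connects \<open>gcol_pigeonhole\<close> with the stopping test: the invariant bounds the
  \<open>i\<close>th diagonal entry by the distance of the two columns and identifies the first one
  with the norm of the first column.\<close>

lemma ill_conditioned_if_many_centers:
  assumes "fit_inv \<delta> S F" and "i < length (centers F)" and "k < i" and "\<omega> > 0"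
    and "\<omega> * l2dist (gcol \<delta> S (centers F ! i)) (gcol \<delta> S (centers F ! k)) <
           sqrt (dot (gcol \<delta> S (centers F ! 0)) (gcol \<delta> S (centers F ! 0)))"
  shows "\<omega> * \<bar>last (rcols F ! i)\<bar> < \<bar>last (rcols F ! 0)\<bar>"
proof -
  have "\<omega> * \<bar>last (rcols F ! i)\<bar> \<le> \<omega> * l2dist (gcol \<delta> S (centers F ! i)) (gcol \<delta> S (centers F ! k))"
    using assms by (intro mult_left_mono) (auto simp: fit_inv_def)
  also note assms(5)
  also have "sqrt (dot (gcol \<delta> S (centers F ! 0)) (gcol \<delta> S (centers F ! 0))) = \<bar>last (rcols F ! 0)\<bar>"
    using assms(1,2) by (auto simp: fit_inv_def)
  finally show ?thesis .
qed

text \<open>The premise on \<open>K\<close> abstracts from the geometry: a fit with at least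
  \<open>K\<close> centers fails the condition test. So a center is added only while there are fewer
  than \<open>K\<close>, and \<open>K - length (centers F)\<close> measures the remaining
  iterations.\<close>

lemma run_explore_loopM:
  fixes P :: srt_params
  assumes "\<omega>1 P > 0"
  shows "\<exists>C. \<forall>\<delta> S (F :: ('d::finite) fit).
      (\<forall>F :: 'd fit. fit_inv \<delta> S F \<and> K \<le> length (centers F) \<longrightarrow>
         (\<exists>i<length (centers F). \<omega>1 P * \<bar>last (rcols F ! i)\<bar> < \<bar>last (rcols F ! 0)\<bar>)) \<and>
      fit_inv \<delta> S F \<and> centers F \<noteq> [] \<and> length (centers F) \<le> K \<and> length S \<le> n \<longrightarrow>
      run (explore_loopM P \<delta> S F) C
        (\<lambda>F'. fit_inv \<delta> S F' \<and> centers F' \<noteq> [] \<and> length (centers F') \<le> K)"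
proof -
  obtain C where C: "\<And>\<delta> S (F :: 'd fit). \<lbrakk>fit_inv \<delta> S F; centers F \<noteq> []; length (centers F) \<le> K;
      length (centers F) < length S; length S \<le> n\<rbrakk> \<Longrightarrow> run (new_centerM S F) C (\<lambda>c. c \<in> set S)"
    using run_new_centerM[of K n] by metis
  define A where "A = 50 * (K + 1) * (n + 1) * (K + CARD('d) + 1)"
  \<comment> \<open>The cost of one iteration, without the recursive call; the zeros are the
    \<open>ret\<close> branches.\<close>
  define B where "B = K * (K + 10) + 10 + (n + 1 + (K + 1 + (1 + 0 + (0 + (C + (A + (4 * n + 4 +
    (4 * n + 4 + (2 + 0 + 0)))))))))"
  have loop: "run (explore_loopM P \<delta> S F) ((K - length (centers F) + 1) * B)
      (\<lambda>F'. fit_inv \<delta> S F' \<and> centers F' \<noteq> [] \<and> length (centers F') \<le> K)"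
    if K: "\<forall>F :: 'd fit. fit_inv \<delta> S F \<and> K \<le> length (centers F) \<longrightarrow>
         (\<exists>i<length (centers F). \<omega>1 P * \<bar>last (rcols F ! i)\<bar> < \<bar>last (rcols F ! 0)\<bar>)"
      and "fit_inv \<delta> S F" "centers F \<noteq> []" "length (centers F) \<le> K" and n: "length S \<le> n"
    for \<delta> S and F :: "'d fit"
    using that(2-4)
  proof (induction "K - length (centers F)" arbitrary: F rule: less_induct)
    case less
    note inv = less.prems(1) and ne = less.prems(2) and j = less.prems(3)
    have lr: "length (rcols F) \<le> K" "\<forall>col\<in>set (rcols F). length col \<le> K" "length (resid F) \<le> n"
      using inv j n by (auto simp: fit_inv_def in_set_conv_nth)
    have next_fit: "run (do {
        c \<leftarrow> new_centerM S F;
        F' \<leftarrow> add_centerM \<delta> S F c;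
        e \<leftarrow> rmsM (resid F);
        e' \<leftarrow> rmsM (resid F');
        conv \<leftarrow> step 2 0 (e - e' < \<omega>2 P);
        if conv then ret F' else explore_loopM P \<delta> S F' })
      (C + (A + (4 * n + 4 + (4 * n + 4 + (2 + 0 + (0 + (K - length (centers F)) * B))))))
      (\<lambda>F'. fit_inv \<delta> S F' \<and> centers F' \<noteq> [] \<and> length (centers F') \<le> K)"
      if jK: "length (centers F) < K" and jS: "length (centers F) < length S"
    proof (rule run_bind[OF C[OF inv ne j jS n]])
      fix c assume c: "c \<in> set S"
      have add: "run (add_centerM \<delta> S F c) A (\<lambda>F'. fit_inv \<delta> S F' \<and> centers F' = centers F @ [c])"
        unfolding A_def by (rule run_add_centerM[OF inv c n j])
      show "run (do {
          F' \<leftarrow> add_centerM \<delta> S F c;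
          e \<leftarrow> rmsM (resid F);
          e' \<leftarrow> rmsM (resid F');
          conv \<leftarrow> step 2 0 (e - e' < \<omega>2 P);
          if conv then ret F' else explore_loopM P \<delta> S F' })
        (A + (4 * n + 4 + (4 * n + 4 + (2 + 0 + (0 + (K - length (centers F)) * B)))))
        (\<lambda>F'. fit_inv \<delta> S F' \<and> centers F' \<noteq> [] \<and> length (centers F') \<le> K)"
      proof (rule run_bind[OF add], elim conjE)
        fix F' :: "'d fit" assume F': "fit_inv \<delta> S F'" "centers F' = centers F @ [c]"
        have lr': "length (resid F') \<le> n" using F' n by (simp add: fit_inv_def)
        have "run (explore_loopM P \<delta> S F') ((K - length (centers F') + 1) * B)
            (\<lambda>F'. fit_inv \<delta> S F' \<and> centers F' \<noteq> [] \<and> length (centers F') \<le> K)"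
          by (rule less.hyps) (use F' jK in auto)
        moreover have "K - length (centers F') + 1 = K - length (centers F)" using F' jK by simp
        ultimately have IH: "run (explore_loopM P \<delta> S F') ((K - length (centers F)) * B)
            (\<lambda>F'. fit_inv \<delta> S F' \<and> centers F' \<noteq> [] \<and> length (centers F') \<le> K)" by (simp only:)
        show "run (do {
            e \<leftarrow> rmsM (resid F);
            e' \<leftarrow> rmsM (resid F');
            conv \<leftarrow> step 2 0 (e - e' < \<omega>2 P);
            if conv then ret F' else explore_loopM P \<delta> S F' })
          (4 * n + 4 + (4 * n + 4 + (2 + 0 + (0 + (K - length (centers F)) * B))))
          (\<lambda>F'. fit_inv \<delta> S F' \<and> centers F' \<noteq> [] \<and> length (centers F') \<le> K)"
          by (rule run_bind[OF run_rmsM[OF lr(3)]], rule run_bind[OF run_rmsM[OF lr']], rule run_bind_step,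
              rule run_if[OF run_ret IH]) (use F' jK in auto)
      qed
    qed
    have B: "K * (K + 10) + 10 + (n + 1 + (K + 1 + (1 + 0 + (0 + (C + (A + (4 * n + 4 +
        (4 * n + 4 + (2 + 0 + (0 + x)))))))))) = x + B" for x
      by (simp add: B_def)
    show ?case
    proof (subst explore_loopM.simps, rule run_mono,
        rule run_bind[OF run_ill_conditionedM[OF lr(1,2) assms]], rule run_bind[OF run_lenM[OF n]], simp only:,
        rule run_bind[OF run_lenM[OF j]], simp only:, rule run_bind_step, rule run_if[OF run_ret next_fit])
      fix ill
      assume "\<forall>i<length (rcols F). \<omega>1 P * \<bar>last (rcols F ! i)\<bar> < \<bar>last (rcols F ! 0)\<bar> \<longrightarrow> ill"
        and "\<not> (ill \<or> length S \<le> length (centers F))"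
      then show "length (centers F) < K"
        using K inv by (metis fit_inv_def not_le)
    qed (use inv ne j in \<open>auto simp only: B distrib_right mult_1\<close>)
  qed
  show ?thesis
    by (intro exI[of _ "(K + 1) * B"] allI impI, elim conjE, rule run_mono[OF loop mult_le_mono1])
       (assumption | simp)+
qed

text \<open>The length of the result guarantees that zipping coefficients with centers loses
  nothing, so every approximation has at least one center. This keeps the average number of centers
  at least 1.\<close>

lemma run_backsubM:
  assumes "\<forall>col\<in>set cols. length col \<le> k" and "length b \<le> k"
  shows "run (backsubM cols b acc) (length cols * (13 * k + 9) + 1)
    (\<lambda>as. length as = length cols + length acc)"
  using assms
proof (induction cols arbitrary: b acc)
  case Nil
  show ?case by (simp, rule run_mono[OF run_step]) simp_all
next
  case (Cons col cols)
  have col: "length (butlast col) \<le> k" using Cons.prems by auto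
  show ?case unfolding backsubM.simps
    by (rule run_mono, rule run_bind_step, rule run_bind_step, rule run_bind_step,
        rule run_bind[OF run_axpyM[OF col]], simp only:, rule run_bind_step, rule run_weaken[OF Cons.IH])
      (use Cons.prems in auto)
qed

text \<open>With \<open>q\<close> the largest squared distance from the mean, this is the effect of
  the choice of \<open>\<delta>\<close>: the scaled sample lies in a ball of radius
  \<open>sqrt L\<close>. If \<open>q = 0\<close>, all points equal the mean, and
  \<open>\<delta> = 0\<close> by \<open>x / 0 = 0\<close>.\<close>

lemma shape_parameter_bound:
  fixes x m :: "'a::real_normed_vector"
  assumes "L > 0" and "(norm (m - x))\<^sup>2 \<le> q"
  shows "sqrt (L / q) * norm (x - m) \<le> sqrt L"
proof -
  have q: "q \<ge> 0" using assms(2) zero_le_power2 order_trans by blast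
  have "sqrt (L / q) * norm (x - m) = sqrt (L / q * (norm (m - x))\<^sup>2)"
    by (simp only: real_sqrt_mult real_sqrt_abs abs_norm_cancel norm_minus_commute[of x m])
  also have "\<dots> \<le> sqrt L"
    using assms q by (intro real_sqrt_le_mono) (cases "q = 0", auto simp: field_simps)
  finally show ?thesis .
qed

text \<open>\<open>K\<close> precedes \<open>n\<close>, so the number of centers is bounded
  independently of the sample size. The premise on \<open>inh\<close> is there because the fold over
  the inherited centers performs no condition test.\<close>

lemma run_exploreM:
  fixes P :: srt_params
  assumes "\<omega>1 P > 0" and "0 < \<omega>3 P" and "\<omega>3 P < 1"
  shows "\<exists>K>0. \<forall>n. \<exists>C. \<forall>(inh :: (real^'d::finite) list) sr.
      sr \<noteq> [] \<and> set inh \<subseteq> fst ` set sr \<and> length inh \<le> K \<and> length sr \<le> n \<longrightarrow>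
      run (exploreM P inh sr) C (\<lambda>g. snd g \<noteq> [] \<and> length (snd g) \<le> K)"
proof -
  define L where "L = - ln (\<omega>3 P)"
  have L: "L > 0" using assms by (simp add: L_def)
  obtain K where K: "K > 0" and
    pigeonhole: "\<And>\<delta> m (S :: (real^'d) list) cs. \<lbrakk>\<delta> \<ge> 0; \<forall>x\<in>set S. \<delta> * norm (x - m) \<le> sqrt L; set cs \<subseteq> set S;
       K \<le> length cs\<rbrakk> \<Longrightarrow>
       \<exists>i<length cs. \<exists>k<i. \<omega>1 P * l2dist (gcol \<delta> S (cs ! i)) (gcol \<delta> S (cs ! k)) <
         sqrt (dot (gcol \<delta> S (cs ! 0)) (gcol \<delta> S (cs ! 0)))"
    using gcol_pigeonhole[OF L assms(1)] by metis
  show ?thesis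
  proof (rule exI[of _ K], intro conjI K allI)
    fix n
    obtain C where "\<forall>\<delta> S (F :: 'd fit).
      (\<forall>F :: 'd fit. fit_inv \<delta> S F \<and> K \<le> length (centers F) \<longrightarrow>
         (\<exists>i<length (centers F). \<omega>1 P * \<bar>last (rcols F ! i)\<bar> < \<bar>last (rcols F ! 0)\<bar>)) \<and>
      fit_inv \<delta> S F \<and> centers F \<noteq> [] \<and> length (centers F) \<le> K \<and> length S \<le> n \<longrightarrow>
      run (explore_loopM P \<delta> S F) C
        (\<lambda>F'. fit_inv \<delta> S F' \<and> centers F' \<noteq> [] \<and> length (centers F') \<le> K)"
      using run_explore_loopM[OF assms(1), of K n] by (rule exE)
    note C = this[THEN spec, THEN spec, THEN spec, THEN mp, OF conjI, OF _ conjI, OF _ _ conjI,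
        OF _ _ _ conjI]
    define A where "A = 50 * (K + 1) * (n + 1) * (K + CARD('d) + 1)"
    show "\<exists>C. \<forall>(inh :: (real^'d) list) sr.
      sr \<noteq> [] \<and> set inh \<subseteq> fst ` set sr \<and> length inh \<le> K \<and> length sr \<le> n \<longrightarrow>
      run (exploreM P inh sr) C (\<lambda>g. snd g \<noteq> [] \<and> length (snd g) \<le> K)"
    proof (rule exI, intro allI impI, elim conjE)
      fix inh :: "(real^'d) list" and sr :: "'d sample list"
      assume sr: "sr \<noteq> []" and inh: "set inh \<subseteq> fst ` set sr" "length inh \<le> K" and n: "length sr \<le> n"
      define S where "S = map (\<lambda>(x, r, b). x) sr"
      define rs where "rs = map (\<lambda>(x, r, b). r) sr"
      have S: "length S \<le> n" "S \<noteq> []" "set S = fst ` set sr" "length rs = length S"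
        using sr n by (auto simp: S_def rs_def case_prod_unfold)
      have mS: "run (mapM (\<lambda>(x, r, b). step 1 0 x) sr) (n * (1 + 0 + 2) + 1) (\<lambda>v. v = S)"
        unfolding S_def by (rule run_mapM[OF _ n]) (auto intro: run_mono[OF run_step])
      have mr: "run (mapM (\<lambda>(x, r, b). step 1 0 r) sr) (n * (1 + 0 + 2) + 1) (\<lambda>v. v = rs)"
        unfolding rs_def by (rule run_mapM[OF _ n]) (auto intro: run_mono[OF run_step])
      have q: "run (maxM (sqdistM m) S) (n * (3 * CARD('d) + 2) + 1)
          (\<lambda>q. 0 \<le> q \<and> (\<forall>x\<in>set S. (norm (m - x))\<^sup>2 \<le> q))" for m
        by (rule run_maxM[OF run_sqdistM S(1)])
      have amin: "run (argminM (sqdistM m) S) ((n + 1) * (3 * CARD('d) + 1 + 2)) (\<lambda>y. y \<in> set S)" for m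
        by (rule run_argminM[OF S(2) run_weaken[OF run_sqdistM] S(1)]) simp
      \<comment> \<open>\<open>K > 0\<close> leaves room for the single starting center of a node
        that inherits none.\<close>
      have start: "run (if inh = [] then do { c \<leftarrow> argminM (sqdistM m) S; step 2 1 [c] } else step 1 0 inh)
          ((n + 1) * (3 * CARD('d) + 1 + 2) + (2 + 1) + (1 + 0))
          (\<lambda>cs. cs \<noteq> [] \<and> set cs \<subseteq> set S \<and> length cs \<le> K)" for m
        by (rule run_if, rule run_bind[OF amin], rule run_step) (use K in simp, rule run_step, use inh S in simp)
      show "run (exploreM P inh sr) (n * (1 + 0 + 2) + 1 + (n * (1 + 0 + 2) + 1 +
        ((2 * n + 2) * (CARD('d) + 1) + 2 + (n * (3 * CARD('d) + 2) + 1 + (4 + 0 +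
        ((n + 1) * (3 * CARD('d) + 1 + 2) + (2 + 1) + (1 + 0) + (1 + 5 + (K * (A + 1) + 1 + (C +
        (K + 1 + K + (K * (13 * K + 9) + 1 + (3 * K + 1 + (1 + 2)))))))))))))
        (\<lambda>g. snd g \<noteq> [] \<and> length (snd g) \<le> K)"
        unfolding exploreM_def
      proof (rule run_bind[OF mS], simp only:, rule run_bind[OF mr], simp only:,
          rule run_bind[OF run_meanM[OF S(1)]], rule run_bind[OF q], rule run_bind_step, rule run_bind[OF start],
          rule run_bind_step)
        fix m q cs
        assume qm: "0 \<le> q \<and> (\<forall>x\<in>set S. (norm (m - x))\<^sup>2 \<le> q)"
          and cs: "cs \<noteq> [] \<and> set cs \<subseteq> set S \<and> length cs \<le> K"
        define \<delta> where "\<delta> = sqrt (- ln (\<omega>3 P) / q)"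
        have "\<delta> = sqrt (L / q)" by (simp add: \<delta>_def L_def)
        then have \<delta>: "\<delta> \<ge> 0" "\<forall>x\<in>set S. \<delta> * norm (x - m) \<le> sqrt L"
          using qm L shape_parameter_bound[OF L] by auto
        have ill: "\<forall>F :: 'd fit. fit_inv \<delta> S F \<and> K \<le> length (centers F) \<longrightarrow>
         (\<exists>i<length (centers F). \<omega>1 P * \<bar>last (rcols F ! i)\<bar> < \<bar>last (rcols F ! 0)\<bar>)"
        proof (intro allI impI, elim conjE)
          fix F :: "'d fit" assume F: "fit_inv \<delta> S F" "K \<le> length (centers F)"
          then have "set (centers F) \<subseteq> set S" by (simp add: fit_inv_def)
          from pigeonhole[OF \<delta> this F(2)] obtain i k where "i < length (centers F)" "k < i"
            "\<omega>1 P * l2dist (gcol \<delta> S (centers F ! i)) (gcol \<delta> S (centers F ! k)) <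
              sqrt (dot (gcol \<delta> S (centers F ! 0)) (gcol \<delta> S (centers F ! 0)))" by blast
          with ill_conditioned_if_many_centers[OF F(1) _ _ assms(1)]
          show "\<exists>i<length (centers F). \<omega>1 P * \<bar>last (rcols F ! i)\<bar> < \<bar>last (rcols F ! 0)\<bar>" by blast
        qed
        let ?F0 = "\<lparr>centers = [], qcols = [], rcols = [], qtr = [], resid = rs\<rparr> :: 'd fit"
        have "run (foldM (add_centerM \<delta> S) ?F0 cs) (length cs * (A + 1) + 1)
            (\<lambda>F. fit_inv \<delta> S F \<and> centers F = take (length cs) cs)"
        proof (rule run_foldM_nth)
          fix i and F :: "'d fit"
          assume i: "i < length cs" and F: "fit_inv \<delta> S F \<and> centers F = take i cs"
          then have "cs ! i \<in> set S" using cs by (auto dest: nth_mem)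
          moreover have "length (centers F) \<le> K" using F cs by (simp add: min.coboundedI1)
          ultimately have "run (add_centerM \<delta> S F (cs ! i)) A
              (\<lambda>F'. fit_inv \<delta> S F' \<and> centers F' = centers F @ [cs ! i])"
            using F S(1) unfolding A_def by (intro run_add_centerM) auto
          then show "run (add_centerM \<delta> S F (cs ! i)) A
              (\<lambda>F'. fit_inv \<delta> S F' \<and> centers F' = take (Suc i) cs)"
            using F i by (simp add: take_Suc_conv_app_nth)
        qed (use S in \<open>simp add: fit_inv_def\<close>)
        from run_mono[OF this linear_mono]
        have fold: "run (foldM (add_centerM \<delta> S) ?F0 cs) (K * (A + 1) + 1)
            (\<lambda>F. fit_inv \<delta> S F \<and> centers F = cs)"
          using cs by simp
        show "run (do {
            F1 \<leftarrow> foldM (add_centerM (sqrt (- ln (\<omega>3 P) / q)) S) ?F0 cs;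
            F \<leftarrow> explore_loopM P (sqrt (- ln (\<omega>3 P) / q)) S F1;
            cols \<leftarrow> step (length (rcols F) + 1) (length (rcols F)) (rev (rcols F));
            \<alpha>s \<leftarrow> backsubM cols (qtr F) [];
            ac \<leftarrow> zipM \<alpha>s (centers F);
            step 1 2 (sqrt (- ln (\<omega>3 P) / q), ac) })
          (K * (A + 1) + 1 + (C + (K + 1 + K + (K * (13 * K + 9) + 1 + (3 * K + 1 + (1 + 2))))))
          (\<lambda>g. snd g \<noteq> [] \<and> length (snd g) \<le> K)"
          unfolding \<delta>_def[symmetric]
        proof (rule run_bind[OF fold], rule run_bind[OF C[OF ill]])
          fix F :: "'d fit"
          assume F: "fit_inv \<delta> S F \<and> centers F \<noteq> [] \<and> length (centers F) \<le> K"
          have l: "length (rcols F) = length (centers F)" "length (qtr F) \<le> K"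
            "\<forall>col\<in>set (rev (rcols F)). length col \<le> K"
            using F by (auto simp: fit_inv_def in_set_conv_nth)
          have "run (backsubM (rev (rcols F)) (qtr F) []) (length (rev (rcols F)) * (13 * K + 9) + 1)
            (\<lambda>as. length as = length (rev (rcols F)) + length ([] :: real list))"
            by (rule run_backsubM[OF l(3,2)])
          from run_mono[OF this linear_mono]
          have bs: "run (backsubM (rev (rcols F)) (qtr F) []) (K * (13 * K + 9) + 1)
            (\<lambda>as. length as = length (centers F))"
            using F l by simp
          have "run (do {
              \<alpha>s \<leftarrow> backsubM (rev (rcols F)) (qtr F) [];
              ac \<leftarrow> zipM \<alpha>s (centers F);
              step 1 2 (\<delta>, ac) })
            (K * (13 * K + 9) + 1 + (3 * K + 1 + (1 + 2)))
            (\<lambda>g. snd g \<noteq> [] \<and> length (snd g) \<le> K)"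
          proof (rule run_bind[OF bs])
            fix as :: "real list" assume as: "length as = length (centers F)"
            then have "length as \<le> K" using F by simp
            then show "run (do { ac \<leftarrow> zipM as (centers F); step 1 2 (\<delta>, ac) }) (3 * K + 1 + (1 + 2))
                (\<lambda>g. snd g \<noteq> [] \<and> length (snd g) \<le> K)"
              by (rule run_bind[OF run_zipM], simp only:, intro run_step) (use as F in auto)
          qed
          then show "run (do {
              cols \<leftarrow> step (length (rcols F) + 1) (length (rcols F)) (rev (rcols F));
              \<alpha>s \<leftarrow> backsubM cols (qtr F) [];
              ac \<leftarrow> zipM \<alpha>s (centers F);
              step 1 2 (\<delta>, ac) })
            (K + 1 + K + (K * (13 * K + 9) + 1 + (3 * K + 1 + (1 + 2))))
            (\<lambda>g. snd g \<noteq> [] \<and> length (snd g) \<le> K)"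
            by (rule run_mono[OF run_bind_step]) (use F l in simp)
        qed (use cs S in auto)
      qed
    qed
  qed
qed

section \<open>Processing a node\<close>

text \<open>Absorbs additive constants into a multiple of the number of points.\<close>

lemma const_le: "1 \<le> N \<Longrightarrow> c \<le> c * (N :: nat)"
  by simp

text \<open>The premise \<open>m \<le> length xs\<close> keeps the list nonempty at every draw, so
  reducing modulo its length gives a valid index for any random stream.\<close>

lemma run_drawM:
  assumes "m \<le> length xs" and "length xs \<le> n"
  shows "run (drawM rnd pos m xs) (m * (4 * n + 8) + 1) (\<lambda>ys. length ys = m)"
  using assms
proof (induction m arbitrary: pos xs)
  case 0
  show ?case by (simp, rule run_mono[OF run_step]) simp_all
next
  case (Suc m)
  let ?i = "rnd pos mod length xs"
  have i: "?i < length xs" by (rule mod_less_divisor) (use Suc.prems in auto)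
  have IH: "run (drawM rnd (Suc pos) m (take ?i xs @ drop (Suc ?i) xs)) (m * (4 * n + 8) + 1)
      (\<lambda>ys. length ys = m)"
    by (rule Suc.IH) (use Suc.prems i in auto)
  show ?case unfolding drawM.simps
    by (rule run_mono, rule run_bind[OF run_lenM[OF Suc.prems(2)]], simp only:, rule run_bind_step,
        rule run_bind[OF run_nthM[OF i Suc.prems(2)]], simp only:, rule run_bind_step,
        rule run_bind[OF IH], rule run_step) (use Suc.prems in simp_all)
qed

text \<open>Every draw copies the remaining list and costs O(N), so linearity rests on
  \<open>sz\<close> staying bounded. With \<open>0 < sz\<close> the sample is nonempty, as
  exploration requires.\<close>

lemma run_sparsifyM:
  fixes X :: "'d::finite sample list"
  assumes N: "length X \<le> N" "1 \<le> N" and X: "X \<noteq> []" and sz: "0 < sz"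
  shows "run (sparsifyM rnd pos sz X) ((12 * sz + 40) * N)
    (\<lambda>(cs, S, pos'). cs = map fst (filter (\<lambda>p. snd (snd p)) X) \<and> set cs \<subseteq> fst ` set S \<and> S \<noteq> [] \<and>
       length S \<le> max (length cs) sz)"
proof -
  define inh where "inh = filter (\<lambda>p. snd (snd p)) X"
  define rest where "rest = filter (\<lambda>p. \<not> snd (snd p)) X"
  have len: "length inh + length rest = length X"
    unfolding inh_def rest_def by (rule sum_length_filter_compl)
  let ?m = "min (length X) (max (length inh) sz) - length inh"
  have inh: "run (filterM (\<lambda>(x, r, b). step 1 0 b) X) (N * (1 + 3) + 1) (\<lambda>v. v = inh)"
    unfolding inh_def by (rule run_filterM[OF _ N(1)]) (auto intro: run_mono[OF run_step])
  have rest: "run (filterM (\<lambda>(x, r, b). step 1 0 (\<not> b)) X) (N * (1 + 3) + 1) (\<lambda>v. v = rest)"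
    unfolding rest_def by (rule run_filterM[OF _ N(1)]) (auto intro: run_mono[OF run_step])
  have l: "length inh \<le> N" "length rest \<le> N" using len N by linarith+
  have m: "?m \<le> length rest" "?m \<le> sz" using len by auto
  have draw: "run (drawM rnd pos ?m rest) (sz * (4 * N + 8) + 1) (\<lambda>ys. length ys = ?m)"
    by (rule run_mono[OF run_drawM[OF m(1) l(2)] linear_mono[OF m(2)]])
  have cs: "run (mapM (\<lambda>(x, r, b). step 1 0 x) inh) (N * (1 + 2) + 1) (\<lambda>v. v = map fst inh)"
    by (rule run_mapM[OF _ l(1)]) (auto intro: run_mono[OF run_step])
  have 1: "length X > 0" using X by simp
  have arith: "N * (1 + 3) + 1 + (N * (1 + 3) + 1 + (N + 1 + (N + 1 + (3 + 0 + (sz * (4 * N + 8) + 1 +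
      (2 * N + 1 + (N * (1 + 2) + 1 + (1 + 3)))))))) \<le> (12 * sz + 40) * N"
    using const_le[OF N(2), of "8 * sz + 14"] by (simp add: algebra_simps)
  show ?thesis unfolding sparsifyM_def
    by (rule run_mono[OF _ arith], rule run_bind[OF inh], simp only:, rule run_bind[OF rest], simp only:,
        rule run_bind[OF run_lenM[OF N(1)]], simp only:, rule run_bind[OF run_lenM[OF l(1)]], simp only:,
        rule run_bind_step, rule run_bind[OF draw], rule run_bind[OF run_appendM[OF l(1)]], simp only:,
        rule run_bind[OF cs], simp only:, rule run_step)
      (use 1 sz len in \<open>auto simp: min_def split: if_splits simp flip: inh_def\<close>)
qed

section \<open>Evaluating approximations and updating residuals\<close>

lemma run_evalM:
  fixes x :: "real^'d::finite"
  assumes "length (snd g) \<le> K"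
  shows "run (evalM g x) (K * (3 * CARD('d) + 7) + 1) (\<lambda>_. True)"
  unfolding evalM_def
  by (rule run_mono[OF run_sumM_any[where b = "3 * CARD('d) + 5", OF _ assms]], clarsimp,
      rule run_mono, rule run_bind[OF run_gaussM], rule run_step) simp_all

text \<open>At the start of a node these are its inherited centers.\<close>

definition flagged :: "'d sample list \<Rightarrow> nat" where
  "flagged X = length (filter (\<lambda>p. snd (snd p)) X)"

text \<open>Unchanged locations, and flags only at centers of \<open>g\<close>, are the facts from
  which \<open>flagged_part\<close> bounds the centers inherited by the parts.\<close>

lemma run_updateM:
  fixes X :: "'d::finite sample list"
  assumes N: "length X \<le> N" "1 \<le> N" and K: "length (snd g) \<le> K"
  shows "run (updateM g X) ((K * (4 * CARD('d) + 10) + 20) * N)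
    (\<lambda>X'. map fst X' = map fst X \<and> (\<forall>p\<in>set X'. snd (snd p) \<longrightarrow> fst p \<in> snd ` set (snd g)))"
proof -
  define cs where "cs = map snd (snd g)"
  have cs: "run (mapM (\<lambda>(\<alpha>, c). step 1 0 c) (snd g)) (K * (1 + 2) + 1) (\<lambda>v. v = cs)"
    unfolding cs_def by (rule run_mapM[OF _ K]) (auto intro: run_mono[OF run_step])
  have member: "run (memberM x cs) (CARD('d) * K + 1) (\<lambda>b. b \<longleftrightarrow> x \<in> snd ` set (snd g))" for x
    unfolding memberM_def by (rule run_mono[OF run_step]) (use K in \<open>simp_all add: cs_def\<close>)
  let ?Q = "\<lambda>p p'. fst p' = fst p \<and> (snd (snd p') \<longrightarrow> fst p' \<in> snd ` set (snd g))"
  let ?b = "K * (3 * CARD('d) + 7) + 1 + (CARD('d) * K + 1 + (1 + 3))"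
  have elem: "run ((\<lambda>(x, r, b). do { v \<leftarrow> evalM g x; b' \<leftarrow> memberM x cs; step 1 3 (x, r - v, b') }) p) ?b (?Q p)"
    for p :: "'d sample"
    by (cases p, simp only: prod.case, rule run_bind[OF run_evalM[OF K]], rule run_bind[OF member],
        rule run_step) simp
  have upd: "run (mapM (\<lambda>(x, r, b). do { v \<leftarrow> evalM g x; b' \<leftarrow> memberM x cs; step 1 3 (x, r - v, b') }) X)
      (N * (?b + 2) + 1) (list_all2 ?Q X)"
    by (rule run_mono[OF run_mapM_rel[OF elem] linear_mono[OF N(1)]])
  have arith: "K * (1 + 2) + 1 + (N * (?b + 2) + 1) \<le> (K * (4 * CARD('d) + 10) + 20) * N"
    using const_le[OF N(2), of "3 * K + 12"] by (simp add: algebra_simps)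
  have rel: "map fst X' = map fst X \<and> (\<forall>p\<in>set X'. snd (snd p) \<longrightarrow> fst p \<in> snd ` set (snd g))"
    if "list_all2 ?Q X X'" for X' :: "'d sample list"
    using that by (induction rule: list_all2_induct) (simp_all, metis)
  show ?thesis unfolding updateM_def
    by (rule run_mono[OF _ arith], rule run_bind[OF cs], simp only:, rule run_weaken[OF upd rel])
qed

text \<open>The result is unconstrained because the sizes of the parts do not depend on the
  direction, not even for the zero vector that a sample with a single point yields.\<close>

lemma run_directionM:
  shows "\<exists>C. \<forall>sr :: 'd::finite sample list. sr \<noteq> [] \<and> length sr \<le> n \<longrightarrow> run (directionM sr) C (\<lambda>_. True)"
proof (rule exI, intro allI impI, elim conjE)
  fix sr :: "'d sample list"
  assume sr: "sr \<noteq> []" and n: "length sr \<le> n"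
  define S where "S = map fst sr"
  define sr2 where "sr2 = map (\<lambda>p. (fst p, fst (snd p))) sr"
  let ?m = "min CARD('d) (length S - 1)" and ?u = "CARD('d) + 1"
  have S: "S \<noteq> []" "length S \<le> n" "length sr2 \<le> n" using sr n by (auto simp: S_def sr2_def)
  have mS: "run (mapM (\<lambda>(x, r, b). step 1 0 x) sr) (n * (1 + 2) + 1) (\<lambda>v. v = S)"
    unfolding S_def by (rule run_mapM[OF _ n]) (auto intro: run_mono[OF run_step])
  have mr: "run (mapM (\<lambda>(x, r, b). step 1 2 (x, r)) sr) (n * (3 + 2) + 1) (\<lambda>v. v = sr2)"
    unfolding sr2_def by (rule run_mapM[OF _ n]) (auto intro: run_mono[OF run_step])
  have far: "run (argmaxM (sqdistM x) S) ((n + 1) * (3 * CARD('d) + 2)) (\<lambda>y. y \<in> set S)" for x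
    by (rule run_argmaxM[OF S(1) run_weaken[OF run_sqdistM] S(2)]) simp
  let ?A = "(n + 1) * ((?u + 2) * (3 * CARD('d) + 3) + 2) + (2 * ?u + 2)"
  have quasi: "run (quasiM ?m S [v]) (CARD('d) * ?A) (\<lambda>V. V \<noteq> [] \<and> length V \<le> ?u)" for v
    by (rule run_mono[OF run_weaken[OF run_quasiM[OF _ _ S(1,2)]] mult_le_mono1]) auto
  show "run (directionM sr) (n * (1 + 2) + 1 + (n * (3 + 2) + 1 + (n + 1 + (2 + 0 +
      ((2 * n + 2) * (CARD('d) + 1) + 2 + ((n + 1) * (3 * CARD('d) + 2) + (1 + 1 + (CARD('d) * ?A +
      ((?u + 1) * ((n + 2) * ((?u + 2) * (3 * CARD('d) + 4)) + 2) + ((n + 1) * (3 * CARD('d) + 2) +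
      (CARD('d) + CARD('d)))))))))))) (\<lambda>_. True)"
    unfolding directionM_def
  proof (rule run_bind[OF mS], simp only:, rule run_bind[OF mr], simp only:, rule run_bind[OF run_lenM[OF S(2)]],
      simp only:, rule run_bind_step, rule run_bind[OF run_meanM[OF S(2)]], rule run_bind[OF far],
      rule run_bind_step, rule run_bind[OF quasi], elim conjE)
    fix V :: "(real^'d) list" assume V: "V \<noteq> []" "length V \<le> ?u"
    show "run (do {
        xa \<leftarrow> argmaxM (region_meanM V sr2) V;
        xb \<leftarrow> argmaxM (sqdistM xa) S;
        vsubM xb xa })
      ((?u + 1) * ((n + 2) * ((?u + 2) * (3 * CARD('d) + 4)) + 2) + ((n + 1) * (3 * CARD('d) + 2) +
      (CARD('d) + CARD('d)))) (\<lambda>_. True)"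
      unfolding vsubM_def
      by (rule run_bind[OF run_argmaxM[OF V(1) run_region_meanM[OF V S(3)] V(2)]], rule run_bind[OF far],
          rule run_step) simp
  qed
qed

section \<open>Splitting at a percentile\<close>

lemma mset_split_at:
  fixes c :: real
  shows "mset ((filter (\<lambda>p. fst p < c) X @ take i (filter (\<lambda>p. fst p = c) X)) @
     drop i (filter (\<lambda>p. fst p = c) X) @ filter (\<lambda>p. fst p > c) X) = mset X"
proof -
  have eq: "mset (take i (filter (\<lambda>p. fst p = c) X)) + mset (drop i (filter (\<lambda>p. fst p = c) X)) =
      mset (filter (\<lambda>p. fst p = c) X)"
    by (metis append_take_drop_id mset_append)
  have all: "mset (filter (\<lambda>p. fst p < c) X) + mset (filter (\<lambda>p. fst p = c) X) +
      mset (filter (\<lambda>p. fst p > c) X) = mset X"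
    by (induction X) auto
  show ?thesis unfolding mset_append all[symmetric] eq[symmetric] by (simp only: add.assoc)
qed

text \<open>The rank of the percentile says that fewer than \<open>k\<close> projections lie below
  it and at least \<open>k\<close> do not exceed it. So the tied points suffice to fill the first
  part up to \<open>k\<close>, even if all projections coincide. The main summand 10000 is the cost
  of \<open>select\<close>.\<close>

lemma run_splitM:
  fixes X :: "'d::finite sample list"
  assumes N: "N = length X" "1 \<le> N" and p: "p \<in> {37..62}"
  shows "run (splitM p w X) ((2 * CARD('d) + 10100) * N)
    (\<lambda>(c, A, B). mset (A @ B) = mset X \<and> length A = (p * N + 99) div 100)"
proof -
  \<comment> \<open>The ceiling of \<open>p * N / 100\<close>. The range of \<open>p\<close> makes
    it lie between 1 and \<open>N\<close>, so position \<open>k - 1\<close> exists.\<close>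
  define k where "k = (p * N + 99) div 100"
  have "p * N \<le> 62 * N" "37 * N \<le> p * N" using p by auto
  then have k: "1 \<le> k" "k \<le> N" using N(2) unfolding k_def by linarith+
  define vX where "vX = map (\<lambda>y. (fst y \<bullet> w, y)) X"
  define vs where "vs = map fst vX"
  have l: "length vX = N" "length vs = N" "length X \<le> N" by (simp_all add: vX_def vs_def N)
  have k1: "k - 1 < length vs" using k l by simp
  have mv: "run (mapM (\<lambda>(x, r, b). do { v \<leftarrow> innerM x w; step 1 2 (v, (x, r, b)) }) X)
      (N * (2 * CARD('d) + 3 + 2) + 1) (\<lambda>v. v = vX)"
    unfolding vX_def
    by (rule run_mapM[OF _ l(3)], clarsimp, rule run_mono, rule run_bind[OF run_innerM], rule run_step) simp_all
  have ms: "run (mapM (\<lambda>(v, y). step 1 0 v) vX) (N * (1 + 2) + 1) (\<lambda>v. v = vs)"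
    unfolding vs_def by (rule run_mapM) (auto simp: l intro: run_mono[OF run_step])
  have sel: "run (select (k - 1) vs) (10000 * N) (has_rank (k - 1) vs)"
    using run_mono[OF run_select[OF k1], of "10000 * N"] l by simp
  have lt: "run (filterM (\<lambda>(v, y). step 1 0 (v < c)) vX) (N * (1 + 3) + 1)
      (\<lambda>v. v = filter (\<lambda>p. fst p < c) vX)" for c
    by (rule run_filterM) (auto simp: l intro: run_mono[OF run_step])
  have eq: "run (filterM (\<lambda>(v, y). step 1 0 (v = c)) vX) (N * (1 + 3) + 1)
      (\<lambda>v. v = filter (\<lambda>p. fst p = c) vX)" for c
    by (rule run_filterM) (auto simp: l intro: run_mono[OF run_step])
  have gt: "run (filterM (\<lambda>(v, y). step 1 0 (v > c)) vX) (N * (1 + 3) + 1)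
      (\<lambda>v. v = filter (\<lambda>p. fst p > c) vX)" for c
    by (rule run_filterM) (auto simp: l intro: run_mono[OF run_step])
  have snds: "run (mapM (\<lambda>(v, y). step 1 0 y) Y) (N * (1 + 2) + 1) (\<lambda>v. v = map snd Y)"
    if "length Y \<le> N" for Y :: "(real \<times> 'd sample) list"
    by (rule run_mapM) (use that in \<open>auto intro: run_mono[OF run_step]\<close>)
  show ?thesis unfolding splitM_def
  proof (rule run_mono, rule run_bind[OF run_lenM[OF l(3)]], simp only: N(1)[symmetric] k_def[symmetric],
      rule run_bind_step, rule run_bind[OF mv], simp only: k_def[symmetric], rule run_bind[OF ms], simp only:,
      rule run_bind_step, rule run_bind[OF sel], rule run_bind[OF lt], simp only:, rule run_bind[OF eq],
      simp only:, rule run_bind[OF gt], simp only:)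
    fix c assume c: "has_rank (k - 1) vs c"
    let ?lt = "filter (\<lambda>p. fst p < c) vX" and ?eq = "filter (\<lambda>p. fst p = c) vX"
      and ?gt = "filter (\<lambda>p. fst p > c) vX"
    let ?i = "k - length ?lt"
    let ?A = "?lt @ take ?i ?eq" and ?B = "drop ?i ?eq @ ?gt"
    have AB: "mset (?A @ ?B) = mset vX" by (rule mset_split_at)
    have lens: "length (?A @ ?B) = N" using mset_eq_length[OF AB] l by simp
    then have lt_N: "length ?lt \<le> N" "length (drop ?i ?eq) \<le> N" "length ?A \<le> N" "length ?B \<le> N"
      by simp_all
    have i: "?i \<le> N" using k by simp
    have "length ?lt \<le> k - 1" "k - 1 < length ?lt + length ?eq"
      using c length_filter_le_split[of c vs] by (simp_all add: has_rank_def vs_def filter_map o_def)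
    then have A: "length ?A = k" using k by simp
    have "mset (map snd ?A @ map snd ?B) = image_mset snd (mset (?A @ ?B))" by simp
    also have "\<dots> = mset X" unfolding AB by (simp add: vX_def image_mset.compositionality o_def)
    finally have AB': "mset (map snd ?A @ map snd ?B) = mset X" .
    show "run (do {
        nl \<leftarrow> lenM ?lt;
        i \<leftarrow> step 1 0 (k - nl);
        eq1 \<leftarrow> takeM i ?eq;
        eq2 \<leftarrow> dropM i ?eq;
        A \<leftarrow> appendM ?lt eq1;
        B \<leftarrow> appendM eq2 ?gt;
        A' \<leftarrow> mapM (\<lambda>(v, y). step 1 0 y) A;
        B' \<leftarrow> mapM (\<lambda>(v, y). step 1 0 y) B;
        step 1 3 (c, A', B') })
      (N + 1 + (1 + 0 + (2 * N + 1 + (N + 1 + (2 * N + 1 + (2 * N + 1 + (N * (1 + 2) + 1 + (N * (1 + 2) + 1 + (1 + 3)))))))))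
      (\<lambda>(c, A, B). mset (A @ B) = mset X \<and> length A = k)"
      by (rule run_bind[OF run_lenM[OF lt_N(1)]], simp only:, rule run_bind_step, rule run_bind[OF run_takeM[OF i]],
          simp only:, rule run_bind[OF run_dropM[OF i]], simp only:, rule run_bind[OF run_appendM[OF lt_N(1)]],
          simp only:, rule run_bind[OF run_appendM[OF lt_N(2)]], simp only:, rule run_bind[OF snds[OF lt_N(3)]],
          simp only:, rule run_bind[OF snds[OF lt_N(4)]], simp only:, rule run_step)
        (simp only: prod.case AB' length_map A)
  qed (use N in \<open>simp add: algebra_simps\<close>)
qed

text \<open>For large nodes the fractions are close to 0.63 at most, but rounding up matters for
  small ones: \<open>p = 62\<close> and \<open>N = 5\<close> give \<open>a = 4\<close>, so 4/5
  cannot be improved. Nonempty parts exclude \<open>N = 1\<close>.\<close>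

lemma split_sizes:
  assumes "p \<in> {37..62}" and "a = (p * N + 99) div 100" and "a + b = N" and "1 \<le> a" and "1 \<le> (b :: nat)"
  shows "5 * a \<le> 4 * N" and "5 * b \<le> 4 * N"
proof -
  have "p * N \<le> 62 * N" "37 * N \<le> p * N" using assms(1) by auto
  moreover have "100 * a \<le> p * N + 99" "p * N \<le> 100 * a" using assms(2) by linarith+
  ultimately have "100 * a \<le> 62 * N + 99" "37 * N \<le> 100 * a" by linarith+
  then show "5 * a \<le> 4 * N" "5 * b \<le> 4 * N" using assms(3-5) by linarith+
qed

section \<open>Building a tree\<close>

primrec depth :: "'d::finite tree \<Rightarrow> nat" where
  "depth (Leaf g b) = 0"
| "depth (Node g w c l r) = Suc (max (depth l) (depth r))"

text \<open>Together with \<open>depth\<close> it governs the cost of a prediction, which evaluates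
  one approximation per node of a path.\<close>

primrec max_centers :: "'d::finite tree \<Rightarrow> nat" where
  "max_centers (Leaf g b) = length (snd g)"
| "max_centers (Node g w c l r) = max (length (snd g)) (max (max_centers l) (max_centers r))"

text \<open>The average number of centers lies between 1 and \<open>K\<close>, multiplied out so
  that the initial state without nodes is included.\<close>

definition state_ok :: "nat \<Rightarrow> nat \<times> nat \<times> nat \<Rightarrow> bool" where
  "state_ok K = (\<lambda>(pos, nodes, total). nodes \<le> total \<and> total \<le> K * nodes)"

lemma state_ok_add:
  assumes "state_ok K (pos, nodes, tot)" and "1 \<le> c" and "c \<le> K"
  shows "state_ok K (pos', nodes + 1, tot + c)"
  using assms by (simp add: state_ok_def)

text \<open>The lower bound of the average makes the rounded size positive; its upper bound makes
  the size independent of the history.\<close>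

lemma sample_size_bounds:
  fixes \<kappa> :: real
  assumes "state_ok K (pos, nodes, tot)" and "\<kappa> > 0" and "0 < m"
  defines "sz \<equiv> if nodes = 0 then m else nat \<lceil>\<kappa> * (real tot / real nodes)\<rceil>"
  shows "0 < sz" and "sz \<le> m + nat \<lceil>\<kappa> * real K\<rceil>"
proof -
  have st: "nodes \<le> tot" "tot \<le> K * nodes" using assms(1) by (simp_all add: state_ok_def)
  have "0 < sz \<and> sz \<le> m + nat \<lceil>\<kappa> * real K\<rceil>"
  proof (cases "nodes = 0")
    case False
    have "0 < \<kappa> * (real tot / real nodes)" using False st assms(2) by simp
    moreover have "real tot \<le> real K * real nodes" using st(2) by (metis of_nat_le_iff of_nat_mult)
    then have "\<kappa> * (real tot / real nodes) \<le> \<kappa> * real K"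
      using False assms(2) by (intro mult_left_mono) (simp_all add: divide_le_eq)
    then have "nat \<lceil>\<kappa> * (real tot / real nodes)\<rceil> \<le> nat \<lceil>\<kappa> * real K\<rceil>"
      by (intro nat_mono ceiling_mono)
    ultimately show ?thesis using False by (simp add: sz_def)
  qed (use assms(3) in \<open>simp add: sz_def\<close>)
  then show "0 < sz" "sz \<le> m + nat \<lceil>\<kappa> * real K\<rceil>" by auto
qed

text \<open>As the points are distinct, a part inherits at most as many centers as its parent has.\<close>

lemma flagged_part:
  assumes "mset (A @ B) = mset X'" and "map fst X' = map fst X" and "distinct (map fst X)"
    and "\<forall>p\<in>set X'. snd (snd p) \<longrightarrow> fst p \<in> set cs"
  shows "distinct (map fst A) \<and> flagged A \<le> length cs \<and> distinct (map fst B) \<and> flagged B \<le> length cs"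
proof -
  have part: "flagged Y \<le> length cs" if "distinct (map fst Y)" "set Y \<subseteq> set X'" for Y
  proof -
    let ?F = "filter (\<lambda>p. snd (snd p)) Y"
    have "distinct (map fst ?F)" using that(1) by (rule distinct_map_filter)
    then have "flagged Y = card (set (map fst ?F))"
      by (simp only: distinct_card flagged_def length_map)
    also have "\<dots> \<le> card (set cs)"
      by (rule card_mono) (use assms(4) that(2) in auto)
    also have "\<dots> \<le> length cs" by (rule card_length)
    finally show ?thesis .
  qed
  have "mset (map fst (A @ B)) = mset (map fst X)"
    using assms(1,2) by (metis mset_map)
  then have "distinct (map fst (A @ B))" using assms(3) mset_eq_imp_distinct_iff by blast
  moreover have "set (A @ B) = set X'" using assms(1) by (rule mset_eq_setD)
  ultimately show ?thesis using part[of A] part[of B] by auto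
qed

text \<open>The work at a node is linear in its size, and the parts have at most 4/5 of its points. So a
  node with at most \<open>(5/4)^h\<close> points needs time and space \<open>C N (h + 1)\<close>.\<close>

lemma run_buildM:
  fixes P :: srt_params
  assumes pos: "\<omega>1 P > 0" "0 < \<omega>3 P" "\<omega>3 P < 1" "\<omega>4 P > 0" "n0 P > 0" "\<kappa> P > 0"
  shows "\<exists>K C. \<forall>\<epsilon> M rnd perc (X :: 'd::finite sample list) st h.
      (\<forall>k. perc k \<in> {37..62}) \<and> X \<noteq> [] \<and> distinct (map fst X) \<and> flagged X \<le> K \<and> state_ok K st \<and>
      4 ^ h * length X \<le> 5 ^ h \<longrightarrow>
      run (buildM P \<epsilon> M rnd perc X st) (C * length X * (h + 1))
        (\<lambda>(T, st'). state_ok K st' \<and> max_centers T \<le> K \<and> depth T \<le> h)"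
proof -
  obtain K where K: "K > 0" and ex: "\<forall>n. \<exists>C. \<forall>(inh :: (real^'d) list) sr.
      sr \<noteq> [] \<and> set inh \<subseteq> fst ` set sr \<and> length inh \<le> K \<and> length sr \<le> n \<longrightarrow>
      run (exploreM P inh sr) C (\<lambda>g. snd g \<noteq> [] \<and> length (snd g) \<le> K)"
    using run_exploreM[OF pos(1-3)] by blast
  \<comment> \<open>\<open>sz0\<close> bounds the requested sizes at the root and elsewhere. A
    sample can be larger only because of its inherited centers, of which there are at most
    \<open>K\<close>; \<open>n\<close> covers both.\<close>
  define sz0 where "sz0 = n0 P + nat \<lceil>\<kappa> P * real K\<rceil>"
  define n where "n = K + sz0"
  obtain Ce where Ce: "\<And>(inh :: (real^'d) list) sr.
      \<lbrakk>sr \<noteq> []; set inh \<subseteq> fst ` set sr; length inh \<le> K; length sr \<le> n\<rbrakk> \<Longrightarrow>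
      run (exploreM P inh sr) Ce (\<lambda>g. snd g \<noteq> [] \<and> length (snd g) \<le> K)"
    using ex[rule_format, of n] by blast
  obtain Cd where Cd: "\<And>sr :: 'd sample list. \<lbrakk>sr \<noteq> []; length sr \<le> n\<rbrakk> \<Longrightarrow>
      run (directionM sr) Cd (\<lambda>_. True)"
    using run_directionM[of n] by blast
  define Cs where "Cs = 12 * sz0 + 40"
  define Cu where "Cu = K * (4 * CARD('d) + 10) + 20"
  define Cp where "Cp = 2 * CARD('d) + 10100"
  \<comment> \<open>Collects the costs that do not grow with the node, 75 being a generous value for
    the single steps, and 5 units per point: 3 for the maximal residual and 1 for each length of a
    part.\<close>
  define C1 where "C1 = Ce + Cu * (n + 1) + K + Cd + 80"
  define C where "C = C1 + Cs + Cu + Cp"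
  have main: "run (buildM P \<epsilon> M rnd perc X st) (C * length X * (h + 1))
        (\<lambda>(T, st'). state_ok K st' \<and> max_centers T \<le> K \<and> depth T \<le> h)"
    if perc: "\<forall>k. perc k \<in> {37..62}" and "X \<noteq> []" "distinct (map fst X)" "flagged X \<le> K" "state_ok K st"
      "4 ^ h * length X \<le> 5 ^ h"
    for \<epsilon> M rnd perc st h and X :: "'d sample list"
    using that(2-)
  proof (induction h arbitrary: X st rule: less_induct)
    case (less h)
    let ?N = "length X"
    have N: "1 \<le> ?N" using less.prems(1) by (simp add: Suc_le_eq)
    obtain pos nodes total where st: "st = (pos, nodes, total)" by (cases st)
    define sz where "sz = (if nodes = 0 then n0 P else nat \<lceil>\<kappa> P * (real total / real nodes)\<rceil>)"
    have sz: "0 < sz" "sz \<le> sz0"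
      using sample_size_bounds[of K pos nodes total "\<kappa> P" "n0 P"] less.prems(4) assms(5,6) st
      by (simp_all add: sz_def sz0_def)
    have sparsify: "run (sparsifyM rnd pos sz X) (Cs * ?N)
      (\<lambda>(cs, S, pos'). length cs \<le> K \<and> set cs \<subseteq> fst ` set S \<and> S \<noteq> [] \<and> length S \<le> n)"
    proof (rule run_weaken, rule run_mono[OF run_sparsifyM[OF order_refl N less.prems(1) sz(1)]])
      show "(12 * sz + 40) * ?N \<le> Cs * ?N" using sz by (simp add: Cs_def)
    qed (use less.prems(3) sz in \<open>auto simp: flagged_def n_def\<close>)
    have subtree: "run (buildM P \<epsilon> M rnd perc Y st') (C * length Y * h)
        (\<lambda>(T, st'). state_ok K st' \<and> max_centers T \<le> K \<and> Suc (depth T) \<le> h)"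
      if "5 * length Y \<le> 4 * ?N" "1 \<le> length Y" "2 \<le> ?N" "distinct (map fst Y)" "flagged Y \<le> K"
        "state_ok K st'" for st' and Y :: "'d sample list"
    proof -
      \<comment> \<open>The height 0 admits one point only, whereas a split node has at least
        two.\<close>
      have "h \<noteq> 0" using less.prems(5) that(3) by (cases h) auto
      then obtain h' where h: "h = Suc h'" using not0_implies_Suc by blast
      have "5 * (4 ^ h' * length Y) \<le> 4 ^ h' * (4 * ?N)" using that(1) by simp
      also have "\<dots> \<le> 5 * 5 ^ h'" using less.prems(5) by (simp add: h mult_ac)
      finally have "4 ^ h' * length Y \<le> 5 ^ h'" by simp
      then have "run (buildM P \<epsilon> M rnd perc Y st') (C * length Y * (h' + 1))
          (\<lambda>(T, st'). state_ok K st' \<and> max_centers T \<le> K \<and> depth T \<le> h')"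
        by (intro less.IH) (use that h in auto)
      then show ?thesis by (auto simp: h elim!: run_weaken)
    qed
    have recurse: "run (do {
          (l, st1) \<leftarrow> buildM P \<epsilon> M rnd perc A st';
          (r, st2) \<leftarrow> buildM P \<epsilon> M rnd perc B st1;
          step 1 9 (Node g w c l r, st2) })
        (C * ?N * h + 10)
        (\<lambda>(T, st'). state_ok K st' \<and> max_centers T \<le> K \<and> depth T \<le> h)"
      if "5 * length A \<le> 4 * ?N" "1 \<le> length A" "distinct (map fst A)" "flagged A \<le> K"
        "5 * length B \<le> 4 * ?N" "1 \<le> length B" "distinct (map fst B)" "flagged B \<le> K"
        "length A + length B = ?N" "state_ok K st'" "length (snd g) \<le> K"
      for st' w c and g :: "'d approx" and A B :: "'d sample list"
    proof -
      have N2: "2 \<le> ?N" using that by linarith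
      note A = subtree[OF that(1,2) N2 that(3,4,10)] and B = subtree[OF that(5,6) N2 that(7,8)]
      \<comment> \<open>The parts share the points of the node, so together they get the bound of
        \<open>?N\<close> points with one level less. The 10 is the assembly of the node.\<close>
      have "C * length A * h + (C * length B * h + (1 + 9)) = C * (length A + length B) * h + 10"
        by (simp add: algebra_simps)
      then have bound: "C * length A * h + (C * length B * h + (1 + 9)) \<le> C * ?N * h + 10"
        using that(9) by simp
      show ?thesis
        by (rule run_mono[OF _ bound], rule run_bind[OF A], clarify, rule run_bind[OF B], assumption, clarify,
            rule run_step) (use that(11) in auto)
    qed
    have "run (buildM P \<epsilon> M rnd perc X st)
        (1 + 1 + (4 + 0 + (Cs * ?N + (Ce + (Cu * ?N + (Cu * (n + 1) + (K + 1 + (2 + 2 + (Cd + (1 + 0 + (Cp * ?N +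
          (?N * (1 + 2) + 1 + (2 + 0 + (?N + 1 + (?N + 1 + (5 + 0 + (1 + 6 + (C * ?N * h + 10))))))))))))))))))
        (\<lambda>(T, st'). state_ok K st' \<and> max_centers T \<le> K \<and> depth T \<le> h)"
      unfolding st
    proof (subst buildM.simps, rule run_bind_step, simp only: prod.case sz_def[symmetric], rule run_bind_step,
        rule run_bind[OF sparsify], clarify)
      fix cs pos' and S :: "'d sample list"
      assume S: "length cs \<le> K" "set cs \<subseteq> fst ` set S" "S \<noteq> []" "length S \<le> n"
      have Sn: "length S \<le> n + 1" "1 \<le> n + 1" using S(4) by simp_all
      note explore = Ce[OF S(3,2,1,4)]
      show "run (do {
          g \<leftarrow> exploreM P cs S;
          X' \<leftarrow> updateM g X;
          sr' \<leftarrow> updateM g S;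
          nc \<leftarrow> lenM (snd g);
          (nodes', total') \<leftarrow> step 2 2 (nodes + 1, total + nc);
          w \<leftarrow> directionM sr';
          p \<leftarrow> step 1 0 (perc nodes);
          (c, A, B) \<leftarrow> splitM p w X';
          err \<leftarrow> maxM (\<lambda>(x, r, b). step 1 0 \<bar>r\<bar>) X';
          accurate \<leftarrow> step 2 0 (err / M \<le> \<epsilon>);
          nA \<leftarrow> lenM A;
          nB \<leftarrow> lenM B;
          lacking \<leftarrow> step 5 0 (real (min nA nB) < \<omega>4 P * (real total' / real nodes'));
          if accurate \<or> lacking
          then step 1 6 (Leaf g (\<not> accurate), pos', nodes', total')
          else do {
            (l, st1) \<leftarrow> buildM P \<epsilon> M rnd perc A (pos', nodes', total');
            (r, st2) \<leftarrow> buildM P \<epsilon> M rnd perc B st1;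
            step 1 9 (Node g w c l r, st2) } })
        (Ce + (Cu * ?N + (Cu * (n + 1) + (K + 1 + (2 + 2 + (Cd + (1 + 0 + (Cp * ?N +
          (?N * (1 + 2) + 1 + (2 + 0 + (?N + 1 + (?N + 1 + (5 + 0 + (1 + 6 + (C * ?N * h + 10)))))))))))))))
        (\<lambda>(T, st'). state_ok K st' \<and> max_centers T \<le> K \<and> depth T \<le> h)"
      proof (rule run_bind[OF explore], elim conjE)
        fix g :: "'d approx"
        assume g: "snd g \<noteq> []" "length (snd g) \<le> K"
        have st': "state_ok K (pos', nodes + 1, total + length (snd g))"
          by (rule state_ok_add) (use less.prems(4) st g in \<open>auto simp: Suc_le_eq\<close>)
        note updX = run_updateM[OF order_refl N g(2), folded Cu_def]
        note updS = run_updateM[OF Sn g(2), folded Cu_def]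
        show "run (do {
            X' \<leftarrow> updateM g X;
            sr' \<leftarrow> updateM g S;
            nc \<leftarrow> lenM (snd g);
            (nodes', total') \<leftarrow> step 2 2 (nodes + 1, total + nc);
            w \<leftarrow> directionM sr';
            p \<leftarrow> step 1 0 (perc nodes);
            (c, A, B) \<leftarrow> splitM p w X';
            err \<leftarrow> maxM (\<lambda>(x, r, b). step 1 0 \<bar>r\<bar>) X';
            accurate \<leftarrow> step 2 0 (err / M \<le> \<epsilon>);
            nA \<leftarrow> lenM A;
            nB \<leftarrow> lenM B;
            lacking \<leftarrow> step 5 0 (real (min nA nB) < \<omega>4 P * (real total' / real nodes'));
            if accurate \<or> lacking
            then step 1 6 (Leaf g (\<not> accurate), pos', nodes', total')
            else do {
              (l, st1) \<leftarrow> buildM P \<epsilon> M rnd perc A (pos', nodes', total');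
              (r, st2) \<leftarrow> buildM P \<epsilon> M rnd perc B st1;
              step 1 9 (Node g w c l r, st2) } })
          (Cu * ?N + (Cu * (n + 1) + (K + 1 + (2 + 2 + (Cd + (1 + 0 + (Cp * ?N +
            (?N * (1 + 2) + 1 + (2 + 0 + (?N + 1 + (?N + 1 + (5 + 0 + (1 + 6 + (C * ?N * h + 10))))))))))))))
          (\<lambda>(T, st'). state_ok K st' \<and> max_centers T \<le> K \<and> depth T \<le> h)"
        proof (rule run_bind[OF updX], rule run_bind[OF updS], rule run_bind[OF run_lenM[OF g(2)]], simp only:,
            rule run_bind_step, simp only: prod.case, rule run_bind[OF Cd])
          fix X' S' :: "'d sample list" and w
          assume X': "map fst X' = map fst X \<and> (\<forall>p\<in>set X'. snd (snd p) \<longrightarrow> fst p \<in> snd ` set (snd g))"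
            and S': "map fst S' = map fst S \<and> (\<forall>p\<in>set S'. snd (snd p) \<longrightarrow> fst p \<in> snd ` set (snd g))"
          have NX': "?N = length X'" using X' by (metis length_map)
          have lS': "length S' = length S" using S' by (metis length_map)
          show "S' \<noteq> []" "length S' \<le> n" using lS' S by auto
          have perc': "perc nodes \<in> {37..62}" using perc by blast
          note split = run_splitM[OF NX' N perc', folded Cp_def]
          have err: "run (maxM (\<lambda>(x, r, b). step 1 0 \<bar>r\<bar>) X') (?N * (1 + 2) + 1) (\<lambda>_. True)"
            by (rule run_weaken[OF run_maxM[where g = "\<lambda>p. \<bar>fst (snd p)\<bar>"]])
               (auto simp: NX' intro: run_mono[OF run_step])
          show "run (do {
              p \<leftarrow> step 1 0 (perc nodes);
              (c, A, B) \<leftarrow> splitM p w X';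
              err \<leftarrow> maxM (\<lambda>(x, r, b). step 1 0 \<bar>r\<bar>) X';
              accurate \<leftarrow> step 2 0 (err / M \<le> \<epsilon>);
              nA \<leftarrow> lenM A;
              nB \<leftarrow> lenM B;
              lacking \<leftarrow> step 5 0 (real (min nA nB) <
                \<omega>4 P * (real (total + length (snd g)) / real (nodes + 1)));
              if accurate \<or> lacking
              then step 1 6 (Leaf g (\<not> accurate), pos', nodes + 1, total + length (snd g))
              else do {
                (l, st1) \<leftarrow> buildM P \<epsilon> M rnd perc A (pos', nodes + 1, total + length (snd g));
                (r, st2) \<leftarrow> buildM P \<epsilon> M rnd perc B st1;
                step 1 9 (Node g w c l r, st2) } })
            (1 + 0 + (Cp * ?N +
              (?N * (1 + 2) + 1 + (2 + 0 + (?N + 1 + (?N + 1 + (5 + 0 + (1 + 6 + (C * ?N * h + 10)))))))))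
            (\<lambda>(T, st'). state_ok K st' \<and> max_centers T \<le> K \<and> depth T \<le> h)"
          proof (rule run_bind_step, rule run_bind[OF split], clarify, rule run_bind[OF err], rule run_bind_step)
            fix c and A B :: "'d sample list" and err
            assume AB: "mset (A @ B) = mset X'" and lA: "length A = (perc nodes * ?N + 99) div 100"
            have lAB: "length A + length B = ?N"
              using mset_eq_length[OF AB] NX' by simp
            then have l: "length A \<le> ?N" "length B \<le> ?N" by linarith+
            have flags: "distinct (map fst A) \<and> flagged A \<le> length (map snd (snd g)) \<and>
                distinct (map fst B) \<and> flagged B \<le> length (map snd (snd g))"
              by (rule flagged_part[OF AB _ less.prems(2)]) (use X' in auto)
            \<comment> \<open>An empty part therefore counts as lacking data, and the recursion only
              meets nonempty parts.\<close>
            have "0 < \<omega>4 P * (real (total + length (snd g)) / real (nodes + 1))"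
              using g assms(4) by (intro mult_pos_pos divide_pos_pos) (auto simp: add_nonneg_pos)
            then have enough: "1 \<le> length A \<and> 1 \<le> length B" if "\<not> real (min (length A) (length B)) <
                \<omega>4 P * (real (total + length (snd g)) / real (nodes + 1))"
              using that by (cases "length A = 0 \<or> length B = 0") auto
            show "run (do {
                nA \<leftarrow> lenM A;
                nB \<leftarrow> lenM B;
                lacking \<leftarrow> step 5 0 (real (min nA nB) <
                  \<omega>4 P * (real (total + length (snd g)) / real (nodes + 1)));
                if err / M \<le> \<epsilon> \<or> lacking
                then step 1 6 (Leaf g (\<not> err / M \<le> \<epsilon>), pos', nodes + 1, total + length (snd g))
                else do {
                  (l, st1) \<leftarrow> buildM P \<epsilon> M rnd perc A (pos', nodes + 1, total + length (snd g));
                  (r, st2) \<leftarrow> buildM P \<epsilon> M rnd perc B st1;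
                  step 1 9 (Node g w c l r, st2) } })
              (?N + 1 + (?N + 1 + (5 + 0 + (1 + 6 + (C * ?N * h + 10)))))
              (\<lambda>(T, st'). state_ok K st' \<and> max_centers T \<le> K \<and> depth T \<le> h)"
            proof (rule run_bind[OF run_lenM[OF l(1)]], simp only:, rule run_bind[OF run_lenM[OF l(2)]], simp only:,
                rule run_bind_step, rule run_if, rule run_step)
              show "case (Leaf g (\<not> err / M \<le> \<epsilon>), pos', nodes + 1, total + length (snd g)) of
                  (T, st') \<Rightarrow> state_ok K st' \<and> max_centers T \<le> K \<and> depth T \<le> h"
                using st' g by simp
            next
              assume "\<not> (err / M \<le> \<epsilon> \<or> real (min (length A) (length B)) <
                  \<omega>4 P * (real (total + length (snd g)) / real (nodes + 1)))"
              then have ne: "1 \<le> length A" "1 \<le> length B" using enough by blast+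
              show "run (do {
                  (l, st1) \<leftarrow> buildM P \<epsilon> M rnd perc A (pos', nodes + 1, total + length (snd g));
                  (r, st2) \<leftarrow> buildM P \<epsilon> M rnd perc B st1;
                  step 1 9 (Node g w c l r, st2) })
                (C * ?N * h + 10)
                (\<lambda>(T, st'). state_ok K st' \<and> max_centers T \<le> K \<and> depth T \<le> h)"
                by (rule recurse) (use ne flags g st' lAB split_sizes[OF perc' lA lAB ne] in auto)
            qed
          qed
        qed
      qed
    qed
    then show ?case
    proof (rule run_mono)
      have "Ce + Cu * (n + 1) + K + Cd + 75 + 5 * ?N \<le> C1 * ?N"
        using const_le[OF N, of "Ce + Cu * (n + 1) + K + Cd + 75"] unfolding C1_def distrib_right by linarith
      then have "Ce + Cu * (n + 1) + K + Cd + 75 + 5 * ?N + (Cs * ?N + Cu * ?N + Cp * ?N + C * ?N * h) \<le>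
          C1 * ?N + (Cs * ?N + Cu * ?N + Cp * ?N + C * ?N * h)" by (rule add_right_mono)
      also have "\<dots> = C * ?N * (h + 1)" by (simp add: C_def algebra_simps)
      finally show "1 + 1 + (4 + 0 + (Cs * ?N + (Ce + (Cu * ?N + (Cu * (n + 1) + (K + 1 + (2 + 2 + (Cd + (1 + 0 + (Cp * ?N +
          (?N * (1 + 2) + 1 + (2 + 0 + (?N + 1 + (?N + 1 + (5 + 0 + (1 + 6 + (C * ?N * h + 10)))))))))))))))))
          \<le> C * ?N * (h + 1)"
        by simp
    qed
  qed
  show ?thesis
    by (rule exI[of _ K], rule exI[of _ C]) (use main in blast)
qed

section \<open>Trees and forests\<close>

text \<open>For \<open>N \<ge> 1\<close> the least \<open>h\<close> with
  \<open>N \<le> (5/4)^h\<close>; the base is the reciprocal of the ratio in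
  \<open>split_sizes\<close>.\<close>

definition levels :: "nat \<Rightarrow> nat" where
  "levels N = nat \<lceil>log (5/4) (real N)\<rceil>"

lemma power_levels:
  assumes "1 \<le> N" shows "4 ^ levels N * N \<le> 5 ^ levels N"
proof -
  have "real N = (5/4) powr (log (5/4) (real N))" using assms by simp
  also have "\<dots> \<le> (5/4) powr (real (levels N))"
    unfolding levels_def by (intro powr_mono real_nat_ceiling_ge) simp
  also have "\<dots> = (5/4) ^ levels N" by (rule powr_realpow) simp
  finally have "real (4 ^ levels N * N) \<le> real (5 ^ levels N)"
    by (simp add: power_divide field_simps)
  then show ?thesis by (simp only: of_nat_le_iff)
qed

text \<open>Apart from the change of base, the summand 2 pays for rounding up and for the
  \<open>+ 1\<close>, each at most \<open>log 2 (real N)\<close> because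
  \<open>N \<ge> 2\<close>.\<close>

lemma levels_le:
  assumes "2 \<le> N" shows "real (levels N + 1) \<le> (1 / log 2 (5/4) + 2) * log 2 (real N)"
proof -
  have log: "log (5/4) (real N) = 1 / log 2 (5/4) * log 2 (real N)"
    using assms by (subst log_base_change[of 2]) auto
  have "log 2 2 \<le> log 2 (real N)" using assms by (subst log_le_cancel_iff) auto
  then have ge1: "1 \<le> log 2 (real N)" by simp
  have "0 \<le> log (5/4) (real N)" using assms by simp
  then have "real (levels N) \<le> log (5/4) (real N) + 1" unfolding levels_def by linarith
  then show ?thesis using ge1 unfolding log by (simp add: distrib_right)
qed

section \<open>Prediction and training with a single tree\<close>

lemma run_srt_predictM:
  fixes x :: "real^'d::finite"
  assumes "max_centers T \<le> K"
  shows "run (srt_predictM T x) ((depth T + 1) * (K * (3 * CARD('d) + 7) + 2 * CARD('d) + 5)) (\<lambda>_. True)"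
  using assms
proof (induction T)
  case (Leaf g b)
  then have g: "length (snd g) \<le> K" by simp
  show ?case unfolding srt_predictM.simps
    by (rule run_mono, rule run_bind[OF run_evalM[OF g]], rule run_step) simp_all
next
  case (Node g w c l r)
  let ?c = "K * (3 * CARD('d) + 7) + 2 * CARD('d) + 5"
  let ?h = "max (depth l) (depth r) + 1"
  have g: "length (snd g) \<le> K" using Node.prems by simp
  have l: "run (srt_predictM l x) (?h * ?c) (\<lambda>_. True)"
    by (rule run_mono[OF Node.IH(1) mult_le_mono1]) (use Node.prems in auto)
  have r: "run (srt_predictM r x) (?h * ?c) (\<lambda>_. True)"
    by (rule run_mono[OF Node.IH(2) mult_le_mono1]) (use Node.prems in auto)
  have child: "run (if t \<le> c then srt_predictM l x else srt_predictM r x) (?h * ?c) (\<lambda>_. True)" for t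
    using l r by simp
  show ?case unfolding srt_predictM.simps
    by (rule run_mono, rule run_bind[OF run_evalM[OF g]], rule run_bind[OF run_innerM], rule run_bind[OF child],
        rule run_step) simp_all
qed

lemma run_srt_trainM:
  fixes P :: srt_params
  assumes pos: "\<omega>1 P > 0" "0 < \<omega>3 P" "\<omega>3 P < 1" "\<omega>4 P > 0" "n0 P > 0" "\<kappa> P > 0"
  shows "\<exists>K C. \<forall>\<epsilon> rnd perc (xs :: (real^'d::finite) list) f.
      (\<forall>k. perc k \<in> {37..62}) \<and> xs \<noteq> [] \<and> distinct xs \<longrightarrow>
      run (srt_trainM P \<epsilon> rnd perc (map (\<lambda>x. (x, f x)) xs)) (C * length xs * (levels (length xs) + 1))
        (\<lambda>T. max_centers T \<le> K \<and> depth T \<le> levels (length xs))"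
proof -
  from run_buildM[OF pos] obtain K C where KC: "\<And>\<epsilon> M rnd perc (X :: 'd sample list) st h.
      \<lbrakk>\<forall>k. perc k \<in> {37..62}; X \<noteq> []; distinct (map fst X); flagged X \<le> K; state_ok K st;
       4 ^ h * length X \<le> 5 ^ h\<rbrakk> \<Longrightarrow>
      run (buildM P \<epsilon> M rnd perc X st) (C * length X * (h + 1))
        (\<lambda>(T, st'). state_ok K st' \<and> max_centers T \<le> K \<and> depth T \<le> h)"
    by blast
  have "run (srt_trainM P \<epsilon> rnd perc (map (\<lambda>x. (x, f x)) xs)) ((C + 11) * length xs * (levels (length xs) + 1))
        (\<lambda>T. max_centers T \<le> K \<and> depth T \<le> levels (length xs))"
    if perc: "\<forall>k. perc k \<in> {37..62}" and xs: "xs \<noteq> []" "distinct xs"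
    for \<epsilon> rnd perc f and xs :: "(real^'d) list"
  proof -
    let ?N = "length xs" and ?h = "levels (length xs)"
    let ?D = "map (\<lambda>x. (x, f x)) xs"
    define X :: "'d sample list" where "X = map (\<lambda>p. (fst p, snd p, False)) ?D"
    have N: "1 \<le> ?N" using xs by (simp add: Suc_le_eq)
    have X: "length X = ?N" "map fst X = xs" "flagged X = 0"
      by (simp_all add: X_def o_def flagged_def filter_map)
    have mx: "run (maxM (\<lambda>(x, y). step 1 0 \<bar>y\<bar>) ?D) (?N * (1 + 2) + 1) (\<lambda>_. True)"
      by (rule run_weaken[OF run_maxM[where g = "\<lambda>p. \<bar>snd p\<bar>"]]) (auto intro: run_mono[OF run_step])
    have mX: "run (mapM (\<lambda>(x, y). step 1 3 (x, y, False)) ?D) (?N * (4 + 2) + 1) (\<lambda>v. v = X)"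
      unfolding X_def by (rule run_mapM) (auto intro: run_mono[OF run_step])
    have build: "run (buildM P \<epsilon> M rnd perc X (0, 0, 0)) (C * ?N * (?h + 1))
        (\<lambda>(T, st'). state_ok K st' \<and> max_centers T \<le> K \<and> depth T \<le> ?h)" for M
      unfolding X(1)[symmetric]
      by (rule KC[OF perc]) (use X xs power_levels[OF N] in \<open>auto simp: state_ok_def\<close>)
    \<comment> \<open>The two passes over the data cost 3 and 6 units per point and 1 unit each at
      the end, at most 11 per point in total.\<close>
    have arith: "?N * (1 + 2) + 1 + (?N * (4 + 2) + 1 + (C * ?N * (?h + 1) + 0)) \<le> (C + 11) * ?N * (?h + 1)"
      using N by (simp add: algebra_simps)
    show ?thesis unfolding srt_trainM_def
      by (rule run_mono[OF _ arith], rule run_bind[OF mx], rule run_bind[OF mX], simp only:,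
          rule run_bind[OF build], clarify, rule run_ret) simp
  qed
  then show ?thesis by blast
qed

text \<open>Aggregating \<open>n\<close> predictions takes a constant number of passes over lists of
  length at most \<open>n\<close>. The overhead per tree is thus a constant, for which 40 is
  generous.\<close>

lemma run_srf_predictM:
  assumes "\<And>T. T \<in> set Ts \<Longrightarrow> run (srt_predictM T x) b (\<lambda>_. True)" and "length Ts = n" and "1 \<le> n"
  shows "run (srf_predictM Ts x) (n * (b + 40)) (\<lambda>_. True)"
proof -
  have ss: "run (mapM (\<lambda>T. srt_predictM T x) Ts) (n * (b + 2) + 1) (\<lambda>ss. length ss = n)"
    unfolding assms(2)[symmetric]
    by (rule run_weaken[OF run_mapM_rel[OF assms(1)]]) (auto dest: list_all2_lengthD)
  have sum: "run (sumM (step 1 0) ys) (n * (1 + 2) + 1) (\<lambda>_. True)" if "length ys \<le> n" for ys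
    by (rule run_sumM_any[OF run_mono[OF run_step] that]) simp_all
  have sum_fst: "run (sumM (\<lambda>(s, v). step 1 0 s) ys) (n * (1 + 2) + 1) (\<lambda>_. True)"
    if "length ys \<le> n" for ys :: "(real \<times> real) list"
    by (rule run_sumM_any[OF _ that]) (auto intro: run_mono[OF run_step])
  have sum_snd: "run (sumM (\<lambda>(s, v). step 1 0 v) ys) (n * (1 + 2) + 1) (\<lambda>_. True)"
    if "length ys \<le> n" for ys :: "(real \<times> real) list"
    by (rule run_sumM_any[OF _ that]) (auto intro: run_mono[OF run_step])
  have filt: "run (filterM (\<lambda>(s, v). step 1 0 (v < m)) ys) (n * (1 + 3) + 1) (\<lambda>zs. length zs \<le> n)"
    if "length ys \<le> n" for m and ys :: "(real \<times> real) list"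
    by (rule run_weaken[OF run_filterM[OF _ that, where q = "\<lambda>p. snd p < m"]])
       (use that in \<open>auto intro: run_mono[OF run_step] order_trans[OF length_filter_le]\<close>)
  have vs: "run (mapM (\<lambda>s. step 2 2 (s, (s - m)\<^sup>2)) ys) (n * (4 + 2) + 1) (\<lambda>zs. length zs \<le> n)"
    if "length ys = n" for m :: real and ys
    by (rule run_weaken[OF run_mapM[where g = "\<lambda>s. (s, (s - m)\<^sup>2)"]])
       (use that in \<open>auto intro: run_mono[OF run_step]\<close>)
  have len: "length ys = n \<Longrightarrow> length ys \<le> n" for ys :: "real list" by simp
  show ?thesis unfolding srf_predictM_def
    by (rule run_mono, rule run_bind[OF ss], frule len, rule run_bind[OF run_lenM], assumption,
        rule run_bind[OF sum], assumption, rule run_bind_step, rule run_bind[OF vs], assumption,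
        rule run_bind[OF sum_snd], assumption, rule run_bind_step, rule run_bind[OF filt], assumption,
        rule run_bind[OF run_lenM], assumption, rule run_bind[OF sum_fst], assumption, rule run_step)
      (use assms(3) in \<open>simp_all add: algebra_simps\<close>)
qed

theorem theorem5p7:
  fixes P :: srt_params
  assumes "\<omega>1 P > 0" and "\<omega>2 P > 0" and "0 < \<omega>3 P" and "\<omega>3 P < 1" and "\<omega>4 P > 0"
    and "n0 P > 0" and "\<kappa> P > 0"
  shows "\<exists>Time Space Pred :: nat \<Rightarrow> real.
    Time \<in> O(\<lambda>N. real N * log 2 (real N)) \<and>
    Space \<in> O(\<lambda>N. real N * log 2 (real N)) \<and>
    Pred \<in> O(\<lambda>N. log 2 (real N)) \<and>
    (\<forall>(\<Omega> :: (real^'d::finite) set) xs f \<epsilon> D.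
       convex \<Omega> \<and> xs \<noteq> [] \<and> distinct xs \<and> set xs \<subseteq> \<Omega> \<and> \<epsilon> > 0 \<and> D = map (\<lambda>x. (x, f x)) xs \<longrightarrow>
       (\<forall>rnd. \<exists>T t s.
          srt_trainM P \<epsilon> rnd median_splits D = Some (T, t, s) \<and>
          real t \<le> Time (length xs) \<and> real s \<le> Space (length xs) \<and>
          (\<forall>x\<in>\<Omega>. \<exists>y t s. srt_predictM T x = Some (y, t, s) \<and> real t \<le> Pred (length xs))) \<and>
       (\<forall>nt rnds percs. nt \<ge> 1 \<and> (\<forall>i k. percs i k \<in> {37..62}) \<longrightarrow>
          (\<exists>Ts t s.
             srf_trainM P \<epsilon> rnds percs nt D = Some (Ts, t, s) \<and>
             real t \<le> real nt * Time (length xs) \<and> real s \<le> real nt * Space (length xs) \<and>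
             (\<forall>x\<in>\<Omega>. \<exists>y t s. srf_predictM Ts x = Some (y, t, s) \<and>
                real t \<le> real nt * Pred (length xs)))))"
proof -
  obtain K C where train: "\<And>\<epsilon> rnd perc (xs :: (real^'d) list) f.
      \<lbrakk>\<forall>k. perc k \<in> {37..62}; xs \<noteq> []; distinct xs\<rbrakk> \<Longrightarrow>
      run (srt_trainM P \<epsilon> rnd perc (map (\<lambda>x. (x, f x)) xs)) (C * length xs * (levels (length xs) + 1))
        (\<lambda>T. max_centers T \<le> K \<and> depth T \<le> levels (length xs))"
    using run_srt_trainM[OF assms(1,3-7)] by blast
  define c where "c = K * (3 * CARD('d) + 7) + 2 * CARD('d) + 5"
  \<comment> \<open>The summands 3 here and 40 in \<open>Pred\<close> pay the overhead of a forest,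
    tree by tree: 2 units for each entry of the list of trees and 1 for its end, and the aggregation
    of predictions. So the forest costs are bounded by \<open>nt\<close> times these very
    functions.\<close>
  define Time where "Time N = C * N * (levels N + 1) + 3" for N
  define Pred where "Pred N = (levels N + 1) * c + 40" for N
  define a where "a = 1 / log 2 (5/4) + (2 :: real)"
  have log1: "1 \<le> log 2 (real N)" if "2 \<le> N" for N
  proof -
    have "log 2 2 \<le> log 2 (real N)" using that by (subst log_le_cancel_iff) auto
    then show ?thesis by simp
  qed
  \<comment> \<open>The estimate starts at \<open>N = 2\<close>, where the logarithm reaches 1 and
    can absorb additive constants; at \<open>N = 1\<close> it vanishes.\<close>
  have bigT: "(\<lambda>N. real (Time N)) \<in> O(\<lambda>N. real N * log 2 (real N))"
  proof (rule bigoI[where c = "real C * a + 3"], rule eventually_mono[OF eventually_ge_at_top[of 2]])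
    fix N :: nat assume N: "2 \<le> N"
    have "real C * real N * real (levels N + 1) \<le> real C * real N * (a * log 2 (real N))"
      using levels_le[OF N] unfolding a_def by (intro mult_left_mono) auto
    moreover have "1 * 1 \<le> real N * log 2 (real N)" using N log1[OF N] by (intro mult_mono) auto
    ultimately show "norm (real (Time N)) \<le> (real C * a + 3) * norm (real N * log 2 (real N))"
      using N log1[OF N] by (simp add: Time_def algebra_simps)
  qed
  have bigP: "(\<lambda>N. real (Pred N)) \<in> O(\<lambda>N. log 2 (real N))"
  proof (rule bigoI[where c = "a * real c + 40"], rule eventually_mono[OF eventually_ge_at_top[of 2]])
    fix N :: nat assume N: "2 \<le> N"
    have "real (levels N + 1) * real c \<le> (a * log 2 (real N)) * real c"
      using levels_le[OF N] unfolding a_def by (intro mult_right_mono) auto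
    then show "norm (real (Pred N)) \<le> (a * real c + 40) * norm (log 2 (real N))"
      using log1[OF N] by (simp add: Pred_def algebra_simps)
  qed
  have predict: "run (srt_predictM T x) ((levels N + 1) * c) (\<lambda>_. True)"
    if "max_centers T \<le> K \<and> depth T \<le> levels N" for T N and x :: "real^'d"
    unfolding c_def by (rule run_mono[OF run_srt_predictM mult_le_mono1]) (use that in auto)
  \<comment> \<open>\<open>Time\<close> also serves as the witness for space, because
    \<open>run\<close> bounds both by the same number.\<close>
  show ?thesis
  proof (rule exI[of _ "\<lambda>N. real (Time N)"], rule exI[of _ "\<lambda>N. real (Time N)"],
      rule exI[of _ "\<lambda>N. real (Pred N)"], intro conjI bigT bigP allI impI; elim conjE)
    fix \<Omega> :: "(real^'d) set" and xs and f :: "real^'d \<Rightarrow> real" and \<epsilon> D rnd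
    assume xs: "xs \<noteq> []" "distinct xs" and D: "D = map (\<lambda>x. (x, f x)) xs"
    \<comment> \<open>The median is percentile 50, hence within the range from 37 to 62 that
      \<open>train\<close> requires.\<close>
    have "run (srt_trainM P \<epsilon> rnd median_splits D) (Time (length xs))
        (\<lambda>T. max_centers T \<le> K \<and> depth T \<le> levels (length xs))"
      unfolding D by (rule run_mono[OF train]) (use xs in \<open>auto simp: Time_def\<close>)
    then obtain T t s where T: "srt_trainM P \<epsilon> rnd median_splits D = Some (T, t, s)"
      "t \<le> Time (length xs)" "s \<le> Time (length xs)" "max_centers T \<le> K \<and> depth T \<le> levels (length xs)"
      unfolding run_def by blast
    have "run (srt_predictM T x) (Pred (length xs)) (\<lambda>_. True)" for x
      by (rule run_mono[OF predict[OF T(4)]]) (simp add: Pred_def)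
    then have "\<exists>y t s. srt_predictM T x = Some (y, t, s) \<and> t \<le> Pred (length xs)" for x
      unfolding run_def by blast
    with T(1-3) show "\<exists>T t s. srt_trainM P \<epsilon> rnd median_splits D = Some (T, t, s) \<and>
          real t \<le> real (Time (length xs)) \<and> real s \<le> real (Time (length xs)) \<and>
          (\<forall>x\<in>\<Omega>. \<exists>y t s. srt_predictM T x = Some (y, t, s) \<and> real t \<le> real (Pred (length xs)))"
      unfolding of_nat_le_iff by blast
  next
    fix \<Omega> :: "(real^'d) set" and xs and f :: "real^'d \<Rightarrow> real" and \<epsilon> D and nt :: nat and rnds percs :: "nat \<Rightarrow> nat \<Rightarrow> nat"
    assume xs: "xs \<noteq> []" "distinct xs" and D: "D = map (\<lambda>x. (x, f x)) xs"
      and nt: "1 \<le> nt" and percs: "\<forall>i k. percs i k \<in> {37..62}"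
    let ?N = "length xs"
    let ?good = "\<lambda>T. max_centers T \<le> K \<and> depth T \<le> levels ?N"
    have "run (srt_trainM P \<epsilon> (rnds i) (if i = 0 then median_splits else percs i) D)
        (C * ?N * (levels ?N + 1)) ?good" for i
      unfolding D by (rule train) (use xs percs in auto)
    then have "run (srf_trainM P \<epsilon> rnds percs nt D)
        (length [0..<nt] * (C * ?N * (levels ?N + 1) + 2) + 1) (list_all2 (\<lambda>_. ?good) [0..<nt])"
      unfolding srf_trainM_def by (intro run_mapM_rel)
    then have "run (srf_trainM P \<epsilon> rnds percs nt D) (nt * Time ?N) (list_all2 (\<lambda>_. ?good) [0..<nt])"
      by (rule run_mono) (use nt in \<open>simp add: Time_def algebra_simps\<close>)
    then obtain Ts t s where Ts: "srf_trainM P \<epsilon> rnds percs nt D = Some (Ts, t, s)"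
      "t \<le> nt * Time ?N" "s \<le> nt * Time ?N" "list_all2 (\<lambda>_. ?good) [0..<nt] Ts"
      unfolding run_def by blast
    have lTs: "length Ts = nt" using list_all2_lengthD[OF Ts(4)] by simp
    have good: "?good T" if "T \<in> set Ts" for T
    proof -
      obtain i where "i < length Ts" "T = Ts ! i"
        using \<open>T \<in> set Ts\<close> by (auto simp: in_set_conv_nth)
      with list_all2_nthD2[OF Ts(4)] show ?thesis by blast
    qed
    have "run (srf_predictM Ts x) (nt * Pred ?N) (\<lambda>_. True)" for x
      unfolding Pred_def by (rule run_srf_predictM[OF predict[OF good] lTs nt])
    then have "\<exists>y t s. srf_predictM Ts x = Some (y, t, s) \<and> t \<le> nt * Pred ?N" for x
      unfolding run_def by blast
    with Ts(1-3) show "\<exists>Ts t s. srf_trainM P \<epsilon> rnds percs nt D = Some (Ts, t, s) \<and>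
          real t \<le> real nt * real (Time ?N) \<and> real s \<le> real nt * real (Time ?N) \<and>
          (\<forall>x\<in>\<Omega>. \<exists>y t s. srf_predictM Ts x = Some (y, t, s) \<and> real t \<le> real nt * real (Pred ?N))"
      unfolding of_nat_mult[symmetric] of_nat_le_iff by blast
  qed
qed

end
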